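(* Let $R(z)=R_0+zC(I-zA)^{-1}B+\gamma(zI-\alpha)^{-1}\beta$ be an $m\times m$ rational matrix function with $A$ and $\alpha$ stable and with no poles and no zeros on the unit circle $\mathbb{T}$, and let \[ \Xi(z)=\Xi_0+\gamma(zI-\alpha)^{-1}\beta_1+zC_1(I-zA_0)^{-1}B_0D^{-1} \] be its left unitary factor, with $D,A_0,B_0,\Xi_0,C_1,\beta_1$ as defined in the context. Then rational bi-inner matrix functions $V(z)$ and $W(z)$ with $\Xi(z)=V(z)W^*(z)$ can be constructed as follows. Let $P_0$ be the solution of the Stein equation \[ P_0-A_0^*P_0A_0=C_1^*C_1,\quad\text{that is,}\quad P_0=\sum_{j=0}^\infty (A_0^* )^jC_1^*C_1A_0^j . \] Then there exist matrices $B_V$ and $D_V$ (with $D_V$ of size $m\times m$) such that \[ \begin{bmatrix}A_0^* & C_1^*\\ B_V^* & D_V^*\end{bmatrix}\begin{bmatrix}P_0&0\\0&I\end{bmatrix}\begin{bmatrix}A_0&B_V\\ C_1&D_V\end{bmatrix}=\begin{bmatrix}P_0&0\\0&I\end{bmatrix}. \] Moreover, the function \[ V(z)=D_V+zC_1(I-zA_0)^{-1}B_V \] is a bi-inner factor for $\Xi(z)$, and the function $W(z)$ defined by $W^*(z)=V^*(z)\Xi(z)$ is bi-inner too. Assume, in addition, that $A_0^*$ and $\alpha$ have no common eigenvalues and that the realization $\Xi(z)=\Xi_0+\gamma(zI-\alpha)^{-1}\beta_1+zC_1(I-zA_0)^{-1}B_0D^{-1}$ of $\Xi(z)$ is minimal.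 Let $P_1$ be the solution of \[ A_0^*P_1-P_1\alpha=-C_1^*\gamma, \] and set \[ D_W^*=D_V^*\Xi_0+B_V^*P_0B_0D^{-1},\qquad B_W^*=D_V^*\gamma+B_V^*P_1 . \] Then \[ W^*(z)=D_W^*+B_W^*(zI-\alpha)^{-1}\beta_1 . \]
   Context: All matrices are complex; a square matrix is stable if all its eigenvalues lie in the open unit disc. For a rational matrix function $F(z)$, $F^*(z)=F(1/\bar z)^*$. Zeros of a square rational matrix function are the poles of its inverse. A rational $m\times m$ matrix function is bi-inner if it has unitary values on $\mathbb{T}$ and no poles on the unit disc. Let $P_+$ and $P_-$ be the unique solutions of $P_+-A^*P_+A=C^*C$ and $P_--\alpha^*P_-\alpha=\gamma^*\gamma$. Put \[ \widetilde A=\begin{bmatrix}A^*& C^*\gamma\\0&\alpha\end{bmatrix},\quad \widetilde B=\begin{bmatrix}C^*R_0+A^*P_+B\\ \beta\end{bmatrix},\quad \widetilde C=\begin{bmatrix}B^*& R_0^*\gamma+\beta^*P_-\alpha\end{bmatrix},\quad \widetilde D=R_0^*R_0+B^*P_+B+\beta^*P_-\beta. \] Let $Q$ be the unique stabilizing solution of \[ Q-\widetilde AQ\widetilde A^*=(\widetilde B-\widetilde AQ\widetilde C^* )(\widetilde D-\widetilde CQ\widetilde C^* )^{-1}(\widetilde B^*-\widetilde CQ\widetilde A^* ), \] i.e. the Hermitian solution for which $\widetilde D-\widetilde CQ\widetilde C^*$ is positive definite and the matrix $A_0$ below is stable (such a $Q$ exists and is unique). Define \[ D=(\widetilde D-\widetilde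 CQ\widetilde C^* )^{1/2},\quad C_0=\widetilde B^*-\widetilde CQ\widetilde A^*,\quad B_0=\widetilde C^*,\quad A_0=\widetilde A^*-\widetilde C^*D^{-2}C_0, \] and $\Psi(z)=D+zD^{-1}C_0(I-z\widetilde A^* )^{-1}B_0$, a rational function with no poles and no zeros on the closed unit disc and with $R^*(z)R(z)=\Psi^*(z)\Psi(z)$. The left unitary factor of $R(z)$ is $\Xi(z)=R(z)\Psi(z)^{-1}$; it is unitary on $\mathbb{T}$. Let $Y$ be the unique solution of $Y-\alpha YA_0=\alpha\beta D^{-2}C_0$ and put \begin{align*} \Xi_0&=R_0D^{-1}-\gamma YA_0B_0D^{-1}-\gamma\beta D^{-2}C_0B_0D^{-1},\\ C_1&=\begin{bmatrix}C&0\end{bmatrix}-R_0D^{-2}C_0-\gamma YA_0^2-\gamma\beta D^{-2}C_0A_0,\\ \beta_1&=(\beta-YB_0)D^{-1}; \end{align*} with these matrices $\Xi(z)$ has the realization displayed in the claim. This realization is called minimal if the pairs $(\gamma,\alpha)$ and $(C_1,A_0)$ are observable and the pairs $(\alpha,\beta_1)$ and $(A_0,B_0)$ are controllable. *)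

theory Defs
  imports
    "Jordan_Normal_Form.Spectral_Radius"
    "Jordan_Normal_Form.Schur_Decomposition"
    "Jordan_Normal_Form.Gauss_Jordan_Elimination"
    "HOL-Computational_Algebra.Normalized_Fraction"
    "HOL-Computational_Algebra.Polynomial_Factorial"
    "HOL-Computational_Algebra.Field_as_Ring"
begin

subsection \<open>Matrices\<close>

notation mat_adjoint ("(_\<^sup>\<dagger>)" [1000] 1000)

text \<open>Only meaningful for invertible matrices.\<close>

definition minv :: "'a :: field mat \<Rightarrow> 'a mat" where
  "minv A = the (mat_inverse A)"

text \<open>Horizontal concatenation, the counterpart of \<open>@\<^sub>r\<close>.\<close>

definition append_cols :: "'a :: zero mat \<Rightarrow> 'a mat \<Rightarrow> 'a mat" (infixr \<open>@\<^sub>c\<close> 66) where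
  "M @\<^sub>c N = four_block_mat M N (0\<^sub>m 0 (dim_col M)) (0\<^sub>m 0 (dim_col N))"

definition stable_mat :: "complex mat \<Rightarrow> bool" where
  "stable_mat A \<longleftrightarrow> square_mat A \<and> spectrum A \<subseteq> {\<mu>. cmod \<mu> < 1}"

text \<open>The order on the complex numbers is the componentwise one restricted to equal imaginary
  parts, so the inequality below says that the quadratic form is real and positive.\<close>

definition pos_def_mat :: "complex mat \<Rightarrow> bool" where
  "pos_def_mat A \<longleftrightarrow> square_mat A \<and> A\<^sup>\<dagger> = A \<and>
     (\<forall>v \<in> carrier_vec (dim_row A). v \<noteq> 0\<^sub>v (dim_row A) \<longrightarrow> 0 < (A *\<^sub>v v) \<bullet>c v)"

definition unitary_mat :: "complex mat \<Rightarrow> bool" where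
  "unitary_mat U \<longleftrightarrow> square_mat U \<and> U\<^sup>\<dagger> * U = 1\<^sub>m (dim_row U) \<and> U * U\<^sup>\<dagger> = 1\<^sub>m (dim_row U)"

definition observable_pair :: "complex mat \<Rightarrow> complex mat \<Rightarrow> bool" where
  "observable_pair C A \<longleftrightarrow>
     (\<forall>x \<in> carrier_vec (dim_col A).
        (\<forall>k. (C * A ^\<^sub>m k) *\<^sub>v x = 0\<^sub>v (dim_row C)) \<longrightarrow> x = 0\<^sub>v (dim_col A))"

definition controllable_pair :: "complex mat \<Rightarrow> complex mat \<Rightarrow> bool" where
  "controllable_pair A B \<longleftrightarrow>
     LinearCombinations.module.span class_ring (module_vec TYPE(complex) (dim_row A))
       (\<Union>k. set (cols (A ^\<^sub>m k * B))) = carrier_vec (dim_row A)"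

subsection \<open>Scalar rational functions\<close>

text \<open>Rational functions are elements of the field of fractions of the polynomial ring, so that
  removable singularities play no role. \<open>quot_of_fract\<close> returns the representation in lowest
  terms.\<close>

type_synonym ratfun = "complex poly fract"

definition rat_const :: "complex \<Rightarrow> ratfun" where
  "rat_const c = to_fract [:c:]"

definition rat_z :: ratfun where
  "rat_z = to_fract [:0, 1:]"

definition rat_pole :: "ratfun \<Rightarrow> complex \<Rightarrow> bool" where
  "rat_pole q z \<longleftrightarrow> poly (snd (quot_of_fract q)) z = 0"

definition rat_eval :: "ratfun \<Rightarrow> complex \<Rightarrow> complex" where
  "rat_eval q z = poly (fst (quot_of_fract q)) z / poly (snd (quot_of_fract q)) z"

text \<open>\<open>conj_subst p\<close> is the rational function $\overline{p(1/\bar z)}$: conjugate the coefficients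
  of the polynomial and substitute $1/z$ for the variable. \<open>rat_star q\<close> is
  $\overline{q(1/\bar z)}$.\<close>

definition conj_subst :: "complex poly \<Rightarrow> ratfun" where
  "conj_subst p = poly (map_poly (\<lambda>c. rat_const (cnj c)) p) (inverse rat_z)"

definition rat_star :: "ratfun \<Rightarrow> ratfun" where
  "rat_star q = conj_subst (fst (quot_of_fract q)) / conj_subst (snd (quot_of_fract q))"

subsection \<open>Rational matrix functions\<close>

type_synonym ratmat = "ratfun mat"

definition const_mat :: "complex mat \<Rightarrow> ratmat" where
  "const_mat M = map_mat rat_const M"

definition mat_pole :: "ratmat \<Rightarrow> complex \<Rightarrow> bool" where
  "mat_pole F z \<longleftrightarrow> (\<exists>i < dim_row F. \<exists>j < dim_col F. rat_pole (F $$ (i, j)) z)"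

text \<open>Only meaningful if \<open>F\<close> is invertible over the field of rational functions.\<close>

definition mat_zero :: "ratmat \<Rightarrow> complex \<Rightarrow> bool" where
  "mat_zero F z \<longleftrightarrow> mat_pole (minv F) z"

definition mat_eval :: "ratmat \<Rightarrow> complex \<Rightarrow> complex mat" where
  "mat_eval F z = map_mat (\<lambda>q. rat_eval q z) F"

text \<open>$F^*(z) = F(1/\bar z)^*$\<close>

definition mat_star :: "ratmat \<Rightarrow> ratmat" where
  "mat_star F = map_mat rat_star (transpose_mat F)"

text \<open>Having a unitary value at a point of the unit circle includes having no pole there, so the
  pole condition is imposed on the closed disc.\<close>

definition bi_inner :: "nat \<Rightarrow> ratmat \<Rightarrow> bool" where
  "bi_inner m F \<longleftrightarrow> F \<in> carrier_mat m m \<and>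
     (\<forall>z. cmod z \<le> 1 \<longrightarrow> \<not> mat_pole F z) \<and>
     (\<forall>z. cmod z = 1 \<longrightarrow> unitary_mat (mat_eval F z))"

text \<open>The rational function $z K (I - zL)^{-1} M$ and the rational function
  $K (zI - L)^{-1} M$.\<close>

definition realize_out :: "complex mat \<Rightarrow> complex mat \<Rightarrow> complex mat \<Rightarrow> ratmat" where
  "realize_out K L M =
     rat_z \<cdot>\<^sub>m (const_mat K * minv (1\<^sub>m (dim_row L) - rat_z \<cdot>\<^sub>m const_mat L) * const_mat M)"

definition realize_in :: "complex mat \<Rightarrow> complex mat \<Rightarrow> complex mat \<Rightarrow> ratmat" where
  "realize_in K L M =
     const_mat K * minv (rat_z \<cdot>\<^sub>m 1\<^sub>m (dim_row L) - const_mat L) * const_mat M"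

subsection \<open>The encoding behaves as intended at points that are not poles\<close>

lemma rat_Fract:
  assumes "poly b z \<noteq> 0"
  shows "\<not> rat_pole (Fraction_Field.Fract a b) z"
    and "rat_eval (Fraction_Field.Fract a b) z = poly a z / poly b z"
proof -
  have b: "b \<noteq> 0" using assms by auto
  obtain d where d: "a = fst (normalize_quot (a, b)) * d" "b = snd (normalize_quot (a, b)) * d"
    using normalize_quotE[OF b, of a] by metis
  have q: "quot_of_fract (Fraction_Field.Fract a b) = normalize_quot (a, b)"
    using b by (simp add: quot_of_fract_quot_to_fract[of "(a, b)", unfolded quot_to_fract_def, simplified])
  have e: "poly a z = poly (fst (normalize_quot (a, b))) z * poly d z"
    "poly b z = poly (snd (normalize_quot (a, b))) z * poly d z"
    using d by (metis poly_mult)+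
  show "\<not> rat_pole (Fraction_Field.Fract a b) z"
    using assms e unfolding rat_pole_def q by auto
  show "rat_eval (Fraction_Field.Fract a b) z = poly a z / poly b z"
    using assms e unfolding rat_eval_def q by auto
qed

lemma rat_FractE:
  assumes "\<not> rat_pole q z"
  obtains a b where "q = Fraction_Field.Fract a b" "poly b z \<noteq> 0"
proof -
  have "q = Fraction_Field.Fract (fst (quot_of_fract q)) (snd (quot_of_fract q))"
    by (metis quot_to_fract_quot_of_fract quot_to_fract_def case_prod_unfold)
  then show ?thesis using assms that unfolding rat_pole_def by blast
qed

lemma rat_eval_add:
  assumes "\<not> rat_pole p z" "\<not> rat_pole q z"
  shows "\<not> rat_pole (p + q) z" "rat_eval (p + q) z = rat_eval p z + rat_eval q z"
proof -
  obtain a b where p: "p = Fraction_Field.Fract a b" "poly b z \<noteq> 0" using rat_FractE[OF assms(1)] .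
  obtain c d where q: "q = Fraction_Field.Fract c d" "poly d z \<noteq> 0" using rat_FractE[OF assms(2)] .
  have "p + q = Fraction_Field.Fract (a * d + c * b) (b * d)"
    using p q by (subst p(1), subst q(1), subst add_fract) auto
  then show "\<not> rat_pole (p + q) z" "rat_eval (p + q) z = rat_eval p z + rat_eval q z"
    using p q by (simp_all add: rat_Fract add_frac_eq)
qed

lemma rat_eval_mult:
  assumes "\<not> rat_pole p z" "\<not> rat_pole q z"
  shows "\<not> rat_pole (p * q) z" "rat_eval (p * q) z = rat_eval p z * rat_eval q z"
proof -
  obtain a b where p: "p = Fraction_Field.Fract a b" "poly b z \<noteq> 0" using rat_FractE[OF assms(1)] .
  obtain c d where q: "q = Fraction_Field.Fract c d" "poly d z \<noteq> 0" using rat_FractE[OF assms(2)] .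
  show "\<not> rat_pole (p * q) z" "rat_eval (p * q) z = rat_eval p z * rat_eval q z"
    using p q by (auto simp: rat_Fract)
qed

lemma rat_eval_divide:
  assumes "\<not> rat_pole p z" "\<not> rat_pole q z" "rat_eval q z \<noteq> 0"
  shows "\<not> rat_pole (p / q) z" "rat_eval (p / q) z = rat_eval p z / rat_eval q z"
proof -
  obtain a b where p: "p = Fraction_Field.Fract a b" "poly b z \<noteq> 0" using rat_FractE[OF assms(1)] .
  obtain c d where q: "q = Fraction_Field.Fract c d" "poly d z \<noteq> 0" using rat_FractE[OF assms(2)] .
  have c: "poly c z \<noteq> 0" using assms(3) q by (auto simp: rat_Fract)
  show "\<not> rat_pole (p / q) z" "rat_eval (p / q) z = rat_eval p z / rat_eval q z"
    using p q c by (auto simp: rat_Fract divide_simps)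
qed

lemma rat_eval_const: "\<not> rat_pole (rat_const c) z" "rat_eval (rat_const c) z = c"
  using rat_Fract[of 1 z "[:c:]"] by (auto simp: rat_const_def to_fract_def)

lemma rat_eval_z: "\<not> rat_pole rat_z z" "rat_eval rat_z z = z"
  using rat_Fract[of 1 z "[:0, 1:]"] by (auto simp: rat_z_def to_fract_def)

lemma rat_eval_conj_subst:
  assumes "z \<noteq> 0"
  shows "\<not> rat_pole (conj_subst p) z \<and> rat_eval (conj_subst p) z = cnj (poly p (1 / cnj z))"
proof (induction p)
  case 0
  show ?case using rat_eval_const[of 0 z] by (simp add: conj_subst_def rat_const_def)
next
  case (pCons c p)
  have r0: "rat_const 0 = 0" by (simp add: rat_const_def)
  have i: "\<not> rat_pole (inverse rat_z) z" "rat_eval (inverse rat_z) z = 1 / z"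
    using rat_eval_divide[of 1 z rat_z] rat_eval_const[of 1 z] assms
    by (simp_all add: rat_eval_z rat_const_def divide_inverse one_pCons[symmetric])
  have s: "conj_subst (pCons c p) = rat_const (cnj c) + inverse rat_z * conj_subst p"
    unfolding conj_subst_def by (subst Polynomial.map_poly_pCons) (simp_all add: r0)
  have m: "\<not> rat_pole (inverse rat_z * conj_subst p) z"
    "rat_eval (inverse rat_z * conj_subst p) z = 1 / z * cnj (poly p (1 / cnj z))"
    using rat_eval_mult[OF i(1)] pCons.IH i(2) by auto
  show ?case unfolding s
    using rat_eval_add[OF rat_eval_const(1) m(1), of "cnj c"] m(2) by (auto simp: rat_eval_const)
qed

lemma rat_eval_star:
  assumes "z \<noteq> 0" "\<not> rat_pole q (1 / cnj z)"
  shows "\<not> rat_pole (rat_star q) z" "rat_eval (rat_star q) z = cnj (rat_eval q (1 / cnj z))"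
proof -
  let ?a = "conj_subst (fst (quot_of_fract q))" and ?b = "conj_subst (snd (quot_of_fract q))"
  note a = rat_eval_conj_subst[OF assms(1), of "fst (quot_of_fract q)"]
  note b = rat_eval_conj_subst[OF assms(1), of "snd (quot_of_fract q)"]
  have n: "rat_eval ?b z \<noteq> 0"
    using b assms(2) by (simp add: rat_pole_def)
  note d = rat_eval_divide[OF conjunct1[OF a] conjunct1[OF b] n]
  show "\<not> rat_pole (rat_star q) z"
    using d(1) by (simp add: rat_star_def)
  have "rat_eval (rat_star q) z = rat_eval ?a z / rat_eval ?b z"
    using d(2) by (simp add: rat_star_def)
  also have "\<dots> = cnj (rat_eval q (1 / cnj z))"
    using a b by (simp add: rat_eval_def[of q])
  finally show "rat_eval (rat_star q) z = cnj (rat_eval q (1 / cnj z))" .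
qed

end

theory Submission
  imports Defs
begin

text \<open>Every function in the theorem is a constant plus terms \<open>K e(L) M\<close> and \<open>K o(L) M\<close>, where
  \<open>e(L) = (zI - L)\<^sup>-\<^sup>1\<close> and \<open>o(L) = z(I - zL)\<^sup>-\<^sup>1\<close> (\<open>res_in\<close> and \<open>res_out\<close> below).
  Reflection in the unit circle exchanges the two kinds, because \<open>e(L)\<^sup>* = o(L\<^sup>\<dagger>)\<close>. For stable \<open>L\<close> the
  poles of \<open>e(L)\<close> lie inside the circle and those of \<open>o(L)\<close> outside.

  All computations come from one mechanism: a matrix equation turns a product of two resolvents into
  a sum. If \<open>X - LXM = S\<close>, then \<open>e(L) S o(M) = X + XM o(M) + e(L) LX\<close> (\<open>stein_in_out\<close>, and
  \<open>stein_out_in\<close> for the other order); if \<open>LX - XM = S\<close>, then \<open>e(L) S e(M) = e(L) X - X e(M)\<close>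
  (\<open>sylvester_in_in\<close>, \<open>sylvester_out_out\<close>).

  \<^item> Write \<open>Z = C~ e(A~) B~\<close> with the tilded matrices of the data. The Stein equations for \<open>P\<^sub>+\<close> and
    \<open>P\<^sub>-\<close> give \<open>R\<^sup>*R = D~ + Z + Z\<^sup>*\<close> (\<open>spectral_density\<close>). The Riccati equation is a Stein equation
    for \<open>Q\<close> and gives the same expression for \<open>\<Psi>\<^sup>*\<Psi>\<close> (\<open>spectral_factor\<close>). Hence \<open>\<Xi> = R\<Psi>\<^sup>-\<^sup>1\<close> satisfies
    \<open>\<Xi>\<^sup>*\<Xi> = I\<close>. Its realization follows by splitting the product of \<open>e(\<alpha>)\<close> with
    \<open>\<Psi>\<^sup>-\<^sup>1\<close> by means of \<open>Y\<close> (\<open>res_in_times_factor_inverse\<close>).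

  \<^item> The block equation makes \<open>V\<^sup>*V = I\<close> (\<open>lossless_star_times\<close>) and makes the poles of \<open>\<Xi>\<close> outside
    the disc cancel in \<open>V\<^sup>*\<Xi>\<close> (\<open>lossless_star_times_out\<close>). So \<open>W\<^sup>* = V\<^sup>*\<Xi>\<close> has poles inside the disc
    only, which means that \<open>W\<close> has none on the closed disc
    (\<open>unitary_lossless_factorization\<close>).

  \<^item> For the existence of \<open>B\<^sub>V\<close> and \<open>D\<^sub>V\<close> the matrix \<open>P\<^sub>0\<close> may be singular. It factors as \<open>S\<^sup>\<dagger>S\<close> with \<open>S\<close>
    right invertible, of rank \<open>k\<close> say, and the stacked matrix with blocks \<open>SA\<^sub>0\<close> and \<open>C\<^sub>1\<close> has
    \<open>k + m\<close> rows and factors through \<open>S\<close>, so \<open>m\<close> orthonormal columns orthogonal to its columns exist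
    (\<open>lossless_extension\<close>).

  \<^item> Splitting \<open>V\<^sup>*\<Xi>\<close> further by the Sylvester equation for \<open>P\<^sub>1\<close> leaves the stated formula for \<open>W\<^sup>*\<close> plus
    \<open>B\<^sub>V\<^sup>\<dagger> e(A\<^sub>0\<^sup>\<dagger>) G\<close> with a constant matrix \<open>G\<close>. The identity \<open>\<Xi>\<^sup>*\<Xi> = I\<close> expresses
    \<open>(B\<^sub>0D\<^sup>-\<^sup>1)\<^sup>\<dagger> e(A\<^sub>0\<^sup>\<dagger>) G\<close> by functions whose poles are not eigenvalues of \<open>A\<^sub>0\<^sup>\<dagger>\<close>. This function therefore has no
    poles at all, vanishes at infinity and is zero; controllability of \<open>(A\<^sub>0, B\<^sub>0)\<close> then yields
    \<open>G = 0\<close> (\<open>quotient_residue_zero\<close>).\<close>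

section \<open>Matrix algebra with side conditions on dimensions\<close>

text \<open>The ring laws for matrices, with equations between dimensions as side conditions. In this form
  the simplifier discharges the conditions, so the laws rewrite every expression of conformable
  matrices into a sum of products bracketed to the right. An identity then follows by comparing
  entries, where the entries of the products are left unevaluated; this is how the many equations
  between matrix expressions below are proved.\<close>

lemma assoc_mat_dim:
  "dim_col A = dim_row B \<Longrightarrow> dim_col B = dim_row C \<Longrightarrow> A * B * C = A * (B * (C :: 'a :: semiring_0 mat))"
  by (rule assoc_mult_mat[of _ "dim_row A" "dim_col A" _ "dim_col B" _ "dim_col C"]) auto

lemma mult_add_mat_dim:
  fixes A B C :: "'a :: semiring_0 mat"
  shows "dim_row B = dim_row C \<Longrightarrow> dim_col B = dim_col C \<Longrightarrow> dim_col A = dim_row B \<Longrightarrow>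
    A * (B + C) = A * B + A * C"
  by (rule mult_add_distrib_mat[of _ "dim_row A" "dim_col A" _ "dim_col B"]) auto

lemma add_mult_mat_dim:
  fixes A B C :: "'a :: semiring_0 mat"
  shows "dim_row A = dim_row B \<Longrightarrow> dim_col A = dim_col B \<Longrightarrow> dim_col A = dim_row C \<Longrightarrow>
    (A + B) * C = A * C + B * C"
  by (rule add_mult_distrib_mat[of _ "dim_row A" "dim_col A" _ _ "dim_col C"]) auto

lemma mult_minus_mat_dim:
  fixes A B C :: "'a :: ring mat"
  shows "dim_row B = dim_row C \<Longrightarrow> dim_col B = dim_col C \<Longrightarrow> dim_col A = dim_row B \<Longrightarrow>
    A * (B - C) = A * B - A * C"
  by (rule mult_minus_distrib_mat[of _ "dim_row A" "dim_col A" _ "dim_col B"]) auto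

lemma minus_mult_mat_dim:
  fixes A B C :: "'a :: ring mat"
  shows "dim_row A = dim_row B \<Longrightarrow> dim_col A = dim_col B \<Longrightarrow> dim_col A = dim_row C \<Longrightarrow>
    (A - B) * C = A * C - B * C"
  by (rule minus_mult_distrib_mat[of _ "dim_row A" "dim_col A" _ _ "dim_col C"]) auto

lemma one_mult_mat_dim: "dim_row A = k \<Longrightarrow> 1\<^sub>m k * A = (A :: 'a :: semiring_1 mat)"
  and mult_one_mat_dim: "dim_col A = k \<Longrightarrow> A * 1\<^sub>m k = A"
  by auto

lemma uminus_mult_mat_dim: "dim_col A = dim_row B \<Longrightarrow> (- A) * B = - (A * (B :: 'a :: ring mat))"
  by (rule eq_matI) auto

lemma mult_uminus_mat_dim: "dim_col A = dim_row B \<Longrightarrow> A * (- B) = - (A * (B :: 'a :: ring mat))"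
  by (rule eq_matI) auto

lemma smult_mult_mat_dim: "dim_col A = dim_row B \<Longrightarrow> (k \<cdot>\<^sub>m A) * B = k \<cdot>\<^sub>m (A * (B :: 'a :: comm_ring_1 mat))"
  by (rule eq_matI) auto

lemma mult_smult_mat_dim: "dim_col A = dim_row B \<Longrightarrow> A * (k \<cdot>\<^sub>m B) = k \<cdot>\<^sub>m (A * (B :: 'a :: comm_ring_1 mat))"
  by (rule eq_matI) auto

lemma zero_mult_mat_dim: "dim_row A = k \<Longrightarrow> 0\<^sub>m r k * A = (0\<^sub>m r (dim_col A) :: 'a :: semiring_0 mat)"
  and mult_zero_mat_dim: "dim_col A = k \<Longrightarrow> A * 0\<^sub>m k r = 0\<^sub>m (dim_row A) r"
  by auto

lemmas mat_ring_dim = assoc_mat_dim mult_add_mat_dim add_mult_mat_dim mult_minus_mat_dim minus_mult_mat_dim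
  one_mult_mat_dim mult_one_mat_dim uminus_mult_mat_dim mult_uminus_mat_dim smult_mult_mat_dim
  mult_smult_mat_dim zero_mult_mat_dim mult_zero_mat_dim

lemma carrier_mat_dims: "A \<in> carrier_mat n m \<Longrightarrow> dim_row A = n \<and> dim_col A = m" by auto

lemma mult_eq_assoc: "A * B = C \<Longrightarrow> dim_col A = dim_row B \<Longrightarrow> dim_col B = dim_row X \<Longrightarrow> A * (B * X) = C * (X :: 'a :: semiring_0 mat)"
  using assoc_mat_dim[of A B X] by simp

section \<open>Inverses and poles\<close>

lemma minv_inverse:
  fixes M :: "'a :: field mat"
  assumes "M \<in> carrier_mat n n" "det M \<noteq> 0"
  shows "minv M \<in> carrier_mat n n" "M * minv M = 1\<^sub>m n" "minv M * M = 1\<^sub>m n"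
proof -
  obtain N where "mat_inverse M = Some N"
    using mat_inverse(1)[OF assms(1)] det_non_zero_imp_unit[OF assms] by fastforce
  then show "minv M \<in> carrier_mat n n" "M * minv M = 1\<^sub>m n" "minv M * M = 1\<^sub>m n"
    using mat_inverse(2)[OF assms(1)] by (auto simp: minv_def)
qed

lemma minv_unique:
  fixes M :: "'a :: field mat"
  assumes M: "M \<in> carrier_mat n n" and N: "N \<in> carrier_mat n n" and 1: "M * N = 1\<^sub>m n"
  shows "minv M = N"
proof -
  have "det M \<noteq> 0" using det_mult[OF M N] 1 by auto
  note I = minv_inverse[OF M this]
  have "minv M * (M * N) = N" using I M N mult_eq_assoc[of "minv M" M "1\<^sub>m n" N] by auto
  then show ?thesis using 1 I by simp
qed

lemma minv_smult_adj_mat: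
  fixes M :: "'a :: field mat"
  assumes "M \<in> carrier_mat n n" "det M \<noteq> 0"
  shows "minv M = inverse (det M) \<cdot>\<^sub>m adj_mat M"
proof (rule minv_unique[OF assms(1)])
  show "M * (inverse (det M) \<cdot>\<^sub>m adj_mat M) = 1\<^sub>m n"
    using adj_mat[OF assms(1)] assms by (subst mult_smult_mat_dim) auto
qed (use adj_mat[OF assms(1)] in auto)

lemma const_mat_carrier [simp]: "const_mat M \<in> carrier_mat n m \<longleftrightarrow> M \<in> carrier_mat n m"
  by (auto simp: const_mat_def)

lemma const_mat_dim [simp]: "dim_row (const_mat M) = dim_row M" "dim_col (const_mat M) = dim_col M"
  by (auto simp: const_mat_def)

interpretation rat_const: inj_comm_ring_hom rat_const
  by unfold_locales (simp_all add: rat_const_def one_pCons[symmetric] flip: to_fract_add to_fract_mult)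

lemma rat_eval_sum:
  assumes "finite S" "\<forall>k\<in>S. \<not> rat_pole (f k) z"
  shows "\<not> rat_pole (\<Sum>k\<in>S. f k) z \<and> rat_eval (\<Sum>k\<in>S. f k) z = (\<Sum>k\<in>S. rat_eval (f k) z)"
  using assms by induction (use rat_eval_const[of 0 z] in \<open>auto simp: rat_eval_add rat_const_def\<close>)

lemma no_mat_pole_mult:
  assumes "\<not> mat_pole F z" "\<not> mat_pole G z" "dim_col F = dim_row G"
  shows "\<not> mat_pole (F * G) z"
  using assms unfolding mat_pole_def
  by (auto simp: scalar_prod_def rat_eval_mult intro: conjunct1[OF rat_eval_sum, THEN notE, rotated -1])

lemma no_mat_pole_add: "\<not> mat_pole F z \<Longrightarrow> \<not> mat_pole G z \<Longrightarrow> dim_row F = dim_row G \<Longrightarrow>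
    dim_col F = dim_col G \<Longrightarrow> \<not> mat_pole (F + G) z"
  by (auto simp: mat_pole_def rat_eval_add)

lemma no_mat_pole_const: "\<not> mat_pole (const_mat M) z"
  by (auto simp: mat_pole_def const_mat_def rat_eval_const)

lemma mat_eval_mult:
  assumes "\<not> mat_pole F z" "\<not> mat_pole G z" "dim_col F = dim_row G"
  shows "mat_eval (F * G) z = mat_eval F z * mat_eval G z"
proof (rule eq_matI)
  fix i j assume "i < dim_row (mat_eval F z * mat_eval G z)" "j < dim_col (mat_eval F z * mat_eval G z)"
  then have "i < dim_row F" "j < dim_col G" by (auto simp: mat_eval_def)
  then show "mat_eval (F * G) z $$ (i, j) = (mat_eval F z * mat_eval G z) $$ (i, j)"
    using assms conjunct2[OF rat_eval_sum[of "{0..<dim_row G}" "\<lambda>k. F $$ (i, k) * G $$ (k, j)" z]]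
    by (simp add: mat_eval_def mat_pole_def scalar_prod_def rat_eval_mult)
qed (auto simp: mat_eval_def)

lemma rat_eval_to_fract: "\<not> rat_pole (to_fract q) z" "rat_eval (to_fract q) z = poly q z"
  by (simp_all add: rat_pole_def rat_eval_def)

text \<open>By Cramer's rule the inverse of a polynomial matrix can have a pole only at a zero of its
  determinant.\<close>

lemma minv_poly_mat_no_pole:
  fixes P :: "complex poly mat"
  assumes P: "P \<in> carrier_mat n n" and z: "det (map_mat (\<lambda>q. poly q z) P) \<noteq> 0"
  shows "det (map_mat to_fract P) \<noteq> 0" "\<not> mat_pole (minv (map_mat to_fract P)) z"
proof -
  interpret f: inj_comm_ring_hom "to_fract :: complex poly \<Rightarrow> ratfun"
    by unfold_locales auto
  have "comm_ring_hom (\<lambda>q. poly q z)" by unfold_locales auto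
  then have d: "poly (det P) z \<noteq> 0" using z by (simp add: comm_ring_hom.hom_det)
  then show 1: "det (map_mat to_fract P) \<noteq> 0" by (auto simp: f.hom_det)
  have del: "mat_delete (map_mat to_fract P) i j = map_mat to_fract (mat_delete P i j)" for i j
    by (rule eq_matI) (auto simp: mat_delete_def)
  have pow: "to_fract ((- 1 :: complex poly) ^ k) = (- 1) ^ k" for k
    by (simp add: f.hom_power)
  have adj: "adj_mat (map_mat to_fract P) = map_mat to_fract (adj_mat P)"
    using P by (intro eq_matI)
      (auto simp: adj_mat_def cofactor_def del f.hom_det pow)
  have "\<not> rat_pole (inverse (to_fract (det P)) * to_fract q) z" for q
    using rat_eval_divide(1)[of "to_fract q" z "to_fract (det P)"] d
    by (simp add: rat_eval_to_fract divide_inverse mult.commute)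
  then show "\<not> mat_pole (minv (map_mat to_fract P)) z"
    using P 1 adj adj_mat(1)[OF P]
    by (subst minv_smult_adj_mat[of _ n]) (auto simp: mat_pole_def f.hom_det)
qed

section \<open>The two resolvents of a constant matrix\<close>

definition res_in :: "complex mat \<Rightarrow> ratmat" where
  "res_in L = minv (rat_z \<cdot>\<^sub>m 1\<^sub>m (dim_row L) - const_mat L)"

definition res_out :: "complex mat \<Rightarrow> ratmat" where
  "res_out L = rat_z \<cdot>\<^sub>m minv (1\<^sub>m (dim_row L) - rat_z \<cdot>\<^sub>m const_mat L)"

lemma res_in_regular:
  assumes L: "L \<in> carrier_mat n n" and z: "z \<notin> spectrum L"
  shows "det (rat_z \<cdot>\<^sub>m 1\<^sub>m n - const_mat L) \<noteq> 0" "\<not> mat_pole (res_in L) z"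
proof -
  define P where "P = mat n n (\<lambda>(i, j). (if i = j then [:0, 1:] else 0) - [:L $$ (i, j):])"
  have P: "P \<in> carrier_mat n n" by (simp add: P_def)
  have 1: "rat_z \<cdot>\<^sub>m 1\<^sub>m n - const_mat L = map_mat to_fract P"
    by (rule eq_matI) (use L in \<open>auto simp: P_def rat_z_def const_mat_def rat_const_def simp flip: to_fract_diff to_fract_uminus\<close>)
  have 2: "map_mat (\<lambda>q. poly q z) P = (- 1) \<cdot>\<^sub>m char_matrix L z"
    by (rule eq_matI) (use L in \<open>auto simp: P_def char_matrix_def\<close>)
  have "det (char_matrix L z) \<noteq> 0"
    using z eigenvalue_det[OF L, of z] by (auto simp: spectrum_def)
  then have "det (map_mat (\<lambda>q. poly q z) P) \<noteq> 0"
    unfolding 2 by simp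
  from minv_poly_mat_no_pole[OF P this] 
  show "det (rat_z \<cdot>\<^sub>m 1\<^sub>m n - const_mat L) \<noteq> 0" "\<not> mat_pole (res_in L) z"
    using L by (auto simp: res_in_def 1)
qed

lemma res_out_regular:
  assumes L: "L \<in> carrier_mat n n" and z: "z = 0 \<or> 1 / z \<notin> spectrum L"
  shows "det (1\<^sub>m n - rat_z \<cdot>\<^sub>m const_mat L) \<noteq> 0"
    "\<not> mat_pole (minv (1\<^sub>m n - rat_z \<cdot>\<^sub>m const_mat L)) z"
proof -
  define P where "P = mat n n (\<lambda>(i, j). (if i = j then 1 else 0) - [:0, L $$ (i, j):])"
  have P: "P \<in> carrier_mat n n" by (simp add: P_def)
  have 1: "1\<^sub>m n - rat_z \<cdot>\<^sub>m const_mat L = map_mat to_fract P"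
    by (rule eq_matI) (use L in \<open>auto simp: P_def rat_z_def const_mat_def rat_const_def
      simp flip: to_fract_diff to_fract_uminus to_fract_1 to_fract_mult\<close>)
  have "det (map_mat (\<lambda>q. poly q z) P) \<noteq> 0"
  proof (cases "z = 0")
    case True
    have "map_mat (\<lambda>q. poly q z) P = 1\<^sub>m n"
      by (rule eq_matI) (use L True in \<open>auto simp: P_def\<close>)
    then show ?thesis by simp
  next
    case False
    have 2: "map_mat (\<lambda>q. poly q z) P = (- z) \<cdot>\<^sub>m char_matrix L (1 / z)"
      by (rule eq_matI) (use L False in \<open>auto simp: P_def char_matrix_def algebra_simps\<close>)
    have "det (char_matrix L (1 / z)) \<noteq> 0"
      using z False eigenvalue_det[OF L, of "1 / z"] by (auto simp: spectrum_def)
    then show ?thesis unfolding 2 using False by simp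
  qed
  from minv_poly_mat_no_pole[OF P this] 
  show "det (1\<^sub>m n - rat_z \<cdot>\<^sub>m const_mat L) \<noteq> 0"
    "\<not> mat_pole (minv (1\<^sub>m n - rat_z \<cdot>\<^sub>m const_mat L)) z"
    by (auto simp: 1)
qed

lemma res_out_no_pole:
  assumes L: "L \<in> carrier_mat n n" and z: "z = 0 \<or> 1 / z \<notin> spectrum L"
  shows "\<not> mat_pole (res_out L) z"
  using res_out_regular(2)[OF assms] L
  by (auto simp: res_out_def mat_pole_def rat_eval_mult(1) rat_eval_z)

text \<open>This zero at the origin is the reflection of the zero of \<open>res_in\<close> at infinity; strict
  properness is used in this form.\<close>

lemma res_out_at_0:
  assumes L: "L \<in> carrier_mat n n"
  shows "mat_eval (res_out L) 0 = 0\<^sub>m n n"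
proof -
  let ?M = "1\<^sub>m n - rat_z \<cdot>\<^sub>m const_mat L"
  have "minv ?M \<in> carrier_mat n n"
    using res_out_regular(1)[OF L, of 0] L by (intro minv_inverse(1)) auto
  then show ?thesis
    using res_out_regular(2)[OF L, of 0] L
    by (intro eq_matI) (auto simp: res_out_def mat_pole_def mat_eval_def rat_eval_mult rat_eval_z)
qed

text \<open>The spectrum is finite, so there are points outside it. This makes the resolvent of an arbitrary
  matrix a genuine inverse over the field of rational functions.\<close>

lemma res_in_resolvent:
  assumes L: "L \<in> carrier_mat n n"
  shows "res_in L \<in> carrier_mat n n"
    "rat_z \<cdot>\<^sub>m res_in L = 1\<^sub>m n + const_mat L * res_in L"
    "rat_z \<cdot>\<^sub>m res_in L = 1\<^sub>m n + res_in L * const_mat L"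
proof -
  have "infinite (UNIV - spectrum L)"
    by (meson Diff_infinite_finite card_finite_spectrum(1)[OF L] infinite_UNIV_char_0)
  then obtain z where z: "z \<notin> spectrum L"
    by (metis DiffE not_finite_existsD ex_in_conv finite.emptyI)
  let ?M = "rat_z \<cdot>\<^sub>m 1\<^sub>m n - const_mat L"
  have M: "?M \<in> carrier_mat n n" using L by auto
  note I = minv_inverse[OF M res_in_regular(1)[OF L z]]
  have e: "res_in L = minv ?M" using L by (simp add: res_in_def)
  show c: "res_in L \<in> carrier_mat n n" using I e by simp
  note d = carrier_mat_dims[OF c] carrier_mat_dims[OF L]
  have "?M * res_in L + const_mat L * res_in L = rat_z \<cdot>\<^sub>m res_in L"
    by (rule eq_matI) (use d in \<open>simp_all add: mat_ring_dim del: index_mult_mat(1)\<close>)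
  then show "rat_z \<cdot>\<^sub>m res_in L = 1\<^sub>m n + const_mat L * res_in L" using I e by simp
  have "res_in L * ?M + res_in L * const_mat L = rat_z \<cdot>\<^sub>m res_in L"
    by (rule eq_matI) (use d in \<open>simp_all add: mat_ring_dim del: index_mult_mat(1)\<close>)
  then show "rat_z \<cdot>\<^sub>m res_in L = 1\<^sub>m n + res_in L * const_mat L" using I e by simp
qed

lemma res_out_resolvent:
  assumes L: "L \<in> carrier_mat n n"
  shows "res_out L \<in> carrier_mat n n"
    "res_out L = rat_z \<cdot>\<^sub>m (1\<^sub>m n + const_mat L * res_out L)"
    "res_out L = rat_z \<cdot>\<^sub>m (1\<^sub>m n + res_out L * const_mat L)"
proof -
  let ?M = "1\<^sub>m n - rat_z \<cdot>\<^sub>m const_mat L"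
  have M: "?M \<in> carrier_mat n n" using L by auto
  have "det ?M \<noteq> 0" using res_out_regular(1)[OF L, of 0] by simp
  note I = minv_inverse[OF M this]
  have e: "res_out L = rat_z \<cdot>\<^sub>m minv ?M" using L by (simp add: res_out_def)
  show c: "res_out L \<in> carrier_mat n n" using I e by simp
  note d = carrier_mat_dims[OF I(1)] carrier_mat_dims[OF L]
  have "?M * minv ?M + const_mat L * res_out L = minv ?M"
    unfolding e by (rule eq_matI) (use d in \<open>simp_all add: mat_ring_dim del: index_mult_mat(1)\<close>)
  then show "res_out L = rat_z \<cdot>\<^sub>m (1\<^sub>m n + const_mat L * res_out L)" using I e by simp
  have "minv ?M * ?M + res_out L * const_mat L = minv ?M"
    unfolding e by (rule eq_matI) (use d in \<open>simp_all add: mat_ring_dim del: index_mult_mat(1)\<close>)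
  then show "res_out L = rat_z \<cdot>\<^sub>m (1\<^sub>m n + res_out L * const_mat L)" using I e by simp
qed

section \<open>Reflection in the unit circle\<close>

text \<open>A rational function is determined by its values off a finite set. All laws for \<open>rat_star\<close> are
  read off from the pointwise formula in this way.\<close>

lemma ratfun_eqI:
  assumes "finite S" "\<And>z. z \<notin> S \<Longrightarrow> \<not> rat_pole p z \<Longrightarrow> \<not> rat_pole q z \<Longrightarrow> rat_eval p z = rat_eval q z"
  shows "p = q"
proof -
  have F: "r = Fraction_Field.Fract (fst (quot_of_fract r)) (snd (quot_of_fract r))" for r :: ratfun
    by (metis quot_to_fract_quot_of_fract quot_to_fract_def case_prod_unfold)
  define a b c d where abcd: "a = fst (quot_of_fract p)" "b = snd (quot_of_fract p)"
    "c = fst (quot_of_fract q)" "d = snd (quot_of_fract q)"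
  note p = F[of p, folded abcd] and q = F[of q, folded abcd]
  have bd: "b \<noteq> 0" "d \<noteq> 0" by (simp_all add: abcd)
  have "finite (S \<union> {z. poly b z = 0} \<union> {z. poly d z = 0})"
    using assms(1) bd by (simp add: poly_roots_finite)
  moreover have "poly (a * d - c * b) z = 0" 
    if "z \<notin> S \<union> {z. poly b z = 0} \<union> {z. poly d z = 0}" for z
  proof -
    have "\<not> rat_pole p z" "\<not> rat_pole q z" using that by (auto simp: rat_pole_def abcd)
    then have "poly a z / poly b z = poly c z / poly d z"
      using assms(2)[of z] that by (simp add: rat_eval_def abcd)
    then show ?thesis using that by (simp add: frac_eq_eq)
  qed
  then have "- {z. poly (a * d - c * b) z = 0} \<subseteq> S \<union> {z. poly b z = 0} \<union> {z. poly d z = 0}"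
    by blast
  ultimately have "finite (- {z. poly (a * d - c * b) z = 0})"
    by (meson finite_subset)
  then have "infinite {z. poly (a * d - c * b) z = 0}"
    by (metis finite_compl infinite_UNIV_char_0)
  then have "a * d = c * b" using poly_roots_finite[of "a * d - c * b"] by auto
  then show ?thesis using bd by (subst p, subst q) (simp add: eq_fract)
qed

lemma finite_poles: "finite {z. rat_pole q z}"
  by (simp add: rat_pole_def poly_roots_finite)

lemma finite_reflected_poles: "finite {z. rat_pole q (1 / cnj z)}"
proof -
  have "{z. rat_pole q (1 / cnj z)} \<subseteq> (\<lambda>z. 1 / cnj z) ` {z. rat_pole q z}"
  proof
    fix z assume "z \<in> {z. rat_pole q (1 / cnj z)}"
    then show "z \<in> (\<lambda>z. 1 / cnj z) ` {z. rat_pole q z}"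
      by (intro image_eqI[of _ _ "1 / cnj z"]) auto
  qed
  then show ?thesis using finite_poles finite_surj by blast
qed

lemma rat_star_add: "rat_star (p + q) = rat_star p + rat_star q"
  by (rule ratfun_eqI[of "{0} \<union> {z. rat_pole p (1 / cnj z)} \<union> {z. rat_pole q (1 / cnj z)}"])
    (auto simp: finite_reflected_poles rat_eval_star rat_eval_add)

lemma rat_star_mult: "rat_star (p * q) = rat_star p * rat_star q"
  by (rule ratfun_eqI[of "{0} \<union> {z. rat_pole p (1 / cnj z)} \<union> {z. rat_pole q (1 / cnj z)}"])
    (auto simp: finite_reflected_poles rat_eval_star rat_eval_mult)

lemma rat_star_const: "rat_star (rat_const c) = rat_const (cnj c)"
  by (rule ratfun_eqI[of "{0}"]) (auto simp: rat_eval_star rat_eval_const)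

lemma rat_star_star: "rat_star (rat_star q) = q"
  by (rule ratfun_eqI[of "{0} \<union> {z. rat_pole q z}"])
    (auto simp: rat_eval_star finite_poles)

lemma rat_z_nonzero [simp]: "rat_z \<noteq> 0"
  by (simp add: rat_z_def)

lemma rat_star_z: "rat_z * rat_star rat_z = 1"
  by (rule ratfun_eqI[of "{0}"])
    (use rat_eval_const[of 1] in \<open>auto simp: rat_eval_star rat_eval_z rat_eval_mult rat_const.hom_one\<close>)

interpretation rat_star: inj_comm_ring_hom rat_star
proof unfold_locales
  show 0: "rat_star 0 = 0" using rat_star_const[of 0] by (simp add: rat_const.hom_zero)
  show "rat_star 1 = 1" using rat_star_const[of 1] by (simp add: rat_const.hom_one)
  show "x = 0" if "rat_star x = 0" for x using that 0 rat_star_star[of x] by simp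
qed (auto simp: rat_star_add rat_star_mult)

lemma mat_star_dim [simp]: "dim_row (mat_star F) = dim_col F" "dim_col (mat_star F) = dim_row F"
  by (auto simp: mat_star_def)

lemma mat_star_carrier [simp]: "mat_star F \<in> carrier_mat n m \<longleftrightarrow> F \<in> carrier_mat m n"
  by (metis carrier_matD carrier_matI mat_star_dim)

lemma mat_star_index [simp]: "i < dim_col F \<Longrightarrow> j < dim_row F \<Longrightarrow> mat_star F $$ (i, j) = rat_star (F $$ (j, i))"
  by (simp add: mat_star_def)

lemma mat_star_star [simp]: "mat_star (mat_star F) = F"
  by (rule eq_matI) (auto simp: rat_star_star)

lemma mat_star_mult: "dim_col F = dim_row G \<Longrightarrow> mat_star (F * G) = mat_star G * mat_star F"
  by (rule eq_matI) (auto simp: scalar_prod_def rat_star.hom_sum rat_star_mult mult.commute)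

lemma mat_star_add: "dim_row F = dim_row G \<Longrightarrow> dim_col F = dim_col G \<Longrightarrow> 
    mat_star (F + G) = mat_star F + mat_star G"
  by (rule eq_matI) (auto simp: rat_star_add)

lemma mat_star_smult: "mat_star (c \<cdot>\<^sub>m F) = rat_star c \<cdot>\<^sub>m mat_star F"
  by (rule eq_matI) (auto simp: rat_star_mult)

lemma mat_star_one [simp]: "mat_star (1\<^sub>m n) = 1\<^sub>m n"
  by (rule eq_matI) auto

section \<open>Adjoints and constant functions\<close>

lemma adjoint_dim [simp]: "dim_row (A\<^sup>\<dagger>) = dim_col A" "dim_col (A\<^sup>\<dagger>) = dim_row A"
  by (auto simp: mat_adjoint_def)

lemma adjoint_carrier [simp]: "A\<^sup>\<dagger> \<in> carrier_mat n m \<longleftrightarrow> A \<in> carrier_mat m n"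
  by (metis carrier_matD carrier_matI adjoint_dim)

lemma adjoint_index [simp]: "i < dim_col A \<Longrightarrow> j < dim_row A \<Longrightarrow> A\<^sup>\<dagger> $$ (i, j) = conjugate (A $$ (j, i))"
  by (simp add: mat_adjoint_def mat_of_rows_index)

lemma adjoint_adjoint [simp]: "(A\<^sup>\<dagger>)\<^sup>\<dagger> = A"
  by (rule eq_matI) auto

lemma adjoint_mult: "dim_col A = dim_row B \<Longrightarrow> (A * B :: complex mat)\<^sup>\<dagger> = B\<^sup>\<dagger> * A\<^sup>\<dagger>"
  by (rule eq_matI) (auto simp: scalar_prod_def mult.commute)

lemma adjoint_add: "dim_row A = dim_row B \<Longrightarrow> dim_col A = dim_col B \<Longrightarrow> (A + B :: complex mat)\<^sup>\<dagger> = A\<^sup>\<dagger> + B\<^sup>\<dagger>"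
  by (rule eq_matI) auto

lemma adjoint_minus: "dim_row A = dim_row B \<Longrightarrow> dim_col A = dim_col B \<Longrightarrow> (A - B :: complex mat)\<^sup>\<dagger> = A\<^sup>\<dagger> - B\<^sup>\<dagger>"
  by (rule eq_matI) auto

lemma adjoint_uminus: "(- A :: complex mat)\<^sup>\<dagger> = - A\<^sup>\<dagger>"
  by (rule eq_matI) auto

lemma adjoint_one [simp]: "(1\<^sub>m n :: complex mat)\<^sup>\<dagger> = 1\<^sub>m n"
  by (rule eq_matI) auto

lemma adjoint_zero [simp]: "(0\<^sub>m n m :: complex mat)\<^sup>\<dagger> = 0\<^sub>m m n"
  by (rule eq_matI) auto

lemma pow_mat_Suc_left: 
  assumes A: "(A :: 'a :: semiring_1 mat) \<in> carrier_mat n n"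
  shows "A ^\<^sub>m Suc k = A * A ^\<^sub>m k"
proof (induction k)
  case (Suc k)
  have "A ^\<^sub>m Suc (Suc k) = A * A ^\<^sub>m k * A" using Suc by simp
  also have "\<dots> = A * A ^\<^sub>m Suc k" using A by (simp add: assoc_mat_dim)
  finally show ?case .
qed (use A in simp)

lemma adjoint_pow: 
  assumes A: "(A :: complex mat) \<in> carrier_mat n n"
  shows "(A ^\<^sub>m k)\<^sup>\<dagger> = (A\<^sup>\<dagger>) ^\<^sub>m k"
proof (induction k)
  case (Suc k)
  have "(A ^\<^sub>m Suc k)\<^sup>\<dagger> = A\<^sup>\<dagger> * (A ^\<^sub>m k)\<^sup>\<dagger>" using A by (simp add: adjoint_mult)
  then show ?case using Suc pow_mat_Suc_left[of "A\<^sup>\<dagger>" n k] A by simp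
qed (use A in simp)

lemma mat_star_const [simp]: "mat_star (const_mat M) = const_mat (M\<^sup>\<dagger>)"
  by (rule eq_matI) (auto simp: const_mat_def rat_star_const)

lemma const_mat_mult: "dim_col A = dim_row B \<Longrightarrow> const_mat (A * B) = const_mat A * const_mat B"
  unfolding const_mat_def by (rule rat_const.mat_hom_mult[of _ "dim_row A" "dim_col A" _ "dim_col B"]) auto

lemma const_mat_add: "dim_row A = dim_row B \<Longrightarrow> dim_col A = dim_col B \<Longrightarrow> const_mat (A + B) = const_mat A + const_mat B"
  by (rule eq_matI) (auto simp: const_mat_def rat_const.hom_add)

lemma const_mat_minus: "dim_row A = dim_row B \<Longrightarrow> dim_col A = dim_col B \<Longrightarrow> const_mat (A - B) = const_mat A - const_mat B"
  by (rule eq_matI) (auto simp: const_mat_def rat_const.hom_minus)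

lemma const_mat_uminus: "const_mat (- A) = - const_mat A"
  by (rule eq_matI) (auto simp: const_mat_def rat_const.hom_uminus)

lemma const_mat_one: "const_mat (1\<^sub>m n) = 1\<^sub>m n"
  by (rule eq_matI) (auto simp: const_mat_def rat_const.hom_one rat_const.hom_zero)

lemma const_mat_zero: "const_mat (0\<^sub>m n m) = 0\<^sub>m n m"
  by (rule eq_matI) (auto simp: const_mat_def rat_const.hom_zero)

lemmas const_mat_hom = const_mat_mult const_mat_add const_mat_minus const_mat_uminus const_mat_one const_mat_zero

section \<open>Products of resolvents\<close>

lemma smult_smult_mat: "c \<cdot>\<^sub>m (d \<cdot>\<^sub>m A) = (c * d) \<cdot>\<^sub>m (A :: 'a :: semigroup_mult mat)"
  by (rule eq_matI) (auto simp: mult.assoc)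

lemma smult_one_mat: "1 \<cdot>\<^sub>m A = (A :: 'a :: monoid_mult mat)"
  by (rule eq_matI) auto

lemma smult_mat_cancel: 
  assumes "(c :: 'a :: field) \<noteq> 0" "c \<cdot>\<^sub>m A = c \<cdot>\<^sub>m B"
  shows "A = B"
proof -
  have "1 \<cdot>\<^sub>m A = 1 \<cdot>\<^sub>m B"
    using arg_cong[OF assms(2), of "\<lambda>M. inverse c \<cdot>\<^sub>m M"] assms(1) by (simp add: smult_smult_mat)
  then show ?thesis by (metis smult_one_mat)
qed

lemma add_mat_right_cancel:
  fixes A B C :: "'a :: cancel_semigroup_add mat"
  assumes "A + C = B + C" "dim_row A = dim_row C" "dim_row B = dim_row C" "dim_col A = dim_col C" "dim_col B = dim_col C"
  shows "A = B"
proof (rule eq_matI)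
  fix i j assume "i < dim_row B" "j < dim_col B"
  then show "A $$ (i, j) = B $$ (i, j)"
    using arg_cong[OF assms(1), of "\<lambda>M. M $$ (i, j)"] assms(2-) by simp
qed (use assms in simp_all)

text \<open>If \<open>S = z(I + S L)\<close>, then \<open>S(I + L o(L))\<close> and \<open>(I + S L) o(L)\<close> both equal \<open>S o(L) / z\<close>, and comparing
  them gives \<open>S = o(L)\<close>.\<close>

lemma res_out_unique:
  assumes L: "L \<in> carrier_mat n n" and S: "S \<in> carrier_mat n n"
    and eq: "S = rat_z \<cdot>\<^sub>m (1\<^sub>m n + S * const_mat L)"
  shows "S = res_out L"
proof -
  note o = res_out_resolvent[OF L]
  note d = L[THEN carrier_mat_dims] S[THEN carrier_mat_dims] o(1)[THEN carrier_mat_dims]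
  have "rat_z \<cdot>\<^sub>m (S + S * const_mat L * res_out L) = S * (rat_z \<cdot>\<^sub>m (1\<^sub>m n + const_mat L * res_out L))"
    by (rule eq_matI) (use d in \<open>simp_all add: mat_ring_dim distrib_left del: index_mult_mat(1)\<close>)
  also have "\<dots> = S * res_out L" using o(2) by simp
  also have "\<dots> = (rat_z \<cdot>\<^sub>m (1\<^sub>m n + S * const_mat L)) * res_out L" using eq by simp
  also have "\<dots> = rat_z \<cdot>\<^sub>m (res_out L + S * const_mat L * res_out L)"
    by (rule eq_matI) (use d in \<open>simp_all add: mat_ring_dim distrib_left del: index_mult_mat(1)\<close>)
  finally have "S + S * const_mat L * res_out L = res_out L + S * const_mat L * res_out L"
    by (rule smult_mat_cancel[rotated]) simp
  then show ?thesis by (rule add_mat_right_cancel) (use d in simp_all)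
qed

text \<open>Reflecting \<open>z e(L) = I + L e(L)\<close> gives the equation that characterizes \<open>o(L\<^sup>\<dagger>)\<close>.\<close>

lemma mat_star_res_in: 
  assumes L: "L \<in> carrier_mat n n"
  shows "mat_star (res_in L) = res_out (L\<^sup>\<dagger>)"
proof (rule res_out_unique)
  note e = res_in_resolvent[OF L]
  note d = L[THEN carrier_mat_dims] e(1)[THEN carrier_mat_dims]
  show "L\<^sup>\<dagger> \<in> carrier_mat n n" "mat_star (res_in L) \<in> carrier_mat n n" using L e by auto
  have "mat_star (rat_z \<cdot>\<^sub>m res_in L) = 1\<^sub>m n + mat_star (res_in L) * const_mat (L\<^sup>\<dagger>)"
    using d by (subst e(2)) (simp add: mat_star_add mat_star_mult)
  then have "rat_z \<cdot>\<^sub>m (rat_star rat_z \<cdot>\<^sub>m mat_star (res_in L)) = rat_z \<cdot>\<^sub>m (1\<^sub>m n + mat_star (res_in L) * const_mat (L\<^sup>\<dagger>))"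
    by (simp add: mat_star_smult)
  then show "mat_star (res_in L) = rat_z \<cdot>\<^sub>m (1\<^sub>m n + mat_star (res_in L) * const_mat (L\<^sup>\<dagger>))"
    by (simp add: smult_smult_mat rat_star_z smult_one_mat)
qed

lemma mat_star_res_out: 
  assumes L: "L \<in> carrier_mat n n"
  shows "mat_star (res_out L) = res_in (L\<^sup>\<dagger>)"
  using mat_star_res_in[of "L\<^sup>\<dagger>" n] L by (metis adjoint_adjoint adjoint_carrier mat_star_star)

text \<open>With the resolvents cleared, the claim is \<open>z(X - LXM) = (zI - L)X + LX(I - zM)\<close>. The proof keeps
  the resolvents and moves the factor \<open>z\<close> of \<open>o(M)\<close> in \<open>e(L) X o(M)\<close> over to \<open>e(L)\<close>, where
  \<open>z e(L) = I + e(L) L\<close>.\<close>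

lemma stein_in_out:
  assumes car: "L \<in> carrier_mat n n" "X \<in> carrier_mat n k" "M \<in> carrier_mat k k"
  shows "res_in L * const_mat (X - L * X * M) * res_out M = 
    const_mat X + const_mat (X * M) * res_out M + res_in L * const_mat (L * X)"
proof -
  note e = res_in_resolvent[OF car(1)] and o = res_out_resolvent[OF car(3)]
  note d = car[THEN carrier_mat_dims] e(1)[THEN carrier_mat_dims] o(1)[THEN carrier_mat_dims]
  let ?e = "res_in L" and ?o = "res_out M" and ?L = "const_mat L" and ?X = "const_mat X" and ?M = "const_mat M"
  have "?e * ?X * ?o = ?e * ?X * (rat_z \<cdot>\<^sub>m (1\<^sub>m k + ?M * ?o))" using o(2) by simp
  also have "\<dots> = (rat_z \<cdot>\<^sub>m ?e) * ?X * (1\<^sub>m k + ?M * ?o)"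
    by (rule eq_matI) (use d in \<open>simp_all add: mat_ring_dim distrib_left del: index_mult_mat(1)\<close>)
  also have "\<dots> = (1\<^sub>m n + ?e * ?L) * ?X * (1\<^sub>m k + ?M * ?o)" by (simp only: e(3))
  finally have 1: "?e * ?X * ?o = (1\<^sub>m n + ?e * ?L) * ?X * (1\<^sub>m k + ?M * ?o)" .
  have "res_in L * const_mat (X - L * X * M) * res_out M = ?e * ?X * ?o - ?e * ?L * ?X * ?M * ?o"
    by (rule eq_matI) (use d in \<open>simp_all add: mat_ring_dim const_mat_hom del: index_mult_mat(1)\<close>)
  also have "\<dots> = const_mat X + const_mat (X * M) * res_out M + res_in L * const_mat (L * X)"
    unfolding 1
    by (rule eq_matI) (use d in \<open>simp_all add: mat_ring_dim const_mat_hom del: index_mult_mat(1)\<close>)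
  finally show ?thesis .
qed

lemma stein_out_in:
  assumes car: "L \<in> carrier_mat n n" "X \<in> carrier_mat n k" "M \<in> carrier_mat k k"
  shows "res_out L * const_mat (X - L * X * M) * res_in M = 
    const_mat X + res_out L * const_mat (L * X) + const_mat (X * M) * res_in M"
proof -
  note e = res_in_resolvent[OF car(3)] and o = res_out_resolvent[OF car(1)]
  note d = car[THEN carrier_mat_dims] e(1)[THEN carrier_mat_dims] o(1)[THEN carrier_mat_dims]
  let ?e = "res_in M" and ?o = "res_out L" and ?L = "const_mat L" and ?X = "const_mat X" and ?M = "const_mat M"
  have "?o * ?X * ?e = (rat_z \<cdot>\<^sub>m (1\<^sub>m n + ?o * ?L)) * ?X * ?e" using o(3) by simp
  also have "\<dots> = (1\<^sub>m n + ?o * ?L) * ?X * (rat_z \<cdot>\<^sub>m ?e)"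
    by (rule eq_matI) (use d in \<open>simp_all add: mat_ring_dim distrib_left del: index_mult_mat(1)\<close>)
  also have "\<dots> = (1\<^sub>m n + ?o * ?L) * ?X * (1\<^sub>m k + ?M * ?e)" by (simp only: e(2))
  finally have 1: "?o * ?X * ?e = (1\<^sub>m n + ?o * ?L) * ?X * (1\<^sub>m k + ?M * ?e)" .
  have "res_out L * const_mat (X - L * X * M) * res_in M = ?o * ?X * ?e - ?o * ?L * ?X * ?M * ?e"
    by (rule eq_matI) (use d in \<open>simp_all add: mat_ring_dim const_mat_hom del: index_mult_mat(1)\<close>)
  also have "\<dots> = const_mat X + res_out L * const_mat (L * X) + const_mat (X * M) * res_in M"
    unfolding 1
    by (rule eq_matI) (use d in \<open>simp_all add: mat_ring_dim const_mat_hom del: index_mult_mat(1)\<close>)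
  finally show ?thesis .
qed

text \<open>Here the underlying identity is \<open>LX - XM = X(zI - M) - (zI - L)X\<close>.\<close>

lemma sylvester_in_in:
  assumes car: "L \<in> carrier_mat n n" "X \<in> carrier_mat n k" "M \<in> carrier_mat k k"
  shows "res_in L * const_mat (L * X - X * M) * res_in M = 
    res_in L * const_mat X - const_mat X * res_in M"
proof -
  note e = res_in_resolvent[OF car(1)] and o = res_in_resolvent[OF car(3)]
  note d = car[THEN carrier_mat_dims] e(1)[THEN carrier_mat_dims] o(1)[THEN carrier_mat_dims]
  let ?e = "res_in L" and ?o = "res_in M" and ?L = "const_mat L" and ?X = "const_mat X" and ?M = "const_mat M"
  have "(1\<^sub>m n + ?e * ?L) * ?X * ?o = (rat_z \<cdot>\<^sub>m ?e) * ?X * ?o" by (simp only: e(3))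
  also have "\<dots> = ?e * ?X * (rat_z \<cdot>\<^sub>m ?o)"
    by (rule eq_matI) (use d in \<open>simp_all add: mat_ring_dim distrib_left del: index_mult_mat(1)\<close>)
  also have "\<dots> = ?e * ?X * (1\<^sub>m k + ?M * ?o)" by (simp only: o(2))
  finally have 1: "(1\<^sub>m n + ?e * ?L) * ?X * ?o = ?e * ?X * (1\<^sub>m k + ?M * ?o)" .
  have "res_in L * const_mat (L * X - X * M) * res_in M = 
    (1\<^sub>m n + ?e * ?L) * ?X * ?o - ?X * ?o - ?e * ?X * ?M * ?o"
    by (rule eq_matI) (use d in \<open>simp_all add: mat_ring_dim const_mat_hom del: index_mult_mat(1)\<close>)
  also have "\<dots> = res_in L * const_mat X - const_mat X * res_in M"
    unfolding 1
    by (rule eq_matI) (use d in \<open>simp_all add: mat_ring_dim const_mat_hom del: index_mult_mat(1)\<close>)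
  finally show ?thesis .
qed

lemma sylvester_out_out:
  assumes car: "L \<in> carrier_mat n n" "X \<in> carrier_mat n k" "M \<in> carrier_mat k k"
  shows "res_out L * const_mat (L * X - X * M) * res_out M = 
    res_out L * const_mat X - const_mat X * res_out M"
proof -
  note e = res_out_resolvent[OF car(1)] and o = res_out_resolvent[OF car(3)]
  note d = car[THEN carrier_mat_dims] e(1)[THEN carrier_mat_dims] o(1)[THEN carrier_mat_dims]
  let ?e = "res_out L" and ?o = "res_out M" and ?L = "const_mat L" and ?X = "const_mat X" and ?M = "const_mat M"
  have "rat_z \<cdot>\<^sub>m ((1\<^sub>m n + ?e * ?L) * ?X * ?o) = (rat_z \<cdot>\<^sub>m (1\<^sub>m n + ?e * ?L)) * ?X * ?o"
    by (rule eq_matI) (use d in \<open>simp_all add: mat_ring_dim distrib_left del: index_mult_mat(1)\<close>)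
  also have "\<dots> = ?e * ?X * (rat_z \<cdot>\<^sub>m (1\<^sub>m k + ?M * ?o))" using e(3) o(2) by simp
  also have "\<dots> = rat_z \<cdot>\<^sub>m (?e * ?X * (1\<^sub>m k + ?M * ?o))"
    by (rule eq_matI) (use d in \<open>simp_all add: mat_ring_dim distrib_left del: index_mult_mat(1)\<close>)
  finally have 1: "(1\<^sub>m n + ?e * ?L) * ?X * ?o = ?e * ?X * (1\<^sub>m k + ?M * ?o)"
    by (rule smult_mat_cancel[rotated]) simp
  have "res_out L * const_mat (L * X - X * M) * res_out M = 
    (1\<^sub>m n + ?e * ?L) * ?X * ?o - ?X * ?o - ?e * ?X * ?M * ?o"
    by (rule eq_matI) (use d in \<open>simp_all add: mat_ring_dim const_mat_hom del: index_mult_mat(1)\<close>)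
  also have "\<dots> = res_out L * const_mat X - const_mat X * res_out M"
    unfolding 1
    by (rule eq_matI) (use d in \<open>simp_all add: mat_ring_dim const_mat_hom del: index_mult_mat(1)\<close>)
  finally show ?thesis .
qed

section \<open>Lossless systems and spectral factors\<close>

text \<open>This is where the poles outside the disc disappear: the term with \<open>res_out A\<close> that the Stein
  equation produces is cancelled by \<open>D\<^sup>\<dagger>C\<close>, because \<open>B\<^sup>\<dagger>PA + D\<^sup>\<dagger>C = 0\<close>.\<close>

lemma lossless_star_times_out:
  assumes car: "A \<in> carrier_mat n n" "B \<in> carrier_mat n m" "C \<in> carrier_mat k n" "D \<in> carrier_mat k m"
      "P \<in> carrier_mat n n"
    and stein: "P - A\<^sup>\<dagger> * P * A = C\<^sup>\<dagger> * C"
    and 21: "B\<^sup>\<dagger> * P * A + D\<^sup>\<dagger> * C = 0\<^sub>m m n"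
  shows "mat_star (const_mat D + const_mat C * res_out A * const_mat B) * (const_mat C * res_out A) =
    const_mat (B\<^sup>\<dagger> * P) + const_mat (B\<^sup>\<dagger>) * res_in (A\<^sup>\<dagger>) * const_mat (A\<^sup>\<dagger> * P)"
proof -
  have A': "A\<^sup>\<dagger> \<in> carrier_mat n n" using car by simp
  note d = car[THEN carrier_mat_dims] res_out_resolvent(1)[OF car(1), THEN carrier_mat_dims] 
    res_in_resolvent(1)[OF A', THEN carrier_mat_dims]
  let ?o = "res_out A" and ?e = "res_in (A\<^sup>\<dagger>)"
  have "mat_star (const_mat D + const_mat C * ?o * const_mat B) * (const_mat C * ?o) =
     const_mat (D\<^sup>\<dagger> * C) * ?o + const_mat (B\<^sup>\<dagger>) * (?e * const_mat (C\<^sup>\<dagger> * C) * ?o)"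
    using d by (simp add: mat_star_add mat_star_mult mat_star_res_out[OF car(1)] mat_ring_dim const_mat_hom)
  also have "?e * const_mat (C\<^sup>\<dagger> * C) * ?o = const_mat P + const_mat (P * A) * ?o + ?e * const_mat (A\<^sup>\<dagger> * P)"
    using stein_in_out[OF A' car(5,1)] stein by simp
  also have "const_mat (D\<^sup>\<dagger> * C) * ?o + const_mat (B\<^sup>\<dagger>) * \<dots> = 
      const_mat (B\<^sup>\<dagger> * P * A + D\<^sup>\<dagger> * C) * ?o + (const_mat (B\<^sup>\<dagger> * P) + const_mat (B\<^sup>\<dagger>) * ?e * const_mat (A\<^sup>\<dagger> * P))"
    by (rule eq_matI) (use d in \<open>simp_all add: mat_ring_dim const_mat_hom del: index_mult_mat(1)\<close>)
  also have "\<dots> = const_mat (B\<^sup>\<dagger> * P) + const_mat (B\<^sup>\<dagger>) * ?e * const_mat (A\<^sup>\<dagger> * P)"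
    unfolding 21 by (rule eq_matI) (use d in \<open>simp_all add: mat_ring_dim const_mat_hom del: index_mult_mat(1)\<close>)
  finally show ?thesis .
qed

lemma lossless_star_times:
  assumes car: "A \<in> carrier_mat n n" "B \<in> carrier_mat n m" "C \<in> carrier_mat k n" "D \<in> carrier_mat k m"
      "P \<in> carrier_mat n n"
    and stein: "P - A\<^sup>\<dagger> * P * A = C\<^sup>\<dagger> * C"
    and 21: "B\<^sup>\<dagger> * P * A + D\<^sup>\<dagger> * C = 0\<^sub>m m n"
    and 12: "A\<^sup>\<dagger> * P * B + C\<^sup>\<dagger> * D = 0\<^sub>m n m"
    and 22: "B\<^sup>\<dagger> * P * B + D\<^sup>\<dagger> * D = 1\<^sub>m m"
  defines "V \<equiv> const_mat D + const_mat C * res_out A * const_mat B"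
  shows "mat_star V * V = 1\<^sub>m m"
proof -
  have A': "A\<^sup>\<dagger> \<in> carrier_mat n n" using car by simp
  note d = car[THEN carrier_mat_dims] res_out_resolvent(1)[OF car(1), THEN carrier_mat_dims] 
    res_in_resolvent(1)[OF A', THEN carrier_mat_dims]
  let ?o = "res_out A" and ?e = "res_in (A\<^sup>\<dagger>)"
  have V: "mat_star V = const_mat (D\<^sup>\<dagger>) + const_mat (B\<^sup>\<dagger>) * ?e * const_mat (C\<^sup>\<dagger>)"
    using d by (simp add: V_def mat_star_add mat_star_mult mat_star_res_out[OF car(1)] mat_ring_dim)
  have dV: "dim_row V = k" "dim_col V = m" using d by (auto simp: V_def)
  have "mat_star V * V = mat_star V * const_mat D + (mat_star V * (const_mat C * ?o)) * const_mat B"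
    using d dV by (subst (2) V_def) (simp add: mat_ring_dim)
  also have "mat_star V * (const_mat C * ?o) = 
     const_mat (B\<^sup>\<dagger> * P) + const_mat (B\<^sup>\<dagger>) * ?e * const_mat (A\<^sup>\<dagger> * P)"
    unfolding V_def by (rule lossless_star_times_out[OF car stein 21])
  also have "mat_star V * const_mat D + \<dots> * const_mat B = const_mat (B\<^sup>\<dagger> * P * B + D\<^sup>\<dagger> * D) + 
     const_mat (B\<^sup>\<dagger>) * ?e * const_mat (A\<^sup>\<dagger> * P * B + C\<^sup>\<dagger> * D)"
    unfolding V by (rule eq_matI) (use d in \<open>simp_all add: mat_ring_dim const_mat_hom del: index_mult_mat(1)\<close>)
  also have "\<dots> = 1\<^sub>m m" unfolding 12 22 by (rule eq_matI) (use d in \<open>simp_all add: mat_ring_dim const_mat_hom del: index_mult_mat(1)\<close>)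
  finally show ?thesis .
qed

text \<open>In \<open>R\<^sup>*R\<close> the products that contain \<open>C\<^sup>\<dagger>C\<close> and \<open>\<gamma>\<^sup>\<dagger>\<gamma>\<close> combine resolvents of different kinds, and the Stein
  equations split them. The other products of two resolvents combine resolvents of the same kind;
  they are part of \<open>Z\<close> and its reflection.\<close>

lemma spectral_density:
  assumes car: "A \<in> carrier_mat n n" "B \<in> carrier_mat n m" "C \<in> carrier_mat k n" "R0 \<in> carrier_mat k m"
      "\<alpha> \<in> carrier_mat p p" "\<beta> \<in> carrier_mat p m" "\<gamma> \<in> carrier_mat k p" "P \<in> carrier_mat n n" "S \<in> carrier_mat p p"
    and P: "P - A\<^sup>\<dagger> * P * A = C\<^sup>\<dagger> * C" "P\<^sup>\<dagger> = P"
    and S: "S - \<alpha>\<^sup>\<dagger> * S * \<alpha> = \<gamma>\<^sup>\<dagger> * \<gamma>" "S\<^sup>\<dagger> = S"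
  defines "R \<equiv> const_mat R0 + const_mat C * res_out A * const_mat B + const_mat \<gamma> * res_in \<alpha> * const_mat \<beta>"
    and "Z \<equiv> const_mat (B\<^sup>\<dagger>) * res_in (A\<^sup>\<dagger>) * const_mat (C\<^sup>\<dagger> * R0 + A\<^sup>\<dagger> * P * B) +
      const_mat (B\<^sup>\<dagger>) * res_in (A\<^sup>\<dagger>) * const_mat (C\<^sup>\<dagger> * \<gamma>) * res_in \<alpha> * const_mat \<beta> +
      const_mat (R0\<^sup>\<dagger> * \<gamma> + \<beta>\<^sup>\<dagger> * S * \<alpha>) * res_in \<alpha> * const_mat \<beta>"
  shows "mat_star R * R = const_mat (R0\<^sup>\<dagger> * R0 + B\<^sup>\<dagger> * P * B + \<beta>\<^sup>\<dagger> * S * \<beta>) + Z + mat_star Z"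
proof -
  have A': "A\<^sup>\<dagger> \<in> carrier_mat n n" and \<alpha>': "\<alpha>\<^sup>\<dagger> \<in> carrier_mat p p" using car by simp_all
  note d = car[THEN carrier_mat_dims] res_out_resolvent(1)[OF car(1), THEN carrier_mat_dims] 
    res_in_resolvent(1)[OF A', THEN carrier_mat_dims] res_in_resolvent(1)[OF car(5), THEN carrier_mat_dims]
    res_out_resolvent(1)[OF \<alpha>', THEN carrier_mat_dims]
  let ?o = "res_out A" and ?e = "res_in (A\<^sup>\<dagger>)" and ?e' = "res_in \<alpha>" and ?o' = "res_out (\<alpha>\<^sup>\<dagger>)"
  have star: "mat_star ?o = ?e" "mat_star ?e = ?o" "mat_star ?e' = ?o'"
    using mat_star_res_out[OF car(1)] mat_star_res_in[OF car(5)] mat_star_res_in[OF A'] by auto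
  have R': "mat_star R = const_mat (R0\<^sup>\<dagger>) + const_mat (B\<^sup>\<dagger>) * ?e * const_mat (C\<^sup>\<dagger>)
    + const_mat (\<beta>\<^sup>\<dagger>) * ?o' * const_mat (\<gamma>\<^sup>\<dagger>)"
    using d by (simp add: R_def mat_star_add mat_star_mult star mat_ring_dim)
  have Z': "mat_star Z = const_mat (R0\<^sup>\<dagger> * C + B\<^sup>\<dagger> * P * A) * ?o * const_mat B +
      const_mat (\<beta>\<^sup>\<dagger>) * ?o' * const_mat (\<gamma>\<^sup>\<dagger> * C) * ?o * const_mat B +
      const_mat (\<beta>\<^sup>\<dagger>) * ?o' * const_mat (\<gamma>\<^sup>\<dagger> * R0 + \<alpha>\<^sup>\<dagger> * S * \<beta>)"
    using d by (simp add: Z_def mat_star_add mat_star_mult star mat_ring_dim adjoint_mult adjoint_add P S)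
  have "mat_star R * R = const_mat (R0\<^sup>\<dagger> * R0) + const_mat (R0\<^sup>\<dagger> * C) * ?o * const_mat B + const_mat (R0\<^sup>\<dagger> * \<gamma>) * ?e' * const_mat \<beta>
    + const_mat (B\<^sup>\<dagger>) * ?e * const_mat (C\<^sup>\<dagger> * R0) + const_mat (B\<^sup>\<dagger>) * (?e * const_mat (C\<^sup>\<dagger> * C) * ?o) * const_mat B 
    + const_mat (B\<^sup>\<dagger>) * ?e * const_mat (C\<^sup>\<dagger> * \<gamma>) * ?e' * const_mat \<beta>
    + const_mat (\<beta>\<^sup>\<dagger>) * ?o' * const_mat (\<gamma>\<^sup>\<dagger> * R0) + const_mat (\<beta>\<^sup>\<dagger>) * ?o' * const_mat (\<gamma>\<^sup>\<dagger> * C) * ?o * const_mat B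
    + const_mat (\<beta>\<^sup>\<dagger>) * (?o' * const_mat (\<gamma>\<^sup>\<dagger> * \<gamma>) * ?e') * const_mat \<beta>"
    unfolding R' unfolding R_def by (rule eq_matI) (use d in \<open>simp_all add: mat_ring_dim const_mat_hom del: index_mult_mat(1)\<close>)
  also have "?e * const_mat (C\<^sup>\<dagger> * C) * ?o = const_mat P + const_mat (P * A) * ?o + ?e * const_mat (A\<^sup>\<dagger> * P)"
    using stein_in_out[OF A' car(8,1)] P by simp
  also have "?o' * const_mat (\<gamma>\<^sup>\<dagger> * \<gamma>) * ?e' = const_mat S + ?o' * const_mat (\<alpha>\<^sup>\<dagger> * S) + const_mat (S * \<alpha>) * ?e'"
    using stein_out_in[OF \<alpha>' car(9,5)] S by simp
  finally show ?thesis unfolding Z' unfolding Z_def 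
    by (rule trans, intro eq_matI) (use d in \<open>simp_all add: mat_ring_dim const_mat_hom del: index_mult_mat(1)\<close>)
qed

text \<open>A Riccati equation is a Stein equation whose right-hand side depends on the solution. With that
  side abbreviated by \<open>C0\<close>, the single product with poles on both sides is split by \<open>Q\<close>.\<close>

lemma spectral_factor:
  assumes car: "T \<in> carrier_mat n n" "B \<in> carrier_mat n m" "K \<in> carrier_mat m n" "D \<in> carrier_mat m m" "Di \<in> carrier_mat m m"
      "C0 \<in> carrier_mat m n" "Q \<in> carrier_mat n n"
    and D: "D\<^sup>\<dagger> = D" "Di\<^sup>\<dagger> = Di" "D * Di = 1\<^sub>m m" "Di * D = 1\<^sub>m m"
    and Q: "Q - T * Q * T\<^sup>\<dagger> = C0\<^sup>\<dagger> * Di * Di * C0" "Q\<^sup>\<dagger> = Q"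
    and B: "B = C0\<^sup>\<dagger> + T * Q * K\<^sup>\<dagger>"
  defines "\<Psi> \<equiv> const_mat D + const_mat (Di * C0) * res_out (T\<^sup>\<dagger>) * const_mat (K\<^sup>\<dagger>)"
    and "Z \<equiv> const_mat K * res_in T * const_mat B"
  shows "mat_star \<Psi> * \<Psi> = const_mat (D * D + K * Q * K\<^sup>\<dagger>) + Z + mat_star Z"
proof -
  have T': "T\<^sup>\<dagger> \<in> carrier_mat n n" using car by simp_all
  note d = car[THEN carrier_mat_dims] res_out_resolvent(1)[OF T', THEN carrier_mat_dims] 
    res_in_resolvent(1)[OF car(1), THEN carrier_mat_dims]
  let ?o = "res_out (T\<^sup>\<dagger>)" and ?e = "res_in T"
  have star: "mat_star ?o = ?e" "mat_star ?e = ?o"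
    using mat_star_res_out[OF T'] mat_star_res_in[OF car(1)] by auto
  have \<Psi>': "mat_star \<Psi> = const_mat D + const_mat K * ?e * const_mat (C0\<^sup>\<dagger> * Di)"
    using d by (simp add: \<Psi>_def mat_star_add mat_star_mult star mat_ring_dim adjoint_mult D)
  have Z': "mat_star Z = const_mat (C0 + K * Q * T\<^sup>\<dagger>) * ?o * const_mat (K\<^sup>\<dagger>)"
    using d by (simp add: Z_def B mat_star_add mat_star_mult star mat_ring_dim adjoint_mult adjoint_add Q)
  have "mat_star \<Psi> * \<Psi> = const_mat (D * D) + const_mat (D * Di) * const_mat C0 * ?o * const_mat (K\<^sup>\<dagger>)
    + const_mat K * ?e * const_mat (C0\<^sup>\<dagger>) * const_mat (Di * D)
    + const_mat K * (?e * const_mat (C0\<^sup>\<dagger> * Di * Di * C0) * ?o) * const_mat (K\<^sup>\<dagger>)"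
    unfolding \<Psi>' unfolding \<Psi>_def by (rule eq_matI) (use d in \<open>simp_all add: mat_ring_dim const_mat_hom del: index_mult_mat(1)\<close>)
  also have "?e * const_mat (C0\<^sup>\<dagger> * Di * Di * C0) * ?o = const_mat Q + const_mat (Q * T\<^sup>\<dagger>) * ?o + ?e * const_mat (T * Q)"
    using stein_in_out[OF car(1,7) T'] Q by simp
  finally show ?thesis unfolding Z' unfolding Z_def B D
    by (rule trans, intro eq_matI) (use d in \<open>simp_all add: mat_ring_dim const_mat_hom del: index_mult_mat(1)\<close>)
qed

text \<open>The state matrix of the inverse system is \<open>T - B D\<^sup>-\<^sup>2 C\<close>; the resolvents of the two state matrices
  are related by the Sylvester identity with \<open>X = I\<close>, which is the resolvent equation.\<close>

lemma factor_inverse: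
  assumes car: "T \<in> carrier_mat n n" "B \<in> carrier_mat n m" "D \<in> carrier_mat m m" "Di \<in> carrier_mat m m"
      "C \<in> carrier_mat m n"
    and D: "D * Di = 1\<^sub>m m"
  defines "A0 \<equiv> T - B * Di * Di * C"
  defines "\<Psi>i \<equiv> const_mat Di - const_mat (Di * Di * C) * res_out A0 * const_mat (B * Di)"
  shows "(const_mat D + const_mat (Di * C) * res_out T * const_mat B) * \<Psi>i = 1\<^sub>m m"
    and "res_out T * const_mat B * \<Psi>i = res_out A0 * const_mat (B * Di)"
    and "\<Psi>i \<in> carrier_mat m m"
proof -
  have A0: "A0 \<in> carrier_mat n n" by (rule carrier_matI) (use car in \<open>simp_all add: A0_def\<close>)
  note d = car[THEN carrier_mat_dims] res_out_resolvent(1)[OF car(1), THEN carrier_mat_dims] 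
    res_out_resolvent(1)[OF A0, THEN carrier_mat_dims] A0[THEN carrier_mat_dims]
  let ?o = "res_out T" and ?r = "res_out A0"
  have TA: "T * 1\<^sub>m n - 1\<^sub>m n * A0 = B * Di * Di * C" unfolding A0_def
    by (rule eq_matI) (use d in \<open>simp_all add: mat_ring_dim const_mat_hom del: index_mult_mat(1)\<close>)
  have res: "?o * const_mat (B * Di * Di * C) * ?r = ?o - ?r"
    using sylvester_out_out[OF car(1) one_carrier_mat[of n] A0] d unfolding TA
    by (simp only: const_mat_one mult_one_mat_dim one_mult_mat_dim)
  show car': "\<Psi>i \<in> carrier_mat m m" using d by (auto simp: \<Psi>i_def)
  have "?o * const_mat B * \<Psi>i = ?o * const_mat (B * Di) - ?o * const_mat (B * Di * Di * C) * ?r * const_mat (B * Di)"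
    unfolding \<Psi>i_def by (rule eq_matI) (use d in \<open>simp_all add: mat_ring_dim const_mat_hom del: index_mult_mat(1)\<close>)
  also have "\<dots> = ?r * const_mat (B * Di)" unfolding res by (rule eq_matI) (use d in \<open>simp_all add: mat_ring_dim const_mat_hom del: index_mult_mat(1)\<close>)
  finally show 2: "?o * const_mat B * \<Psi>i = ?r * const_mat (B * Di)" .
  have d': "dim_row \<Psi>i = m" "dim_col \<Psi>i = m" using car' by auto
  have "(const_mat D + const_mat (Di * C) * ?o * const_mat B) * \<Psi>i = 
    const_mat D * \<Psi>i + const_mat (Di * C) * (?o * const_mat B * \<Psi>i)"
    using d d' by (simp add: mat_ring_dim)
  also have "\<dots> = const_mat (D * Di) - const_mat (D * Di) * const_mat (Di * C) * ?r * const_mat (B * Di) + 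
      const_mat (Di * C) * (?r * const_mat (B * Di))"
    unfolding 2 unfolding \<Psi>i_def by (rule eq_matI) (use d in \<open>simp_all add: mat_ring_dim const_mat_hom del: index_mult_mat(1)\<close>)
  also have "\<dots> = 1\<^sub>m m" unfolding D by (rule eq_matI) (use d in \<open>simp_all add: mat_ring_dim const_mat_hom del: index_mult_mat(1)\<close>)
  finally show "(const_mat D + const_mat (Di * C) * res_out T * const_mat B) * \<Psi>i = 1\<^sub>m m" .
qed

section \<open>Realizations of products\<close>

text \<open>The equation for \<open>Y\<close> is a Stein equation in disguise: \<open>X = F + Y A0\<close> satisfies \<open>\<alpha>X = Y\<close> and hence
  \<open>X - \<alpha>XA0 = F\<close>.\<close>

lemma res_in_times_factor_inverse:
  assumes car: "\<alpha> \<in> carrier_mat p p" "A0 \<in> carrier_mat n n" "F \<in> carrier_mat p n" "Y \<in> carrier_mat p n"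
      "\<beta> \<in> carrier_mat p m" "K \<in> carrier_mat n m"
    and Y: "Y - \<alpha> * Y * A0 = \<alpha> * F"
  shows "res_in \<alpha> * (const_mat \<beta> - const_mat F * res_out A0 * const_mat K) =
     res_in \<alpha> * const_mat (\<beta> - Y * K) - const_mat ((F + Y * A0) * K) 
       - const_mat ((F + Y * A0) * A0) * res_out A0 * const_mat K"
proof -
  note d = car[THEN carrier_mat_dims] res_out_resolvent(1)[OF car(2), THEN carrier_mat_dims] 
    res_in_resolvent(1)[OF car(1), THEN carrier_mat_dims]
  define X where "X = F + Y * A0"
  have X: "X \<in> carrier_mat p n" by (rule carrier_matI) (use d in \<open>simp_all add: X_def\<close>)
  have "\<alpha> * X = \<alpha> * F + \<alpha> * Y * A0" unfolding X_def by (rule eq_matI) (use d in \<open>simp_all add: mat_ring_dim const_mat_hom del: index_mult_mat(1)\<close>)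
  also have "\<dots> = Y" unfolding Y[symmetric] by (rule eq_matI) (use d in \<open>simp_all add: mat_ring_dim const_mat_hom del: index_mult_mat(1)\<close>)
  finally have \<alpha>X: "\<alpha> * X = Y" .
  have F: "X - \<alpha> * X * A0 = F" unfolding \<alpha>X unfolding X_def by (rule eq_matI) (use d in \<open>simp_all add: mat_ring_dim const_mat_hom del: index_mult_mat(1)\<close>)
  note st = stein_in_out[OF car(1) X car(2), unfolded F, unfolded \<alpha>X]
  have dX: "dim_row X = p" "dim_col X = n" using X by auto
  note d = d dX
  have "res_in \<alpha> * (const_mat \<beta> - const_mat F * res_out A0 * const_mat K) =
    res_in \<alpha> * const_mat \<beta> - (res_in \<alpha> * const_mat F * res_out A0) * const_mat K" by (rule eq_matI) (use d in \<open>simp_all add: mat_ring_dim const_mat_hom del: index_mult_mat(1)\<close>)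
  also have "res_in \<alpha> * const_mat F * res_out A0 = 
    const_mat X + const_mat (X * A0) * res_out A0 + res_in \<alpha> * const_mat Y"
    by (fact st)
  also have "res_in \<alpha> * const_mat \<beta> - \<dots> * const_mat K = 
     res_in \<alpha> * const_mat (\<beta> - Y * K) - const_mat (X * K) - const_mat (X * A0) * res_out A0 * const_mat K"
    by (rule eq_matI) (use d in \<open>simp_all add: mat_ring_dim const_mat_hom del: index_mult_mat(1)\<close>)
  finally show ?thesis unfolding X_def .
qed

text \<open>Each of the four products of two resolvents is split by the matrix equation for its pair of state
  matrices: \<open>P\<close> for \<open>A\<^sup>\<dagger>, A\<close>, \<open>S\<close> for \<open>\<alpha>\<^sup>\<dagger>, \<alpha>\<close>, and \<open>P1\<close> with its adjoint for the two mixed pairs. The matrix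
  \<open>G\<close> collects all that multiplies \<open>res_in (A\<^sup>\<dagger>)\<close> from the right.\<close>

lemma res_in_star_product:
  assumes car: "\<alpha> \<in> carrier_mat p p" "A \<in> carrier_mat n n" "P \<in> carrier_mat n n" "P1 \<in> carrier_mat n p" "S \<in> carrier_mat p p"
      "\<Xi>0 \<in> carrier_mat k m" "\<beta> \<in> carrier_mat p m" "\<gamma> \<in> carrier_mat k p" "C \<in> carrier_mat k n" "K \<in> carrier_mat n m"
    and P: "P - A\<^sup>\<dagger> * P * A = C\<^sup>\<dagger> * C"
    and S: "S - \<alpha>\<^sup>\<dagger> * S * \<alpha> = \<gamma>\<^sup>\<dagger> * \<gamma>"
    and P1: "A\<^sup>\<dagger> * P1 - P1 * \<alpha> = - (C\<^sup>\<dagger> * \<gamma>)"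
  defines "\<Xi> \<equiv> const_mat \<Xi>0 + const_mat \<gamma> * res_in \<alpha> * const_mat \<beta> + const_mat C * res_out A * const_mat K"
    and "G \<equiv> C\<^sup>\<dagger> * \<Xi>0 - P1 * \<beta> + A\<^sup>\<dagger> * P * K"
  shows "mat_star \<Xi> * \<Xi> = const_mat (K\<^sup>\<dagger>) * res_in (A\<^sup>\<dagger>) * const_mat G
    + const_mat (\<Xi>0\<^sup>\<dagger> * \<gamma> + \<beta>\<^sup>\<dagger> * S * \<alpha> + K\<^sup>\<dagger> * P1) * res_in \<alpha> * const_mat \<beta>
    + const_mat (\<beta>\<^sup>\<dagger>) * res_out (\<alpha>\<^sup>\<dagger>) * const_mat (\<gamma>\<^sup>\<dagger> * \<Xi>0 + \<alpha>\<^sup>\<dagger> * S * \<beta> + P1\<^sup>\<dagger> * K)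
    + const_mat (\<Xi>0\<^sup>\<dagger> * C - \<beta>\<^sup>\<dagger> * P1\<^sup>\<dagger> + K\<^sup>\<dagger> * P * A) * res_out A * const_mat K
    + const_mat (\<Xi>0\<^sup>\<dagger> * \<Xi>0 + \<beta>\<^sup>\<dagger> * S * \<beta> + K\<^sup>\<dagger> * P * K)"
proof -
  have A': "A\<^sup>\<dagger> \<in> carrier_mat n n" and \<alpha>': "\<alpha>\<^sup>\<dagger> \<in> carrier_mat p p" and P1': "P1\<^sup>\<dagger> \<in> carrier_mat p n" using car by simp_all
  note d = car[THEN carrier_mat_dims] res_out_resolvent(1)[OF car(2), THEN carrier_mat_dims] 
    res_in_resolvent(1)[OF A', THEN carrier_mat_dims] res_in_resolvent(1)[OF car(1), THEN carrier_mat_dims]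
    res_out_resolvent(1)[OF \<alpha>', THEN carrier_mat_dims]
  let ?o = "res_out A" and ?e = "res_in (A\<^sup>\<dagger>)" and ?e' = "res_in \<alpha>" and ?o' = "res_out (\<alpha>\<^sup>\<dagger>)"
  have star: "mat_star ?o = ?e" "mat_star ?e' = ?o'"
    using mat_star_res_out[OF car(2)] mat_star_res_in[OF car(1)] by auto
  have \<Xi>': "mat_star \<Xi> = const_mat (\<Xi>0\<^sup>\<dagger>) + const_mat (K\<^sup>\<dagger>) * ?e * const_mat (C\<^sup>\<dagger>)
    + const_mat (\<beta>\<^sup>\<dagger>) * ?o' * const_mat (\<gamma>\<^sup>\<dagger>)"
    unfolding \<Xi>_def 
    by (rule eq_matI) (use d in \<open>simp_all add: mat_star_add mat_star_mult star mat_ring_dim del: index_mult_mat(1) mat_star_index\<close>)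
  have "\<alpha>\<^sup>\<dagger> * P1\<^sup>\<dagger> - P1\<^sup>\<dagger> * A = - (P1\<^sup>\<dagger> * A - \<alpha>\<^sup>\<dagger> * P1\<^sup>\<dagger>)"
    by (rule eq_matI) (use d in \<open>simp_all add: mat_ring_dim const_mat_hom del: index_mult_mat(1)\<close>)
  also have "P1\<^sup>\<dagger> * A - \<alpha>\<^sup>\<dagger> * P1\<^sup>\<dagger> = (A\<^sup>\<dagger> * P1 - P1 * \<alpha>)\<^sup>\<dagger>"
    using d by (simp add: adjoint_minus adjoint_mult)
  also have "- \<dots> = \<gamma>\<^sup>\<dagger> * C"
    unfolding P1 using d by (simp add: adjoint_uminus adjoint_mult)
  finally have P1s: "\<alpha>\<^sup>\<dagger> * P1\<^sup>\<dagger> - P1\<^sup>\<dagger> * A = \<gamma>\<^sup>\<dagger> * C" .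
  have P1u: "?e * const_mat (C\<^sup>\<dagger> * \<gamma>) * ?e' = - (?e * const_mat (A\<^sup>\<dagger> * P1 - P1 * \<alpha>) * ?e')"
    unfolding P1 by (rule eq_matI) (use d in \<open>simp_all add: mat_ring_dim const_mat_hom del: index_mult_mat(1)\<close>)
  have "mat_star \<Xi> * \<Xi> = const_mat (\<Xi>0\<^sup>\<dagger> * \<Xi>0) + const_mat (\<Xi>0\<^sup>\<dagger> * C) * ?o * const_mat K + const_mat (\<Xi>0\<^sup>\<dagger> * \<gamma>) * ?e' * const_mat \<beta>
    + const_mat (K\<^sup>\<dagger>) * ?e * const_mat (C\<^sup>\<dagger> * \<Xi>0) + const_mat (K\<^sup>\<dagger>) * (?e * const_mat (C\<^sup>\<dagger> * C) * ?o) * const_mat K 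
    + const_mat (K\<^sup>\<dagger>) * (?e * const_mat (C\<^sup>\<dagger> * \<gamma>) * ?e') * const_mat \<beta>
    + const_mat (\<beta>\<^sup>\<dagger>) * ?o' * const_mat (\<gamma>\<^sup>\<dagger> * \<Xi>0) + const_mat (\<beta>\<^sup>\<dagger>) * (?o' * const_mat (\<gamma>\<^sup>\<dagger> * C) * ?o) * const_mat K
    + const_mat (\<beta>\<^sup>\<dagger>) * (?o' * const_mat (\<gamma>\<^sup>\<dagger> * \<gamma>) * ?e') * const_mat \<beta>"
    unfolding \<Xi>' unfolding \<Xi>_def by (rule eq_matI) (use d in \<open>simp_all add: mat_ring_dim const_mat_hom del: index_mult_mat(1)\<close>)
  also have "?e * const_mat (C\<^sup>\<dagger> * C) * ?o = const_mat P + const_mat (P * A) * ?o + ?e * const_mat (A\<^sup>\<dagger> * P)"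
    using stein_in_out[OF A' car(3,2)] P by simp
  also have "?o' * const_mat (\<gamma>\<^sup>\<dagger> * \<gamma>) * ?e' = const_mat S + ?o' * const_mat (\<alpha>\<^sup>\<dagger> * S) + const_mat (S * \<alpha>) * ?e'"
    using stein_out_in[OF \<alpha>' car(5,1)] S by simp
  also have "?e * const_mat (C\<^sup>\<dagger> * \<gamma>) * ?e' = - (?e * const_mat P1 - const_mat P1 * ?e')"
    using sylvester_in_in[OF A' car(4,1)] P1u by simp
  also have "?o' * const_mat (\<gamma>\<^sup>\<dagger> * C) * ?o = ?o' * const_mat (P1\<^sup>\<dagger>) - const_mat (P1\<^sup>\<dagger>) * ?o"
    using sylvester_out_out[OF \<alpha>' P1' car(2)] P1s by simp
  finally show ?thesis unfolding G_def
    by (rule trans, intro eq_matI) (use d in \<open>simp_all add: mat_ring_dim const_mat_hom del: index_mult_mat(1)\<close>)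
qed

text \<open>The product of \<open>res_in (A\<^sup>\<dagger>)\<close> and \<open>res_in \<alpha>\<close> is split by \<open>P1\<close>. What remains of \<open>res_in (A\<^sup>\<dagger>)\<close> is
  multiplied by the matrix that is assumed to vanish.\<close>

lemma lossless_quotient_realization:
  assumes car: "\<alpha> \<in> carrier_mat p p" "A \<in> carrier_mat n n" "P \<in> carrier_mat n n" "P1 \<in> carrier_mat n p"
      "\<Xi>0 \<in> carrier_mat k m" "\<beta> \<in> carrier_mat p m" "\<gamma> \<in> carrier_mat k p" "C \<in> carrier_mat k n" "K \<in> carrier_mat n m"
      "B \<in> carrier_mat n k" "D \<in> carrier_mat k k"
    and P1: "A\<^sup>\<dagger> * P1 - P1 * \<alpha> = - (C\<^sup>\<dagger> * \<gamma>)"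
    and G: "C\<^sup>\<dagger> * \<Xi>0 - P1 * \<beta> + A\<^sup>\<dagger> * P * K = 0\<^sub>m n m"
  shows "(const_mat (D\<^sup>\<dagger>) + const_mat (B\<^sup>\<dagger>) * res_in (A\<^sup>\<dagger>) * const_mat (C\<^sup>\<dagger>)) * (const_mat \<Xi>0 + const_mat \<gamma> * res_in \<alpha> * const_mat \<beta>)
     + (const_mat (B\<^sup>\<dagger> * P) + const_mat (B\<^sup>\<dagger>) * res_in (A\<^sup>\<dagger>) * const_mat (A\<^sup>\<dagger> * P)) * const_mat K
     = const_mat (D\<^sup>\<dagger> * \<Xi>0 + B\<^sup>\<dagger> * P * K) + const_mat (D\<^sup>\<dagger> * \<gamma> + B\<^sup>\<dagger> * P1) * res_in \<alpha> * const_mat \<beta>"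
proof -
  have A': "A\<^sup>\<dagger> \<in> carrier_mat n n" using car by simp_all
  note d = car[THEN carrier_mat_dims] 
    res_in_resolvent(1)[OF A', THEN carrier_mat_dims] res_in_resolvent(1)[OF car(1), THEN carrier_mat_dims]
  let ?e = "res_in (A\<^sup>\<dagger>)" and ?e' = "res_in \<alpha>"
  have P1u: "?e * const_mat (C\<^sup>\<dagger> * \<gamma>) * ?e' = - (?e * const_mat (A\<^sup>\<dagger> * P1 - P1 * \<alpha>) * ?e')"
    unfolding P1 by (rule eq_matI) (use d in \<open>simp_all add: mat_ring_dim const_mat_hom del: index_mult_mat(1)\<close>)
  have "(const_mat (D\<^sup>\<dagger>) + const_mat (B\<^sup>\<dagger>) * ?e * const_mat (C\<^sup>\<dagger>)) * (const_mat \<Xi>0 + const_mat \<gamma> * ?e' * const_mat \<beta>)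
     + (const_mat (B\<^sup>\<dagger> * P) + const_mat (B\<^sup>\<dagger>) * ?e * const_mat (A\<^sup>\<dagger> * P)) * const_mat K = 
    const_mat (D\<^sup>\<dagger> * \<Xi>0 + B\<^sup>\<dagger> * P * K) + const_mat (D\<^sup>\<dagger> * \<gamma>) * ?e' * const_mat \<beta> 
    + const_mat (B\<^sup>\<dagger>) * ?e * const_mat (C\<^sup>\<dagger> * \<Xi>0 + A\<^sup>\<dagger> * P * K) 
    + const_mat (B\<^sup>\<dagger>) * (?e * const_mat (C\<^sup>\<dagger> * \<gamma>) * ?e') * const_mat \<beta>" by (rule eq_matI) (use d in \<open>simp_all add: mat_ring_dim const_mat_hom del: index_mult_mat(1)\<close>)
  also have "?e * const_mat (C\<^sup>\<dagger> * \<gamma>) * ?e' = - (?e * const_mat P1 - const_mat P1 * ?e')"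
    using sylvester_in_in[OF A' car(4,1)] P1u by simp
  also have "const_mat (D\<^sup>\<dagger> * \<Xi>0 + B\<^sup>\<dagger> * P * K) + const_mat (D\<^sup>\<dagger> * \<gamma>) * ?e' * const_mat \<beta> 
    + const_mat (B\<^sup>\<dagger>) * ?e * const_mat (C\<^sup>\<dagger> * \<Xi>0 + A\<^sup>\<dagger> * P * K) + const_mat (B\<^sup>\<dagger>) * \<dots> * const_mat \<beta> = 
    const_mat (D\<^sup>\<dagger> * \<Xi>0 + B\<^sup>\<dagger> * P * K) + const_mat (D\<^sup>\<dagger> * \<gamma> + B\<^sup>\<dagger> * P1) * ?e' * const_mat \<beta> 
    + const_mat (B\<^sup>\<dagger>) * ?e * const_mat (C\<^sup>\<dagger> * \<Xi>0 - P1 * \<beta> + A\<^sup>\<dagger> * P * K)" by (rule eq_matI) (use d in \<open>simp_all add: mat_ring_dim const_mat_hom del: index_mult_mat(1)\<close>)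
  also have "\<dots> = const_mat (D\<^sup>\<dagger> * \<Xi>0 + B\<^sup>\<dagger> * P * K) + const_mat (D\<^sup>\<dagger> * \<gamma> + B\<^sup>\<dagger> * P1) * ?e' * const_mat \<beta>"
    unfolding G by (rule eq_matI) (use d in \<open>simp_all add: mat_ring_dim const_mat_hom del: index_mult_mat(1)\<close>)
  finally show ?thesis .
qed

section \<open>Strictly proper functions without poles\<close>

lemma mat_eval_dim [simp]: "dim_row (mat_eval F z) = dim_row F" "dim_col (mat_eval F z) = dim_col F"
  by (auto simp: mat_eval_def)

lemma spectrum_adjoint:
  assumes A: "A \<in> carrier_mat n n"
  shows "spectrum (A\<^sup>\<dagger>) = cnj ` spectrum A"
proof -
  have A': "A\<^sup>\<dagger> \<in> carrier_mat n n" using A by simp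
  interpret c: comm_ring_hom cnj by unfold_locales auto
  have 1: "char_matrix (A\<^sup>\<dagger>) (cnj \<mu>) = transpose_mat (map_mat cnj (char_matrix A \<mu>))" for \<mu>
    by (rule eq_matI) (use A in \<open>auto simp: char_matrix_def\<close>)
  have "eigenvalue (A\<^sup>\<dagger>) (cnj \<mu>) \<longleftrightarrow> eigenvalue A \<mu>" for \<mu>
  proof -
    have "det (char_matrix (A\<^sup>\<dagger>) (cnj \<mu>)) = cnj (det (char_matrix A \<mu>))"
      unfolding 1 using A by (subst det_transpose[of _ n]) (auto simp: c.hom_det)
    then show ?thesis unfolding eigenvalue_det[OF A] eigenvalue_det[OF A'] by simp
  qed
  then show ?thesis unfolding spectrum_def 
    by (auto simp: image_iff) (metis complex_cnj_cnj)
qed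

lemma stable_mat_adjoint: 
  assumes "stable_mat A"
  shows "stable_mat (A\<^sup>\<dagger>)"
proof -
  have "A \<in> carrier_mat (dim_row A) (dim_row A)" using assms by (auto simp: stable_mat_def)
  from spectrum_adjoint[OF this] show ?thesis using assms by (auto simp: stable_mat_def)
qed

lemma stable_res_out_no_pole:
  assumes "L \<in> carrier_mat n n" "stable_mat L" "cmod z \<le> 1"
  shows "\<not> mat_pole (res_out L) z"
proof (rule res_out_no_pole[OF assms(1)])
  show "z = 0 \<or> 1 / z \<notin> spectrum L"
  proof (rule disjCI)
    assume "\<not> 1 / z \<notin> spectrum L"
    then have "cmod (1 / z) < 1" using assms(2) by (auto simp: stable_mat_def)
    then show "z = 0" using assms(3) by (simp add: norm_divide divide_simps split: if_splits)
  qed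
qed

lemma pole_free_entire:
  assumes "\<And>z. \<not> rat_pole q z"
  obtains f where "q = to_fract f"
proof -
  have "\<exists>a l. a \<noteq> 0 \<and> l = 0 \<and> snd (quot_of_fract q) = pCons a l"
    using fundamental_theorem_of_algebra_alt[of "snd (quot_of_fract q)"] assms by (auto simp: rat_pole_def)
  then obtain a where a: "a \<noteq> 0" "snd (quot_of_fract q) = [:a:]" by auto
  have "q = Fraction_Field.Fract (fst (quot_of_fract q)) (snd (quot_of_fract q))"
    by (metis quot_to_fract_quot_of_fract quot_to_fract_def case_prod_unfold)
  also have "\<dots> = to_fract ([:1 / a:] * (fst (quot_of_fract q)))"
    using a by (simp add: to_fract_def eq_fract)
  finally show ?thesis using that by blast
qed

lemma rat_eval_isCont:
  assumes "\<not> rat_pole q z"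
  shows "isCont (rat_eval q) z"
  using assms unfolding rat_eval_def rat_pole_def
  by (intro continuous_intros) auto

text \<open>A nonzero polynomial is bounded away from zero near infinity, so its reflection cannot tend to
  zero at the origin.\<close>

lemma poly_star_vanishing_at_0:
  assumes "\<not> rat_pole (rat_star (to_fract f)) 0" "rat_eval (rat_star (to_fract f)) 0 = 0"
  shows "f = 0"
proof (rule ccontr)
  assume f: "f \<noteq> 0"
  obtain c p where p: "f = pCons c p" by (cases f)
  obtain r d where d: "d > 0" "\<And>w. r \<le> cmod w \<Longrightarrow> d \<le> cmod (poly f w)"
  proof (cases "p = 0")
    case True
    then show ?thesis using that[of "cmod c"] p f by auto
  next
    case False
    from poly_infinity[OF this, of 1 c] show ?thesis using that[of 1] p by auto
  qed
  obtain e where e: "e > 0" "\<And>z. z \<noteq> 0 \<Longrightarrow> cmod z < e \<Longrightarrow> cmod (rat_eval (rat_star (to_fract f)) z) < d"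
    using rat_eval_isCont[OF assms(1)] d(1) unfolding isCont_def LIM_eq assms(2) by auto
  \<comment> \<open>a point so large that the polynomial is at least \<open>d\<close> in modulus and its reflection is \<open>e\<close>-close to 0\<close>
  define w where "w = complex_of_real (max r 0 + 1 / e + 1)"
  have w: "cmod w = max r 0 + 1 / e + 1" unfolding w_def using e(1) by (simp only: norm_of_real) simp
  have w0: "w \<noteq> 0" using w e(1) by (auto simp: add_nonneg_eq_0_iff)
  have "rat_eval (rat_star (to_fract f)) (1 / cnj w) = cnj (poly f w)"
    using rat_eval_star(2)[of "1 / cnj w" "to_fract f"] w0 by (simp add: rat_eval_to_fract)
  moreover have "cmod (1 / cnj w) < e"
  proof -
    have "1 / e < cmod w" using w by linarith
    then show ?thesis using e(1) w0 by (simp add: norm_divide divide_simps mult.commute)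
  qed
  moreover have "d \<le> cmod (poly f w)" 
  proof (rule d(2))
    have "1 / e > 0" using e(1) by simp
    then show "r \<le> cmod w" unfolding w by linarith
  qed
  ultimately show False using e(2)[of "1 / cnj w"] w0 by simp
qed

text \<open>Behaviour at infinity, expressed at the origin by reflection.\<close>

lemma star_strictly_proper_at_0:
  assumes "A \<in> carrier_mat n n" "K \<in> carrier_mat k n" "G \<in> carrier_mat n m"
  shows "\<not> mat_pole (mat_star (const_mat K * res_in A * const_mat G)) 0"
    and "mat_eval (mat_star (const_mat K * res_in A * const_mat G)) 0 = 0\<^sub>m m k"
proof -
  have A': "A\<^sup>\<dagger> \<in> carrier_mat n n" using assms by simp
  note d = assms[THEN carrier_mat_dims] res_in_resolvent(1)[OF assms(1), THEN carrier_mat_dims]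
    res_out_resolvent(1)[OF A', THEN carrier_mat_dims]
  have eq: "mat_star (const_mat K * res_in A * const_mat G) = const_mat (G\<^sup>\<dagger>) * (res_out (A\<^sup>\<dagger>) * const_mat (K\<^sup>\<dagger>))"
    using d mat_star_res_in[OF assms(1)] by (simp add: mat_star_mult)
  note o = res_out_no_pole[OF A', of 0, simplified] res_out_at_0[OF A']
  show "\<not> mat_pole (mat_star (const_mat K * res_in A * const_mat G)) 0"
    unfolding eq using d by (intro no_mat_pole_mult no_mat_pole_const o(1)) auto
  show "mat_eval (mat_star (const_mat K * res_in A * const_mat G)) 0 = 0\<^sub>m m k"
    unfolding eq using d
    by (simp add: mat_eval_mult no_mat_pole_mult no_mat_pole_const o zero_mult_mat_dim mult_zero_mat_dim)
qed

text \<open>Liouville's theorem for rational functions: entries without poles are polynomials, and a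
  polynomial that vanishes at infinity is zero.\<close>

lemma strictly_proper_pole_free_eq_0:
  assumes car: "A \<in> carrier_mat n n" "K \<in> carrier_mat k n" "G \<in> carrier_mat n m"
    and free: "\<And>z. \<not> mat_pole (const_mat K * res_in A * const_mat G) z"
  shows "const_mat K * res_in A * const_mat G = 0\<^sub>m k m"
proof -
  let ?F = "const_mat K * res_in A * const_mat G"
  note d = car[THEN carrier_mat_dims] res_in_resolvent(1)[OF car(1), THEN carrier_mat_dims]
  note s = star_strictly_proper_at_0[OF car]
  show ?thesis
  proof (rule eq_matI)
    fix i j assume "i < dim_row (0\<^sub>m k m :: ratmat)" "j < dim_col (0\<^sub>m k m :: ratmat)"
    then have ij: "i < k" "j < m" by auto
    then have "\<not> rat_pole (?F $$ (i, j)) z" for z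
      using free[of z] d by (auto simp: mat_pole_def simp del: index_mult_mat(1))
    then obtain f where f: "?F $$ (i, j) = to_fract f" using pole_free_entire by metis
    have star: "mat_star ?F $$ (j, i) = rat_star (to_fract f)"
      using ij d f by simp
    have "\<not> rat_pole (mat_star ?F $$ (j, i)) 0"
      using s(1) ij d by (auto simp: mat_pole_def simp del: index_mult_mat(1) mat_star_index)
    moreover have "rat_eval (mat_star ?F $$ (j, i)) 0 = 0"
      using arg_cong[OF s(2), of "\<lambda>M. M $$ (j, i)"] ij d
      by (simp add: mat_eval_def del: index_mult_mat(1) mat_star_index)
    ultimately have "f = 0" unfolding star by (rule poly_star_vanishing_at_0)
    then show "?F $$ (i, j) = (0\<^sub>m k m :: ratmat) $$ (i, j)" using f ij by simp
  qed (use d in auto)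
qed

lemma const_plus_strictly_proper_eq_0:
  assumes car: "A \<in> carrier_mat n n" "K \<in> carrier_mat k n" "G \<in> carrier_mat n m" "X \<in> carrier_mat k m"
    and 0: "const_mat X + const_mat K * res_in A * const_mat G = 0\<^sub>m k m"
  shows "X = 0\<^sub>m k m"
proof -
  let ?F = "const_mat K * res_in A * const_mat G"
  note d = car[THEN carrier_mat_dims] res_in_resolvent(1)[OF car(1), THEN carrier_mat_dims]
  have "?F = const_mat (- X)" 
  proof (rule eq_matI)
    fix i j assume "i < dim_row (const_mat (- X))" "j < dim_col (const_mat (- X))"
    then show "?F $$ (i, j) = const_mat (- X) $$ (i, j)"
      using arg_cong[OF 0, of "\<lambda>M. M $$ (i, j)"] d
      by (simp add: const_mat_uminus eq_neg_iff_add_eq_0 add.commute del: index_mult_mat(1))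
  qed (use d in auto)
  then have "mat_eval (const_mat ((- X)\<^sup>\<dagger>)) 0 = 0\<^sub>m m k"
    using star_strictly_proper_at_0(2)[OF car(1-3)] by simp
  moreover have "mat_eval (const_mat ((- X)\<^sup>\<dagger>)) 0 = (- X)\<^sup>\<dagger>"
    by (rule eq_matI) (auto simp: mat_eval_def const_mat_def rat_eval_const)
  ultimately have "(- X)\<^sup>\<dagger> = 0\<^sub>m m k" by simp
  then have "- X = 0\<^sub>m k m" by (metis adjoint_adjoint adjoint_zero)
  then have "X = - 0\<^sub>m k m" by (metis uminus_uminus_mat)
  then show ?thesis by (auto intro!: eq_matI)
qed

text \<open>The matrices \<open>K A\<^sup>j G\<close> are the coefficients of the expansion at infinity. Multiplying
  \<open>K e(A) G = 0\<close> by \<open>z\<close> gives \<open>K G + K A e(A) G = 0\<close>, where the constant and the strictly proper part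
  vanish separately; this is the induction step.\<close>

lemma res_in_eq_0_moments:
  assumes car: "A \<in> carrier_mat n n" "K \<in> carrier_mat k n" "G \<in> carrier_mat n m"
    and zero: "const_mat K * res_in A * const_mat G = 0\<^sub>m k m"
  shows "K * A ^\<^sub>m j * G = 0\<^sub>m k m"
proof -
  have step: "L * G = 0\<^sub>m k m \<and> const_mat (L * A) * res_in A * const_mat G = 0\<^sub>m k m"
    if L: "L \<in> carrier_mat k n" and z: "const_mat L * res_in A * const_mat G = 0\<^sub>m k m" for L
  proof -
    note d = car[THEN carrier_mat_dims] res_in_resolvent(1)[OF car(1), THEN carrier_mat_dims] L[THEN carrier_mat_dims]
    have "const_mat (L * G) + const_mat (L * A) * res_in A * const_mat G =
        const_mat L * (1\<^sub>m n + const_mat A * res_in A) * const_mat G" by (rule eq_matI) (use d in \<open>simp_all add: mat_ring_dim const_mat_hom del: index_mult_mat(1)\<close>)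
    also have "\<dots> = rat_z \<cdot>\<^sub>m (const_mat L * res_in A * const_mat G)"
      unfolding res_in_resolvent(2)[OF car(1), symmetric] by (rule eq_matI) (use d in \<open>simp_all add: mat_ring_dim const_mat_hom del: index_mult_mat(1)\<close>)
    finally have 1: "const_mat (L * G) + const_mat (L * A) * res_in A * const_mat G = 0\<^sub>m k m"
      unfolding z by simp
    have 2: "L * G = 0\<^sub>m k m"
      by (rule const_plus_strictly_proper_eq_0[OF car(1) mult_carrier_mat[OF L car(1)] car(3)
            mult_carrier_mat[OF L car(3)] 1])
    have "const_mat (L * A) * res_in A * const_mat G = 
        0\<^sub>m k m + const_mat (L * A) * res_in A * const_mat G" by (rule eq_matI) (use d in \<open>simp_all add: mat_ring_dim const_mat_hom del: index_mult_mat(1)\<close>)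
    also have "\<dots> = 0\<^sub>m k m" using 1 unfolding 2 const_mat_zero .
    finally have "const_mat (L * A) * res_in A * const_mat G = 0\<^sub>m k m" .
    with 2 show ?thesis by simp
  qed
  have "const_mat (K * A ^\<^sub>m j) * res_in A * const_mat G = 0\<^sub>m k m"
  proof (induction j)
    case (Suc j)
    have "K * A ^\<^sub>m j \<in> carrier_mat k n" by (rule carrier_matI) (use car in auto)
    from step[OF this Suc] have "const_mat (K * A ^\<^sub>m j * A) * res_in A * const_mat G = 0\<^sub>m k m" ..
    also have "K * A ^\<^sub>m j * A = K * A ^\<^sub>m Suc j" 
      using car by (subst assoc_mat_dim) auto
    finally show ?case .
  next
    case 0
    have "K * A ^\<^sub>m 0 = K" using car by simp
    then show ?case using zero by simp
  qed
  moreover have "K * A ^\<^sub>m j \<in> carrier_mat k n" by (rule carrier_matI) (use car in auto)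
  ultimately show ?thesis using step by simp
qed

text \<open>The conjugate of a column of \<open>G\<close> annihilates all columns of the matrices \<open>A\<^sup>j B\<close>, hence their span,
  which is the whole space; so the column is orthogonal to itself.\<close>

lemma controllable_pair_orthogonal:
  assumes car: "A \<in> carrier_mat n n" "B \<in> carrier_mat n m" "G \<in> carrier_mat n k"
    and con: "controllable_pair A B"
    and 0: "\<And>j. B\<^sup>\<dagger> * (A\<^sup>\<dagger>) ^\<^sub>m j * G = 0\<^sub>m m k"
  shows "G = 0\<^sub>m n k"
proof -
  interpret vec_space "TYPE(complex)" n .
  have zero: "G\<^sup>\<dagger> * (A ^\<^sub>m j * B) = 0\<^sub>m k m" for j
  proof -
    have "G\<^sup>\<dagger> * (A ^\<^sub>m j * B) = (B\<^sup>\<dagger> * (A\<^sup>\<dagger>) ^\<^sub>m j * G)\<^sup>\<dagger>"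
      using car by (simp add: adjoint_mult adjoint_pow[of "A\<^sup>\<dagger>" n] assoc_mat_dim)
    then show ?thesis unfolding 0 by simp
  qed
  have "col G l = 0\<^sub>v n" if l: "l < k" for l
  proof -
    let ?g = "conjugate (col G l)"
    have g: "?g \<in> carrier_vec n" using car by auto
    let ?N = "{x \<in> carrier_vec n. ?g \<bullet> x = 0}"
    have sub: "submodule class_ring ?N (module_vec TYPE(complex) n)"
      by (rule submodule.intro) 
        (use g in \<open>auto simp: module_vec_simps scalar_prod_add_distrib[of _ n] intro: module_axioms\<close>)
    have "set (cols (A ^\<^sub>m j * B)) \<subseteq> ?N" for j
    proof
      fix x assume "x \<in> set (cols (A ^\<^sub>m j * B))"
      then obtain i where i: "i < m" "x = col (A ^\<^sub>m j * B) i" using car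
        by (auto simp: cols_def)
      have "row (G\<^sup>\<dagger>) l = ?g" using car l by (intro eq_vecI) auto
      then have "?g \<bullet> x = (G\<^sup>\<dagger> * (A ^\<^sub>m j * B)) $$ (l, i)" using i l car by simp
      also have "\<dots> = 0" unfolding zero using i l by simp
      finally show "x \<in> ?N" using i car by (auto intro!: col_carrier_vec)
    qed
    then have "span (\<Union>j. set (cols (A ^\<^sub>m j * B))) \<subseteq> ?N"
      by (intro span_is_subset[OF _ sub]) auto
    moreover have "span (\<Union>j. set (cols (A ^\<^sub>m j * B))) = carrier_vec n"
      using con car by (simp add: controllable_pair_def)
    ultimately have "carrier_vec n \<subseteq> ?N" by simp
    moreover have "col G l \<in> carrier_vec n" using car by (auto simp: carrier_vecI)
    ultimately have "?g \<bullet> col G l = 0" by blast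
    then have "col G l \<bullet> ?g = 0" using g car by (subst comm_scalar_prod[of _ n]) auto
    then show ?thesis using conjugate_square_eq_0_vec[of "col G l" n] car by auto
  qed
  then show ?thesis using car
    by (intro eq_matI) (auto, metis index_col carrier_matD index_zero_vec(1))
qed

section \<open>Stein equations with a stable state matrix\<close>

lemma pow_smult_mat: "A \<in> carrier_mat n n \<Longrightarrow> (c \<cdot>\<^sub>m A) ^\<^sub>m k = c ^ k \<cdot>\<^sub>m (A :: 'a :: comm_ring_1 mat) ^\<^sub>m k"
proof (induction k)
  case (Suc k)
  then show ?case
    by (intro eq_matI) (auto simp: smult_mult_mat_dim mult_smult_mat_dim smult_smult_mat mult.commute)
qed (auto intro!: eq_matI)

lemma stable_pow_tendsto_0:
  assumes A: "A \<in> carrier_mat n n" and st: "stable_mat A" and ij: "i < n" "j < n"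
  shows "(\<lambda>k. (A ^\<^sub>m k) $$ (i, j)) \<longlonglongrightarrow> 0"
proof -
  have n: "0 < n" using ij by auto
  have fin: "finite (norm ` spectrum A)" "norm ` spectrum A \<noteq> {}"
    using card_finite_spectrum(1)[OF A] spectrum_non_empty[OF A n] by auto
  have sr: "spectral_radius A < 1"
    using fin st by (auto simp: spectral_radius_def stable_mat_def)
  have sr0: "0 \<le> spectral_radius A"
  proof -
    obtain e where "e \<in> norm ` spectrum A" using fin(2) by blast
    then show ?thesis using Max_ge[OF fin(1)] unfolding spectral_radius_def
      by (metis imageE norm_ge_zero order_trans)
  qed
  \<comment> \<open>dividing by a number between the spectral radius and 1 keeps the spectral radius below 1, so the powers stay bounded\<close>
  define r where "r = (1 + spectral_radius A) / 2"
  have r: "0 < r" "r < 1" "spectral_radius A < r" using sr sr0 by (auto simp: r_def)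
  define B where "B = complex_of_real (1 / r) \<cdot>\<^sub>m A"
  have B: "B \<in> carrier_mat n n" using A by (simp add: B_def)
  have "cmod \<mu> < 1" if mu: "\<mu> \<in> spectrum B" for \<mu>
  proof -
    obtain v where v: "v \<in> carrier_vec n" "v \<noteq> 0\<^sub>v n" "B *\<^sub>v v = \<mu> \<cdot>\<^sub>v v"
      using mu B by (auto simp: spectrum_def eigenvalue_def eigenvector_def)
    have "A *\<^sub>v v = r \<cdot>\<^sub>v (B *\<^sub>v v)"
      using A v(1) r(1) by (intro eq_vecI) (auto simp: B_def scalar_prod_def sum_distrib_left)
    also have "\<dots> = (r * \<mu>) \<cdot>\<^sub>v v" unfolding v(3) by (simp add: smult_smult_assoc)
    finally have "r * \<mu> \<in> spectrum A"
      using A v by (auto simp: spectrum_def eigenvalue_def eigenvector_def)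
    then have "cmod (r * \<mu>) \<le> spectral_radius A"
      unfolding spectral_radius_def using fin by (intro Max_ge) auto
    then have "r * cmod \<mu> \<le> spectral_radius A" using r by (simp add: norm_mult)
    then have "r * cmod \<mu> < r" using r(3) by linarith
    then show ?thesis using mult_less_cancel_left_pos[OF r(1), of "cmod \<mu>" 1] by simp
  qed
  moreover have "spectrum B \<noteq> {}" "finite (spectrum B)" 
    using spectrum_non_empty[OF B n] card_finite_spectrum(1)[OF B] by auto
  ultimately have "spectral_radius B < 1" by (auto simp: spectral_radius_def)
  then obtain c where c: "\<And>k. norm_bound (B ^\<^sub>m k) c"
    using spectral_radius_jnf_norm_bound_less_1_upper_triangular[OF B] by blast
  have "cmod ((A ^\<^sub>m k) $$ (i, j)) \<le> c * r ^ k" for k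
  proof -
    have "cmod ((B ^\<^sub>m k) $$ (i, j)) \<le> c" using c[of k] ij B by (auto simp: norm_bound_def)
    then show ?thesis unfolding B_def pow_smult_mat[OF A] using ij A r(1)
      by (simp add: norm_mult norm_power norm_divide divide_simps)
  qed
  moreover have "(\<lambda>k. c * r ^ k) \<longlonglongrightarrow> 0"
    using r by (intro tendsto_mult_right_zero LIMSEQ_realpow_zero) auto
  ultimately have "eventually (\<lambda>k. norm ((A ^\<^sub>m k) $$ (i, j)) \<le> norm (c * r ^ k) * 1) sequentially"
    by (intro always_eventually allI) (metis abs_ge_self mult.right_neutral order_trans real_norm_def)
  with \<open>(\<lambda>k. c * r ^ k) \<longlonglongrightarrow> 0\<close> show ?thesis by (rule tendsto_0_le)
qed

lemma mat_mult_tendsto: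
  assumes "\<And>i l. i < dim_row X \<Longrightarrow> l < dim_col X \<Longrightarrow> (\<lambda>k. F k $$ (i, l)) \<longlonglongrightarrow> X $$ (i, l)"
    and "\<And>l j. l < dim_row Y \<Longrightarrow> j < dim_col Y \<Longrightarrow> (\<lambda>k. G k $$ (l, j)) \<longlonglongrightarrow> (Y :: complex mat) $$ (l, j)"
    and "\<And>k. F k \<in> carrier_mat (dim_row X) (dim_col X)" "\<And>k. G k \<in> carrier_mat (dim_row Y) (dim_col Y)"
    and "dim_col X = dim_row Y" "i < dim_row X" "j < dim_col Y"
  shows "(\<lambda>k. (F k * G k) $$ (i, j)) \<longlonglongrightarrow> (X * Y) $$ (i, j)"
proof -
  have "(F k * G k) $$ (i, j) = (\<Sum>l<dim_row Y. F k $$ (i, l) * G k $$ (l, j))" for k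
    using assms(3)[of k] assms(4)[of k] assms(5-) by (auto simp: scalar_prod_def atLeast0LessThan intro!: sum.cong)
  moreover have "(X * Y) $$ (i, j) = (\<Sum>l<dim_row Y. X $$ (i, l) * Y $$ (l, j))"
    using assms(5-) by (auto simp: scalar_prod_def atLeast0LessThan intro!: sum.cong)
  ultimately show ?thesis using assms by (auto intro!: tendsto_sum tendsto_mult)
qed

text \<open>Iterating \<open>P = C\<^sup>\<dagger>C + A\<^sup>\<dagger>PA\<close>.\<close>

lemma stein_partial_sum:
  assumes A: "A \<in> carrier_mat n n" and P: "P \<in> carrier_mat n n" and C: "C \<in> carrier_mat m n"
    and stein: "P - A\<^sup>\<dagger> * P * A = C\<^sup>\<dagger> * C" and ij: "i < n" "j < n"
  shows "P $$ (i, j) = (\<Sum>l<k. ((A\<^sup>\<dagger>) ^\<^sub>m l * C\<^sup>\<dagger> * C * A ^\<^sub>m l) $$ (i, j)) + ((A\<^sup>\<dagger>) ^\<^sub>m k * P * A ^\<^sub>m k) $$ (i, j)"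
proof (induction k)
  case 0
  then show ?case using A P by simp
next
  case (Suc k)
  note d = A[THEN carrier_mat_dims] P[THEN carrier_mat_dims] C[THEN carrier_mat_dims] 
    pow_carrier_mat[OF A, of k, THEN carrier_mat_dims]
  let ?L = "(A\<^sup>\<dagger>) ^\<^sub>m k" and ?M = "A ^\<^sub>m k"
  have L: "dim_row ?L = n" "dim_col ?L = n" using d by auto
  have "?L * P * ?M = ?L * (P - A\<^sup>\<dagger> * P * A) * ?M + ?L * (A\<^sup>\<dagger> * P * A) * ?M"
    by (rule eq_matI) (use d L in \<open>simp_all add: mat_ring_dim del: index_mult_mat(1)\<close>)
  also have "\<dots> = ?L * C\<^sup>\<dagger> * C * ?M + (A\<^sup>\<dagger>) ^\<^sub>m Suc k * P * A ^\<^sub>m Suc k"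
    unfolding stein pow_mat_Suc_left[OF A] using d L by (simp add: mat_ring_dim)
  finally show ?case using Suc ij d by (simp del: index_mult_mat(1) pow_mat.simps)
qed

lemma stein_sums:
  assumes A: "A \<in> carrier_mat n n" and st: "stable_mat A" and P: "P \<in> carrier_mat n n" and C: "C \<in> carrier_mat m n"
    and stein: "P - A\<^sup>\<dagger> * P * A = C\<^sup>\<dagger> * C" and ij: "i < n" "j < n"
  shows "(\<lambda>l. ((A\<^sup>\<dagger>) ^\<^sub>m l * C\<^sup>\<dagger> * C * A ^\<^sub>m l) $$ (i, j)) sums (P $$ (i, j))"
proof -
  have A': "A\<^sup>\<dagger> \<in> carrier_mat n n" using A by simp
  have lim: "(\<lambda>k. (A ^\<^sub>m k) $$ (i, j)) \<longlonglongrightarrow> 0\<^sub>m n n $$ (i, j)" if "i < n" "j < n" for i j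
    using stable_pow_tendsto_0[OF A st] that by simp
  have lim': "(\<lambda>k. ((A\<^sup>\<dagger>) ^\<^sub>m k) $$ (i, j)) \<longlonglongrightarrow> 0\<^sub>m n n $$ (i, j)" if "i < n" "j < n" for i j
    using tendsto_cnj[OF stable_pow_tendsto_0[OF A st that(2,1)]] that A
    by (simp flip: adjoint_pow[OF A])
  have car: "A ^\<^sub>m k \<in> carrier_mat n n" "(A\<^sup>\<dagger>) ^\<^sub>m k \<in> carrier_mat n n" for k
    using pow_carrier_mat[OF A] pow_carrier_mat[OF A'] by auto
  have "(\<lambda>k. ((A\<^sup>\<dagger>) ^\<^sub>m k * P) $$ (i, j)) \<longlonglongrightarrow> (0\<^sub>m n n * P) $$ (i, j)" if "i < n" "j < n" for i j
    by (rule mat_mult_tendsto) (use lim' car P that in auto)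
  then have "(\<lambda>k. ((A\<^sup>\<dagger>) ^\<^sub>m k * P * A ^\<^sub>m k) $$ (i, j)) \<longlonglongrightarrow> ((0\<^sub>m n n * P) * 0\<^sub>m n n) $$ (i, j)"
    by (rule mat_mult_tendsto)
      (use lim car P ij mult_carrier_mat[OF car(2) P] in \<open>auto simp del: index_mult_mat(1)\<close>)
  then have "(\<lambda>k. ((A\<^sup>\<dagger>) ^\<^sub>m k * P * A ^\<^sub>m k) $$ (i, j)) \<longlonglongrightarrow> 0"
    using ij P by simp
  from tendsto_diff[OF tendsto_const[of "P $$ (i, j)"] this]
  have "(\<lambda>k. P $$ (i, j) - ((A\<^sup>\<dagger>) ^\<^sub>m k * P * A ^\<^sub>m k) $$ (i, j)) \<longlonglongrightarrow> P $$ (i, j)" by simp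
  also have "(\<lambda>k. P $$ (i, j) - ((A\<^sup>\<dagger>) ^\<^sub>m k * P * A ^\<^sub>m k) $$ (i, j)) = 
     (\<lambda>k. \<Sum>l<k. ((A\<^sup>\<dagger>) ^\<^sub>m l * C\<^sup>\<dagger> * C * A ^\<^sub>m l) $$ (i, j))"
    using stein_partial_sum[OF A P C stein ij] by (simp add: algebra_simps fun_eq_iff)
  finally show ?thesis unfolding sums_def .
qed

text \<open>The adjoint of \<open>P\<close> solves the same equation, and the series determines the solution.\<close>

lemma stein_hermitian:
  assumes A: "A \<in> carrier_mat n n" and st: "stable_mat A" and P: "P \<in> carrier_mat n n" and C: "C \<in> carrier_mat m n"
    and stein: "P - A\<^sup>\<dagger> * P * A = C\<^sup>\<dagger> * C"
  shows "P\<^sup>\<dagger> = P"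
proof -
  have P': "P\<^sup>\<dagger> \<in> carrier_mat n n" using P by simp
  have "P\<^sup>\<dagger> - A\<^sup>\<dagger> * P\<^sup>\<dagger> * A = (P - A\<^sup>\<dagger> * P * A)\<^sup>\<dagger>"
    using A P by (simp add: adjoint_minus adjoint_mult assoc_mat_dim)
  also have "\<dots> = C\<^sup>\<dagger> * C" unfolding stein using C by (simp add: adjoint_mult)
  finally have "P\<^sup>\<dagger> $$ (i, j) = P $$ (i, j)" if "i < n" "j < n" for i j
    using stein_sums[OF A st P' C _ that] stein_sums[OF A st P C stein that] sums_unique2 by blast
  then show ?thesis using P P' by (intro eq_matI) auto
qed


section \<open>Completion to a lossless system\<close>

lemma adjoint_mult_vec_inner:
  assumes "A \<in> carrier_mat n m" "u \<in> carrier_vec n" "x \<in> carrier_vec m"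
  shows "(A\<^sup>\<dagger> *\<^sub>v u) \<bullet>c x = u \<bullet>c ((A :: complex mat) *\<^sub>v x)"
proof -
  have "(A\<^sup>\<dagger> *\<^sub>v u) \<bullet>c x = (\<Sum>i<m. \<Sum>j<n. cnj (A $$ (j, i)) * u $ j * cnj (x $ i))"
    using assms by (auto simp: scalar_prod_def sum_distrib_right atLeast0LessThan intro!: sum.cong)
  also have "\<dots> = (\<Sum>j<n. \<Sum>i<m. cnj (A $$ (j, i)) * u $ j * cnj (x $ i))" by (rule sum.swap)
  also have "\<dots> = u \<bullet>c (A *\<^sub>v x)"
    using assms by (auto simp: scalar_prod_def sum_distrib_left atLeast0LessThan ac_simps intro!: sum.cong)
  finally show ?thesis .
qed

text \<open>The quadratic form of \<open>P\<close> at \<open>x\<close> exceeds its value at \<open>Ax\<close> by \<open>\<parallel>Cx\<parallel>\<^sup>2\<close>, so it does not increase along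
  the orbit of \<open>x\<close>, which tends to zero.\<close>

lemma stein_positive_semidefinite:
  assumes A: "A \<in> carrier_mat n n" and st: "stable_mat A" and P: "P \<in> carrier_mat n n" and C: "C \<in> carrier_mat m n"
    and stein: "P - A\<^sup>\<dagger> * P * A = C\<^sup>\<dagger> * C" and x: "x \<in> carrier_vec n"
  shows "0 \<le> Re ((P *\<^sub>v x) \<bullet>c x)"
proof -
  have step: "Re ((P *\<^sub>v (A *\<^sub>v x)) \<bullet>c (A *\<^sub>v x)) \<le> Re ((P *\<^sub>v x) \<bullet>c x)" if x: "x \<in> carrier_vec n" for x
  proof -
    have Ax: "A *\<^sub>v x \<in> carrier_vec n" and Cx: "C *\<^sub>v x \<in> carrier_vec m" and PAx: "P *\<^sub>v (A *\<^sub>v x) \<in> carrier_vec n" 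
      and Px: "P *\<^sub>v x \<in> carrier_vec n" and A': "A\<^sup>\<dagger> \<in> carrier_mat n n"
      using A C P x by auto
    have "(P *\<^sub>v x) \<bullet>c x - (P *\<^sub>v (A *\<^sub>v x)) \<bullet>c (A *\<^sub>v x) = (P *\<^sub>v x) \<bullet>c x - (A\<^sup>\<dagger> *\<^sub>v (P *\<^sub>v (A *\<^sub>v x))) \<bullet>c x"
      using adjoint_mult_vec_inner[OF A PAx x] by simp
    also have "\<dots> = (P *\<^sub>v x - A\<^sup>\<dagger> *\<^sub>v (P *\<^sub>v (A *\<^sub>v x))) \<bullet>c x"
      using Px PAx A' x by (subst minus_scalar_prod_distrib[of _ n]) auto
    also have "P *\<^sub>v x - A\<^sup>\<dagger> *\<^sub>v (P *\<^sub>v (A *\<^sub>v x)) = (P - A\<^sup>\<dagger> * P * A) *\<^sub>v x"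
      using A P A' x by (subst minus_mult_distrib_mat_vec[of _ n n]) (auto simp: assoc_mult_mat_vec[of _ n n _ n])
    also have "\<dots> = C\<^sup>\<dagger> *\<^sub>v (C *\<^sub>v x)" unfolding stein using C x by (auto simp: assoc_mult_mat_vec[of _ n m _ n])
    also have "\<dots> \<bullet>c x = (C *\<^sub>v x) \<bullet>c (C *\<^sub>v x)" by (rule adjoint_mult_vec_inner[OF C Cx x])
    finally show ?thesis using conjugate_square_ge_0_vec[of "C *\<^sub>v x"] 
      by (simp add: less_eq_complex_def minus_complex.simps complex_eq_iff) 
  qed
  have Akx: "A ^\<^sub>m k *\<^sub>v x \<in> carrier_vec n" for k using pow_carrier_mat[OF A] x by (rule mult_mat_vec_carrier)
  have mono: "Re ((P *\<^sub>v (A ^\<^sub>m k *\<^sub>v x)) \<bullet>c (A ^\<^sub>m k *\<^sub>v x)) \<le> Re ((P *\<^sub>v x) \<bullet>c x)" for k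
  proof (induction k)
    case (Suc k)
    have "A ^\<^sub>m Suc k *\<^sub>v x = A *\<^sub>v (A ^\<^sub>m k *\<^sub>v x)"
      unfolding pow_mat_Suc_left[OF A] by (rule assoc_mult_mat_vec[OF A pow_carrier_mat[OF A] x])
    then show ?case using step[OF Akx, of k] Suc by simp
  qed (use A x in simp)
  have lim: "(\<lambda>k. (A ^\<^sub>m k *\<^sub>v x) $ i) \<longlonglongrightarrow> 0" if "i < n" for i
  proof -
    have "(M *\<^sub>v x) $ i = (\<Sum>j<n. M $$ (i, j) * x $ j)" if "M \<in> carrier_mat n n" for M
      using that \<open>i < n\<close> x by (auto simp: scalar_prod_def atLeast0LessThan intro!: sum.cong)
    note this[OF pow_carrier_mat[OF A]]
    moreover have "(\<lambda>k. \<Sum>j<n. (A ^\<^sub>m k) $$ (i, j) * x $ j) \<longlonglongrightarrow> (\<Sum>j<n. 0 * x $ j)"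
      using stable_pow_tendsto_0[OF A st that] by (intro tendsto_sum tendsto_mult tendsto_const) auto
    ultimately show ?thesis by simp
  qed
  have "(P *\<^sub>v y) \<bullet>c y = (\<Sum>i<n. (\<Sum>j<n. P $$ (i, j) * y $ j) * cnj (y $ i))" if "y \<in> carrier_vec n" for y
    using that P by (auto simp: scalar_prod_def atLeast0LessThan intro!: sum.cong)
  note this[OF Akx]
  moreover have "(\<lambda>k. (\<Sum>i<n. (\<Sum>j<n. P $$ (i, j) * (A ^\<^sub>m k *\<^sub>v x) $ j) * cnj ((A ^\<^sub>m k *\<^sub>v x) $ i))) \<longlonglongrightarrow>
      (\<Sum>i<n. (\<Sum>j<n. P $$ (i, j) * 0) * cnj 0)"
    using lim by (intro tendsto_sum tendsto_mult tendsto_const tendsto_cnj) auto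
  ultimately have "(\<lambda>k. (P *\<^sub>v (A ^\<^sub>m k *\<^sub>v x)) \<bullet>c (A ^\<^sub>m k *\<^sub>v x)) \<longlonglongrightarrow> 0" by simp
  from tendsto_Re[OF this] show ?thesis
    using mono by (intro tendsto_upperbound[of _ _ sequentially]) auto
qed

text \<open>Fewer than \<open>n\<close> linear conditions on a vector of length \<open>n\<close> have a nonzero solution.\<close>

lemma exists_unit_orthogonal:
  assumes us: "set us \<subseteq> carrier_vec n" "length us < n"
  obtains v :: "complex vec" where "v \<in> carrier_vec n" "v \<bullet>c v = 1" "\<And>u. u \<in> set us \<Longrightarrow> v \<bullet>c u = 0"
proof -
  \<comment> \<open>the conditions as rows, padded by zero rows to a square matrix, which is then singular\<close>
  define K where "K = mat n n (\<lambda>(r, c). if r < length us then cnj (us ! r $ c) else 0)"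
  have K: "K \<in> carrier_mat n n" by (simp add: K_def)
  have "transpose_mat K *\<^sub>v unit_vec n (n - 1) = 0\<^sub>v n"
    using us(2) by (intro eq_vecI) (auto simp: K_def)
  moreover have "unit_vec n (n - 1) \<noteq> (0\<^sub>v n :: complex vec)" using us(2) by auto
  ultimately have "det (transpose_mat K) = 0"
    using det_0_iff_vec_prod_zero[of "transpose_mat K" n] K unit_vec_carrier[of n "n - 1"] by (meson transpose_carrier_mat)
  then have "det K = 0" using det_transpose[OF K] by simp
  then obtain v where v: "v \<in> carrier_vec n" "v \<noteq> 0\<^sub>v n" "K *\<^sub>v v = 0\<^sub>v n"
    using det_0_iff_vec_prod_zero[OF K] by blast
  have orth: "v \<bullet>c u = 0" if "u \<in> set us" for u
  proof -
    obtain r where r: "r < length us" "u = us ! r" using \<open>u \<in> set us\<close> by (auto simp: in_set_conv_nth)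
    have u: "u \<in> carrier_vec n" using that us by auto
    have "v \<bullet>c u = (K *\<^sub>v v) $ r" using r u v(1) us(2)
      by (auto simp: K_def scalar_prod_def atLeast0LessThan ac_simps intro!: sum.cong)
    then show ?thesis using v(3) r us(2) by simp
  qed
  have "v \<bullet>c v > 0" using conjugate_square_greater_0_vec[OF v(1)] v(2) by simp
  then have s: "Re (v \<bullet>c v) > 0" "v \<bullet>c v = complex_of_real (Re (v \<bullet>c v))"
    by (auto simp: less_complex_def complex_eq_iff)
  define s where "s = 1 / sqrt (Re (v \<bullet>c v))"
  have ss: "s * s * Re (v \<bullet>c v) = 1" using s(1) by (simp add: s_def divide_simps)
  let ?w = "complex_of_real s \<cdot>\<^sub>v v"
  have "?w \<bullet>c ?w = s * s * (v \<bullet>c v)" using v(1) by (simp add: conjugate_smult_vec)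
  also have "\<dots> = 1" by (subst s(2)) (metis ss of_real_mult of_real_1)
  finally have "?w \<bullet>c ?w = 1" .
  moreover have "?w \<bullet>c u = 0" if "u \<in> set us" for u
    using orth[OF that] that us v(1) by (subst smult_scalar_prod_distrib[of _ n]) auto
  ultimately show ?thesis using that[of ?w] v(1) by simp
qed

lemma orthonormal_completion:
  assumes us: "set us \<subseteq> carrier_vec n" "length us + j \<le> n"
  shows "\<exists>ws :: complex vec list. length ws = j \<and> set ws \<subseteq> carrier_vec n \<and>
    (\<forall>i<j. \<forall>l<j. ws ! i \<bullet>c ws ! l = (if i = l then 1 else 0)) \<and> (\<forall>w\<in>set ws. \<forall>u\<in>set us. w \<bullet>c u = 0)"
  using us(2)
proof (induction j)
  case (Suc j)
  then obtain ws where ws: "length ws = j" "set ws \<subseteq> carrier_vec n"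
    "\<And>i l. i < j \<Longrightarrow> l < j \<Longrightarrow> ws ! i \<bullet>c ws ! l = (if i = l then 1 else 0)" 
    "\<And>w u. w \<in> set ws \<Longrightarrow> u \<in> set us \<Longrightarrow> w \<bullet>c u = 0" by auto
  obtain v where v: "v \<in> carrier_vec n" "v \<bullet>c v = 1" "\<And>u. u \<in> set (us @ ws) \<Longrightarrow> v \<bullet>c u = 0"
    using exists_unit_orthogonal[of "us @ ws" n] us(1) ws(1,2) Suc.prems by auto
  have v': "w \<bullet>c v = 0" if "w \<in> set ws" for w
  proof -
    have "w \<in> carrier_vec n" using that ws(2) by auto
    then have "w \<bullet>c v = conjugate (v \<bullet>c w)" using v(1) by (metis conjugate_conjugate_sprod conjugate_id carrier_vec_conjugate conjugate_sprod_vec comm_scalar_prod)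
    then show ?thesis using v(3)[of w] that by simp
  qed
  have "(ws @ [v]) ! i \<bullet>c (ws @ [v]) ! l = (if i = l then 1 else 0)" if "i < Suc j" "l < Suc j" for i l
    using that ws(1,3) v(2,3) v' by (auto simp: nth_append less_Suc_eq)
  then show ?case using ws v by (intro exI[of _ "ws @ [v]"]) auto
qed auto

lemma orthonormal_columns_orthogonal:
  assumes X: "X \<in> carrier_mat n k" and kj: "k + j \<le> n"
  obtains Z :: "complex mat" where "Z \<in> carrier_mat n j" "Z\<^sup>\<dagger> * Z = 1\<^sub>m j" "X\<^sup>\<dagger> * Z = 0\<^sub>m k j"
proof -
  obtain ws :: "complex vec list" where ws: "length ws = j" "set ws \<subseteq> carrier_vec n"
    "\<And>i l. i < j \<Longrightarrow> l < j \<Longrightarrow> ws ! i \<bullet>c ws ! l = (if i = l then 1 else 0)" 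
    "\<And>w u. w \<in> set ws \<Longrightarrow> u \<in> set (cols X) \<Longrightarrow> w \<bullet>c u = 0" 
    using orthonormal_completion[of "cols X" n j] X kj cols_dim[of X] by auto
  define Z where "Z = mat_of_cols n ws"
  have Z: "Z \<in> carrier_mat n j" using ws(1) mat_of_cols_carrier(1)[of n ws] by (simp add: Z_def)
  have cZ: "col Z l = ws ! l" if "l < j" for l using that ws(1,2) by (simp add: Z_def subset_iff)
  have row: "row (M\<^sup>\<dagger>) i = conjugate (col M i)" if "i < dim_col M" for M :: "complex mat" and i
    using that by (intro eq_vecI) auto
  have comm: "conjugate u \<bullet> w = w \<bullet>c u" if "u \<in> carrier_vec n" "w \<in> carrier_vec n" for u w :: "complex vec"
    using that by (intro comm_scalar_prod) auto
  have "Z\<^sup>\<dagger> * Z = 1\<^sub>m j"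
  proof (rule eq_matI)
    fix i l assume "i < dim_row (1\<^sub>m j :: complex mat)" "l < dim_col (1\<^sub>m j :: complex mat)"
    then have il: "i < j" "l < j" by auto
    then have "ws ! i \<in> carrier_vec n" "ws ! l \<in> carrier_vec n" using ws(1,2) by auto
    then show "(Z\<^sup>\<dagger> * Z) $$ (i, l) = (1\<^sub>m j :: complex mat) $$ (i, l)"
      using il Z ws(3)[of l i] by (simp add: row cZ comm)
  qed (use Z in auto)
  moreover have "X\<^sup>\<dagger> * Z = 0\<^sub>m k j"
  proof (rule eq_matI)
    fix i l assume "i < dim_row (0\<^sub>m k j :: complex mat)" "l < dim_col (0\<^sub>m k j :: complex mat)"
    then have il: "i < k" "l < j" by auto
    then have "ws ! l \<in> carrier_vec n" "col X i \<in> carrier_vec n" "ws ! l \<in> set ws" "col X i \<in> set (cols X)"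
      using ws(1,2) X col_carrier_vec[of i k X n] by (auto simp: cols_def)
    then show "(X\<^sup>\<dagger> * Z) $$ (i, l) = (0\<^sub>m k j :: complex mat) $$ (i, l)"
      using il Z X ws(4) by (simp add: row cZ comm)
  qed (use X Z in auto)
  ultimately show ?thesis using that Z by blast
qed

text \<open>Polarization: the values at \<open>x + y\<close> and \<open>x + \<i>y\<close> determine the sesquilinear form.\<close>

lemma zero_form_imp_zero:
  fixes Q :: "complex mat"
  assumes Q: "Q \<in> carrier_mat n n" and 0: "\<And>x. x \<in> carrier_vec n \<Longrightarrow> (Q *\<^sub>v x) \<bullet>c x = 0"
  shows "Q = 0\<^sub>m n n"
proof (rule eq_matI)
  fix i j assume "i < dim_row (0\<^sub>m n n :: complex mat)" "j < dim_col (0\<^sub>m n n :: complex mat)"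
  then have ij: "i < n" "j < n" by auto
  let ?B = "\<lambda>x y. (Q *\<^sub>v x) \<bullet>c y"
  let ?x = "unit_vec n j :: complex vec" and ?y = "unit_vec n i :: complex vec"
  have polar: "c * ?B ?y ?x + cnj c * ?B ?x ?y = 0" for c
  proof -
    have "?B (?x + c \<cdot>\<^sub>v ?y) (?x + c \<cdot>\<^sub>v ?y) = ?B ?x ?x + c * ?B ?y ?x + cnj c * ?B ?x ?y + c * cnj c * ?B ?y ?y"
      using Q by (simp add: mult_add_distrib_mat_vec[of _ n n] mult_mat_vec[of _ n n] conjugate_add_vec[of _ n] conjugate_smult_vec
          add_scalar_prod_distrib[of _ n] scalar_prod_add_distrib[of _ n] algebra_simps)
    then show ?thesis using 0[of "?x + c \<cdot>\<^sub>v ?y"] 0[of ?x] 0[of ?y] by simp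
  qed
  have "?B ?y ?x + ?B ?x ?y = 0" using polar[of 1] by simp
  moreover have "\<i> * (?B ?y ?x - ?B ?x ?y) = 0" using polar[of \<i>] by (simp add: algebra_simps)
  ultimately have "?B ?x ?y = 0" by (simp add: complex_eq_iff)
  moreover have "conjugate ?y = ?y" using ij by (intro eq_vecI) (auto simp: unit_vec_def)
  ultimately show "Q $$ (i, j) = (0\<^sub>m n n :: complex mat) $$ (i, j)"
    using ij Q by simp
qed (use Q in auto)

lemma gram_sum_zero:
  fixes X Y :: "complex mat"
  assumes "dim_col X = n" "dim_col Y = n" and 0: "X\<^sup>\<dagger> * X + Y\<^sup>\<dagger> * Y = 0\<^sub>m n n"
  shows "X = 0\<^sub>m (dim_row X) n" "Y = 0\<^sub>m (dim_row Y) n"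
proof -
  have sq: "z * cnj z = (complex_of_real (cmod z))\<^sup>2" for z by (metis complex_norm_square of_real_power)
  have diag: "(X\<^sup>\<dagger> * X) $$ (j, j) = complex_of_real (\<Sum>i<dim_row X. (cmod (X $$ (i, j)))\<^sup>2)" if "j < dim_col X" for X :: "complex mat" and j
    using that by (auto simp: scalar_prod_def atLeast0LessThan sq mult.commute intro!: sum.cong)
  have "(\<Sum>i<dim_row X. (cmod (X $$ (i, j)))\<^sup>2) + (\<Sum>i<dim_row Y. (cmod (Y $$ (i, j)))\<^sup>2) = 0" if "j < n" for j
  proof -
    have "complex_of_real ((\<Sum>i<dim_row X. (cmod (X $$ (i, j)))\<^sup>2) + (\<Sum>i<dim_row Y. (cmod (Y $$ (i, j)))\<^sup>2)) = (X\<^sup>\<dagger> * X + Y\<^sup>\<dagger> * Y) $$ (j, j)"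
      using that assms(1,2) by (simp add: diag del: index_mult_mat(1))
    also have "\<dots> = 0" unfolding 0 using that by simp
    finally show ?thesis by (simp only: of_real_eq_0_iff)
  qed
  then have "\<forall>i<dim_row X. (cmod (X $$ (i, j)))\<^sup>2 = 0" "\<forall>i<dim_row Y. (cmod (Y $$ (i, j)))\<^sup>2 = 0" if "j < n" for j
    using that by (simp_all add: add_nonneg_eq_0_iff sum_nonneg sum_nonneg_eq_0_iff)
  then show "X = 0\<^sub>m (dim_row X) n" "Y = 0\<^sub>m (dim_row Y) n"
    using assms(1,2) by (auto intro!: eq_matI)
qed


lemma gram_entry:
  assumes V: "V \<in> carrier_mat n k" and P: "(P :: complex mat) \<in> carrier_mat n n" and ij: "i < k" "j < k"
  shows "(V\<^sup>\<dagger> * P * V) $$ (i, j) = (P *\<^sub>v col V j) \<bullet>c col V i"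
proof -
  have "row (V\<^sup>\<dagger>) i = conjugate (col V i)" using V ij by (intro eq_vecI) auto
  moreover have "col (P * V) j = P *\<^sub>v col V j" using V P ij by (intro eq_vecI) auto
  moreover have "V\<^sup>\<dagger> * P * V = V\<^sup>\<dagger> * (P * V)" using V P by (simp add: assoc_mat_dim)
  ultimately have "(V\<^sup>\<dagger> * P * V) $$ (i, j) = conjugate (col V i) \<bullet> (P *\<^sub>v col V j)"
    using V P ij by simp
  also have "\<dots> = (P *\<^sub>v col V j) \<bullet>c col V i"
    using V P ij by (intro comm_scalar_prod[of _ n]) auto
  finally show ?thesis .
qed

text \<open>Vectors that are orthonormal for a sesquilinear form are linearly independent.\<close>

lemma form_orthonormal_bound:
  assumes V: "V \<in> carrier_mat n k" and P: "(P :: complex mat) \<in> carrier_mat n n" and 1: "V\<^sup>\<dagger> * P * V = 1\<^sub>m k"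
  shows "k \<le> n"
proof (rule ccontr)
  assume "\<not> k \<le> n"
  let ?us = "map (\<lambda>i. conjugate (row V i)) [0..<n]"
  have "set ?us \<subseteq> carrier_vec k" using V by auto
  moreover have "length ?us < k" using \<open>\<not> k \<le> n\<close> by simp
  ultimately obtain c where c: "c \<in> carrier_vec k" "c \<bullet>c c = 1" "\<And>u. u \<in> set ?us \<Longrightarrow> c \<bullet>c u = 0"
    using exists_unit_orthogonal by blast
  have "V *\<^sub>v c = 0\<^sub>v n"
  proof (rule eq_vecI)
    fix i assume "i < dim_vec (0\<^sub>v n :: complex vec)"
    then have i: "i < n" by simp
    then have "c \<bullet> row V i = 0" using c(3)[of "conjugate (row V i)"] by simp
    moreover have "row V i \<bullet> c = c \<bullet> row V i" using c(1) V i by (intro comm_scalar_prod[of _ k]) auto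
    ultimately show "(V *\<^sub>v c) $ i = (0\<^sub>v n :: complex vec) $ i" using i V by simp
  qed (use V in auto)
  then have "(V\<^sup>\<dagger> * P) *\<^sub>v (V *\<^sub>v c) = 0\<^sub>v k" using V P by (auto intro!: eq_vecI simp: scalar_prod_def)
  moreover have "(V\<^sup>\<dagger> * P) *\<^sub>v (V *\<^sub>v c) = (V\<^sup>\<dagger> * P * V) *\<^sub>v c"
    using V P c(1) by (intro assoc_mult_mat_vec[of _ k n _ k, symmetric]) (auto intro: mult_carrier_mat[of _ k n])
  ultimately have "c = 0\<^sub>v k" using c(1) unfolding 1 by simp
  then show False using c(2) by simp
qed

lemma hermitian_inner: 
  assumes P: "(P :: complex mat) \<in> carrier_mat n n" "P\<^sup>\<dagger> = P" and xy: "x \<in> carrier_vec n" "y \<in> carrier_vec n"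
  shows "(P *\<^sub>v x) \<bullet>c y = cnj ((P *\<^sub>v y) \<bullet>c x)"
proof -
  have Py: "P *\<^sub>v y \<in> carrier_vec n" using P xy by simp
  have "(P *\<^sub>v x) \<bullet>c y = x \<bullet>c (P *\<^sub>v y)"
    using adjoint_mult_vec_inner[OF P(1) xy] P(2) by simp
  also have "\<dots> = cnj ((P *\<^sub>v y) \<bullet>c x)"
  proof -
    have "u \<bullet>c v = cnj (v \<bullet>c u)" if "u \<in> carrier_vec n" "v \<in> carrier_vec n" for u v
      using that by (auto simp: scalar_prod_def ac_simps)
    then show ?thesis using xy(1) Py .
  qed
  finally show ?thesis .
qed

text \<open>Take a maximal family \<open>V\<close> of vectors that are orthonormal for the form of \<open>P\<close>. By maximality the form
  vanishes on the vectors that are orthogonal to \<open>V\<close> for \<open>P\<close>, that is, on the range of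
  \<open>F = I - VV\<^sup>\<dagger>P\<close>. Thus \<open>F\<^sup>\<dagger>PF = P - PVV\<^sup>\<dagger>P\<close> is zero, and \<open>S = V\<^sup>\<dagger>P\<close> is a right invertible factor
  with \<open>S\<^sup>\<dagger>S = P\<close>.\<close>

lemma positive_semidefinite_factor:
  assumes P: "(P :: complex mat) \<in> carrier_mat n n" "P\<^sup>\<dagger> = P" 
    and psd: "\<And>x. x \<in> carrier_vec n \<Longrightarrow> 0 \<le> Re ((P *\<^sub>v x) \<bullet>c x)"
  obtains k V where "V \<in> carrier_mat n k" "V\<^sup>\<dagger> * P * V = 1\<^sub>m k" "P = P * V * V\<^sup>\<dagger> * P"
proof -
  define S where "S = {k. \<exists>V \<in> carrier_mat n k. V\<^sup>\<dagger> * P * V = 1\<^sub>m k}"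
  have "S \<subseteq> {..n}" using form_orthonormal_bound[OF _ P(1)] by (auto simp: S_def)
  then have fin: "finite S" by (rule finite_subset) simp
  have "(0\<^sub>m n 0)\<^sup>\<dagger> * P * 0\<^sub>m n 0 = 1\<^sub>m 0" by (rule eq_matI) auto
  then have "0 \<in> S" by (auto simp: S_def intro!: bexI[of _ "0\<^sub>m n 0"])
  then have "Max S \<in> S" using fin Max_in by blast
  then obtain k V where k: "k = Max S" and V: "V \<in> carrier_mat n k" "V\<^sup>\<dagger> * P * V = 1\<^sub>m k"
    by (auto simp: S_def)
  define F where "F = 1\<^sub>m n - V * V\<^sup>\<dagger> * P"
  have F: "F \<in> carrier_mat n n" using V P by (auto simp: F_def intro!: minus_carrier_mat mult_carrier_mat)
  note d = V(1)[THEN carrier_mat_dims] P(1)[THEN carrier_mat_dims] F[THEN carrier_mat_dims]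
  have "V\<^sup>\<dagger> * P * F = V\<^sup>\<dagger> * P - (V\<^sup>\<dagger> * P * V) * V\<^sup>\<dagger> * P" unfolding F_def by (rule eq_matI) (use d in \<open>simp_all add: mat_ring_dim const_mat_hom del: index_mult_mat(1)\<close>)
  also have "\<dots> = 0\<^sub>m k n" unfolding V(2) by (rule eq_matI) (use d in \<open>simp_all add: mat_ring_dim const_mat_hom del: index_mult_mat(1)\<close>)
  finally have VPF: "V\<^sup>\<dagger> * P * F = 0\<^sub>m k n" .
  \<comment> \<open>otherwise a normalized vector of the range of \<open>F\<close> would extend \<open>V\<close>\<close>
  have null: "(P *\<^sub>v (F *\<^sub>v x)) \<bullet>c (F *\<^sub>v x) = 0" if x: "x \<in> carrier_vec n" for x
  proof (rule ccontr)
    define q where "q = F *\<^sub>v x"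
    assume "(P *\<^sub>v (F *\<^sub>v x)) \<bullet>c (F *\<^sub>v x) \<noteq> 0"
    then have ne: "(P *\<^sub>v q) \<bullet>c q \<noteq> 0" by (simp add: q_def)
    have q: "q \<in> carrier_vec n" using F x by (simp add: q_def)
    have Pq: "P *\<^sub>v q \<in> carrier_vec n" using P q by simp
    define s where "s = Re ((P *\<^sub>v q) \<bullet>c q)"
    have sq: "(P *\<^sub>v q) \<bullet>c q = complex_of_real s"
      using hermitian_inner[OF P q q] by (simp add: s_def complex_eq_iff)
    then have s: "s > 0" using psd[OF q] ne by (auto simp: s_def less_le)
    define r where "r = 1 / sqrt s"
    have r: "r * r * s = 1" using s by (simp add: r_def field_simps)
    define y where "y = complex_of_real r \<cdot>\<^sub>v q"
    have y: "y \<in> carrier_vec n" using q by (simp add: y_def)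
    have Py: "P *\<^sub>v y = complex_of_real r \<cdot>\<^sub>v (P *\<^sub>v q)"
      unfolding y_def using P(1) q by (rule mult_mat_vec)
    have yy: "(P *\<^sub>v y) \<bullet>c y = 1"
    proof -
      have "(P *\<^sub>v y) \<bullet>c y = complex_of_real (r * r) * ((P *\<^sub>v q) \<bullet>c q)"
        unfolding Py unfolding y_def using Pq q by (simp add: conjugate_smult_vec)
      also have "\<dots> = complex_of_real (r * r * s)" unfolding sq by simp
      finally show ?thesis unfolding r by simp
    qed
    have "(V\<^sup>\<dagger> * P) *\<^sub>v q = 0\<^sub>v k"
    proof -
      have "(V\<^sup>\<dagger> * P) *\<^sub>v q = (V\<^sup>\<dagger> * P * F) *\<^sub>v x"
        unfolding q_def using V P F x
        by (intro assoc_mult_mat_vec[of _ k n _ n, symmetric]) (auto intro: mult_carrier_mat[of _ k n])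
      then show ?thesis unfolding VPF using x by auto
    qed
    then have Vq: "V\<^sup>\<dagger> *\<^sub>v (P *\<^sub>v q) = 0\<^sub>v k"
      using V P q by (simp add: assoc_mult_mat_vec[of _ k n _ n])
    have vy: "(P *\<^sub>v y) \<bullet>c col V i = 0" if i: "i < k" for i
    proof -
      have ci: "col V i \<in> carrier_vec n" using V i by auto
      have "row (V\<^sup>\<dagger>) i = conjugate (col V i)" using V i by (intro eq_vecI) auto
      then have "(P *\<^sub>v q) \<bullet>c col V i = (V\<^sup>\<dagger> *\<^sub>v (P *\<^sub>v q)) $ i"
        using V i Pq ci comm_scalar_prod[of "P *\<^sub>v q" n "conjugate (col V i)"] by simp
      then show ?thesis unfolding Py Vq using Pq ci i by simp
    qed
    have yv: "(P *\<^sub>v col V i) \<bullet>c y = 0" if i: "i < k" for i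
      using hermitian_inner[OF P, of "col V i" y] vy[OF i] y V i by simp
    define V' where "V' = mat n (Suc k) (\<lambda>(i, j). if j < k then V $$ (i, j) else y $ i)"
    have V': "V' \<in> carrier_mat n (Suc k)" by (simp add: V'_def)
    have col': "col V' j = (if j < k then col V j else y)" if "j < Suc k" for j
      using that V y by (intro eq_vecI) (auto simp: V'_def)
    have "V'\<^sup>\<dagger> * P * V' = 1\<^sub>m (Suc k)"
    proof (rule eq_matI)
      fix i j assume "i < dim_row (1\<^sub>m (Suc k) :: complex mat)" "j < dim_col (1\<^sub>m (Suc k) :: complex mat)"
      then have ij: "i < Suc k" "j < Suc k" by auto
      have old: "(P *\<^sub>v col V j) \<bullet>c col V i = (if i = j then 1 else 0)" if "i < k" "j < k"
        using gram_entry[OF V(1) P(1) that] that unfolding V(2) by simp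
      show "(V'\<^sup>\<dagger> * P * V') $$ (i, j) = (1\<^sub>m (Suc k) :: complex mat) $$ (i, j)"
        unfolding gram_entry[OF V' P(1) ij] using ij old vy yv yy by (auto simp: col' less_Suc_eq)
    qed (use V' P in auto)
    then have "Suc k \<in> S" using V' by (auto simp: S_def)
    then show False using fin k Max_ge by (metis Suc_n_not_le_n)
  qed
  have "F\<^sup>\<dagger> * P * F = 0\<^sub>m n n"
  proof (rule zero_form_imp_zero)
    show "F\<^sup>\<dagger> * P * F \<in> carrier_mat n n" using F P by auto
    fix x :: "complex vec" assume x: "x \<in> carrier_vec n"
    have F': "F\<^sup>\<dagger> \<in> carrier_mat n n" using F by simp
    have "(F\<^sup>\<dagger> * P * F) *\<^sub>v x = F\<^sup>\<dagger> *\<^sub>v (P *\<^sub>v (F *\<^sub>v x))"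
      using F F' P x by (simp add: assoc_mult_mat_vec[of _ n n _ n])
    then show "((F\<^sup>\<dagger> * P * F) *\<^sub>v x) \<bullet>c x = 0"
      using adjoint_mult_vec_inner[OF F, of "P *\<^sub>v (F *\<^sub>v x)" x] null[OF x] F P x by simp
  qed
  moreover have "F\<^sup>\<dagger> * P * F = P - P * V * V\<^sup>\<dagger> * P"
  proof -
    have F': "F\<^sup>\<dagger> = 1\<^sub>m n - P * V * V\<^sup>\<dagger>" unfolding F_def using d P(2)
      by (simp add: adjoint_minus adjoint_mult assoc_mat_dim)
    have "F\<^sup>\<dagger> * P * F = P * F - P * V * (V\<^sup>\<dagger> * P * F)" unfolding F' by (rule eq_matI) (use d in \<open>simp_all add: mat_ring_dim const_mat_hom del: index_mult_mat(1)\<close>)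
    also have "\<dots> = P - P * V * V\<^sup>\<dagger> * P" unfolding VPF unfolding F_def by (rule eq_matI) (use d in \<open>simp_all add: mat_ring_dim const_mat_hom del: index_mult_mat(1)\<close>)
    finally show ?thesis .
  qed
  ultimately have 0: "P - P * V * V\<^sup>\<dagger> * P = 0\<^sub>m n n" by simp
  have "P = (P - P * V * V\<^sup>\<dagger> * P) + P * V * V\<^sup>\<dagger> * P" by (rule eq_matI) (use d in \<open>simp_all add: mat_ring_dim const_mat_hom del: index_mult_mat(1)\<close>)
  also have "\<dots> = P * V * V\<^sup>\<dagger> * P" unfolding 0 by (rule eq_matI) (use d in \<open>simp_all add: mat_ring_dim const_mat_hom del: index_mult_mat(1)\<close>)
  finally show ?thesis using that V by blast
qed

lemma stacked_adjoint_mult: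
  assumes "U \<in> carrier_mat k j" "W \<in> carrier_mat m j" "U' \<in> carrier_mat k l" "W' \<in> carrier_mat m l"
  shows "(mat (k + m) j (\<lambda>(a, b). if a < k then U $$ (a, b) else W $$ (a - k, b)))\<^sup>\<dagger>
      * mat (k + m) l (\<lambda>(a, b). if a < k then U' $$ (a, b) else W' $$ (a - k, b)) = U\<^sup>\<dagger> * U' + (W :: complex mat)\<^sup>\<dagger> * W'"
proof (rule eq_matI)
  fix a b assume "a < dim_row (U\<^sup>\<dagger> * U' + W\<^sup>\<dagger> * W')" "b < dim_col (U\<^sup>\<dagger> * U' + W\<^sup>\<dagger> * W')"
  then have ab: "a < j" "b < l" using assms by auto
  let ?f = "\<lambda>i. cnj (if i < k then U $$ (i, a) else W $$ (i - k, a)) * (if i < k then U' $$ (i, b) else W' $$ (i - k, b))"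
  have "(\<Sum>i = 0..<k + m. ?f i) = (\<Sum>i = 0..<k. ?f i) + (\<Sum>i = k..<k + m. ?f i)"
    by (rule sum.atLeastLessThan_concat[symmetric]) auto
  also have "(\<Sum>i = k..<k + m. ?f i) = (\<Sum>i = 0..<m. ?f (i + k))"
    using sum.shift_bounds_nat_ivl[of ?f 0 k m] by (simp add: add.commute)
  finally show "((mat (k + m) j (\<lambda>(a, b). if a < k then U $$ (a, b) else W $$ (a - k, b)))\<^sup>\<dagger>
      * mat (k + m) l (\<lambda>(a, b). if a < k then U' $$ (a, b) else W' $$ (a - k, b))) $$ (a, b) = (U\<^sup>\<dagger> * U' + W\<^sup>\<dagger> * W') $$ (a, b)"
    using ab assms by (simp add: scalar_prod_def)
qed (use assms in auto)

text \<open>With \<open>P = S\<^sup>\<dagger>S\<close> and \<open>SV = I\<close>, the columns to be found are those of a matrix with blocks \<open>b = SB\<close> and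
  \<open>D\<close>, which must be orthonormal and orthogonal to the columns of the matrix with blocks \<open>SA\<close> and \<open>C\<close>.
  By the Stein equation both blocks vanish on the kernel of \<open>S\<close>, so the latter columns are
  combinations of the \<open>k\<close> columns of \<open>SAV\<close> over \<open>CV\<close>, and in a space of dimension \<open>k + m\<close> there is room
  for \<open>m\<close> more. Finally \<open>B = Vb\<close>.\<close>

lemma lossless_extension:
  assumes A: "(A :: complex mat) \<in> carrier_mat n n" and C: "C \<in> carrier_mat m n" and P: "P \<in> carrier_mat n n" "P\<^sup>\<dagger> = P"
    and psd: "\<And>x. x \<in> carrier_vec n \<Longrightarrow> 0 \<le> Re ((P *\<^sub>v x) \<bullet>c x)"
    and stein: "P - A\<^sup>\<dagger> * P * A = C\<^sup>\<dagger> * C"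
  obtains B D where "B \<in> carrier_mat n m" "D \<in> carrier_mat m m" "A\<^sup>\<dagger> * P * B + C\<^sup>\<dagger> * D = 0\<^sub>m n m"
    "B\<^sup>\<dagger> * P * B + D\<^sup>\<dagger> * D = 1\<^sub>m m"
proof -
  obtain k V where V: "V \<in> carrier_mat n k" "V\<^sup>\<dagger> * P * V = 1\<^sub>m k" "P = P * V * V\<^sup>\<dagger> * P"
    using positive_semidefinite_factor[OF P psd] by blast
  define S where "S = V\<^sup>\<dagger> * P"
  have S: "S \<in> carrier_mat k n" using V P by (auto simp: S_def)
  note d = A[THEN carrier_mat_dims] C[THEN carrier_mat_dims] P(1)[THEN carrier_mat_dims] V(1)[THEN carrier_mat_dims] S[THEN carrier_mat_dims]
  have S': "S\<^sup>\<dagger> = P * V" using d P(2) by (simp add: S_def adjoint_mult)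
  have SS: "S\<^sup>\<dagger> * S = P" unfolding S' unfolding S_def using V(3) d by (simp add: assoc_mat_dim)
  have SV: "S * V = 1\<^sub>m k" using V(2) by (simp add: S_def)
  \<comment> \<open>the projection onto the kernel of \<open>S\<close> along the range of \<open>V\<close>\<close>
  define E where "E = 1\<^sub>m n - V * S"
  have E: "E \<in> carrier_mat n n" using V S by (auto simp: E_def intro!: minus_carrier_mat)
  note d = d E[THEN carrier_mat_dims]
  have "S * E = S - (S * V) * S" unfolding E_def by (rule eq_matI) (use d in \<open>simp_all add: mat_ring_dim const_mat_hom del: index_mult_mat(1)\<close>)
  also have "\<dots> = 0\<^sub>m k n" unfolding SV by (rule eq_matI) (use d in \<open>simp_all add: mat_ring_dim const_mat_hom del: index_mult_mat(1)\<close>)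
  finally have SE: "S * E = 0\<^sub>m k n" .
  have "(S * A * E)\<^sup>\<dagger> * (S * A * E) + (C * E)\<^sup>\<dagger> * (C * E) = E\<^sup>\<dagger> * (A\<^sup>\<dagger> * (S\<^sup>\<dagger> * S) * A + C\<^sup>\<dagger> * C) * E"
    using d by (simp add: adjoint_mult mat_ring_dim)
  also have "A\<^sup>\<dagger> * (S\<^sup>\<dagger> * S) * A + C\<^sup>\<dagger> * C = S\<^sup>\<dagger> * S" unfolding SS stein[symmetric] by (rule eq_matI) (use d in \<open>simp_all add: mat_ring_dim const_mat_hom del: index_mult_mat(1)\<close>)
  also have "E\<^sup>\<dagger> * (S\<^sup>\<dagger> * S) * E = (S * E)\<^sup>\<dagger> * (S * E)" using d by (simp add: adjoint_mult mat_ring_dim)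
  also have "\<dots> = 0\<^sub>m n n" unfolding SE by simp
  finally have G0: "(S * A * E)\<^sup>\<dagger> * (S * A * E) + (C * E)\<^sup>\<dagger> * (C * E) = 0\<^sub>m n n" .
  have SAE: "S * A * E = 0\<^sub>m k n" and CE: "C * E = 0\<^sub>m m n"
    using gram_sum_zero[OF _ _ G0] d by simp_all
  have "S * A = S * A * E + S * A * V * S" unfolding E_def by (rule eq_matI) (use d in \<open>simp_all add: mat_ring_dim const_mat_hom del: index_mult_mat(1)\<close>)
  also have "\<dots> = S * A * V * S" unfolding SAE by (rule eq_matI) (use d in \<open>simp_all add: mat_ring_dim const_mat_hom del: index_mult_mat(1)\<close>)
  finally have SA: "S * A = S * A * V * S" .
  have "C = C * E + C * V * S" unfolding E_def by (rule eq_matI) (use d in \<open>simp_all add: mat_ring_dim const_mat_hom del: index_mult_mat(1)\<close>)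
  also have "\<dots> = C * V * S" unfolding CE by (rule eq_matI) (use d in \<open>simp_all add: mat_ring_dim const_mat_hom del: index_mult_mat(1)\<close>)
  finally have CV: "C = C * V * S" .
  let ?st = "\<lambda>j U W. mat (k + m) j (\<lambda>(a, b). if a < k then U $$ (a, b) else W $$ (a - k, b)) :: complex mat"
  obtain Z where Z: "Z \<in> carrier_mat (k + m) m" "Z\<^sup>\<dagger> * Z = 1\<^sub>m m" "(?st k (S * A * V) (C * V))\<^sup>\<dagger> * Z = 0\<^sub>m k m"
    using orthonormal_columns_orthogonal[of "?st k (S * A * V) (C * V)" "k + m" k m] by auto
  define b where "b = mat k m (\<lambda>(i, j). Z $$ (i, j))"
  define D where "D = mat m m (\<lambda>(i, j). Z $$ (k + i, j))"
  have bD: "b \<in> carrier_mat k m" "D \<in> carrier_mat m m" by (auto simp: b_def D_def)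
  have Zst: "Z = ?st m b D" using Z(1) by (intro eq_matI) (auto simp: b_def D_def)
  have 1: "b\<^sup>\<dagger> * b + D\<^sup>\<dagger> * D = 1\<^sub>m m"
    using Z(2) unfolding Zst stacked_adjoint_mult[OF bD bD] .
  have "S * A * V \<in> carrier_mat k k" "C * V \<in> carrier_mat m k" using A C S V by auto
  from Z(3)[unfolded Zst stacked_adjoint_mult[OF this bD]] 
  have 0: "(S * A * V)\<^sup>\<dagger> * b + (C * V)\<^sup>\<dagger> * D = 0\<^sub>m k m" .
  note d = d bD[THEN carrier_mat_dims]
  have "A\<^sup>\<dagger> * P * (V * b) + C\<^sup>\<dagger> * D = (S * A)\<^sup>\<dagger> * (S * V) * b + C\<^sup>\<dagger> * D"
    unfolding SS[symmetric] using d by (simp add: adjoint_mult mat_ring_dim)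
  also have "\<dots> = (S * A * V * S)\<^sup>\<dagger> * b + (C * V * S)\<^sup>\<dagger> * D"
    unfolding SV using SA CV d by simp
  also have "\<dots> = S\<^sup>\<dagger> * ((S * A * V)\<^sup>\<dagger> * b + (C * V)\<^sup>\<dagger> * D)"
    using d by (simp add: adjoint_mult mat_ring_dim)
  also have "\<dots> = 0\<^sub>m n m" unfolding 0 using d by simp
  finally have "A\<^sup>\<dagger> * P * (V * b) + C\<^sup>\<dagger> * D = 0\<^sub>m n m" .
  moreover have "(V * b)\<^sup>\<dagger> * P * (V * b) + D\<^sup>\<dagger> * D = 1\<^sub>m m"
  proof -
    have "(V * b)\<^sup>\<dagger> * P * (V * b) = b\<^sup>\<dagger> * (V\<^sup>\<dagger> * P * V) * b" using d by (simp add: adjoint_mult mat_ring_dim)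
    also have "\<dots> = b\<^sup>\<dagger> * b" unfolding V(2) using d by simp
    finally show ?thesis using 1 by simp
  qed
  ultimately show ?thesis using that[of "V * b" D] V bD by auto
qed

section \<open>Bi-inner factors of a unitary function\<close>

lemma realize_out_eq: 
  assumes "K \<in> carrier_mat k n" "L \<in> carrier_mat n n" "M \<in> carrier_mat n m"
  shows "realize_out K L M = const_mat K * res_out L * const_mat M"
proof -
  have "det (1\<^sub>m n - rat_z \<cdot>\<^sub>m const_mat L) \<noteq> 0" using res_out_regular(1)[OF assms(2), of 0] by simp
  then have "minv (1\<^sub>m n - rat_z \<cdot>\<^sub>m const_mat L) \<in> carrier_mat n n"
    using assms by (intro minv_inverse(1)) auto
  then show ?thesis using assms
    by (simp add: realize_out_def res_out_def mult_smult_mat_dim smult_mult_mat_dim)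
qed

lemma realize_in_eq: "realize_in K L M = const_mat K * res_in L * const_mat M"
  by (simp add: realize_in_def res_in_def)

lemma mat_eval_star:
  assumes "\<not> mat_pole F z" "cmod z = 1"
  shows "\<not> mat_pole (mat_star F) z" "mat_eval (mat_star F) z = (mat_eval F z)\<^sup>\<dagger>"
proof -
  have z: "z \<noteq> 0" "1 / cnj z = z"
    using assms(2) complex_norm_square[of z] by (auto simp: divide_simps mult.commute)
  have *: "\<not> rat_pole (rat_star q) z \<and> rat_eval (rat_star q) z = cnj (rat_eval q z)" if "\<not> rat_pole q z" for q
    using rat_eval_star[OF z(1), of q] that unfolding z(2) by simp
  show "\<not> mat_pole (mat_star F) z" using assms(1) * by (auto simp: mat_pole_def)
  show "mat_eval (mat_star F) z = (mat_eval F z)\<^sup>\<dagger>"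
    using assms(1) * by (intro eq_matI) (auto simp: mat_pole_def mat_eval_def)
qed

lemma bi_innerI:
  assumes F: "F \<in> carrier_mat m m" and pole: "\<And>z. cmod z \<le> 1 \<Longrightarrow> \<not> mat_pole F z" and 1: "mat_star F * F = 1\<^sub>m m"
  shows "bi_inner m F"
  unfolding bi_inner_def
proof (intro conjI allI impI)
  fix z :: complex assume z: "cmod z = 1"
  have p: "\<not> mat_pole F z" using pole[of z] z by simp
  note s = mat_eval_star[OF p z]
  have U: "mat_eval F z \<in> carrier_mat m m" "(mat_eval F z)\<^sup>\<dagger> \<in> carrier_mat m m" using F by (auto intro: carrier_matI)
  have "(mat_eval F z)\<^sup>\<dagger> * mat_eval F z = mat_eval (mat_star F * F) z"
    using s p F by (simp add: mat_eval_mult)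
  also have "\<dots> = mat_eval (const_mat (1\<^sub>m m)) z" unfolding 1 const_mat_one ..
  also have "\<dots> = 1\<^sub>m m" by (intro eq_matI) (auto simp: mat_eval_def const_mat_def rat_eval_const)
  finally have L: "(mat_eval F z)\<^sup>\<dagger> * mat_eval F z = 1\<^sub>m m" .
  from mat_mult_left_right_inverse[OF U(2,1) L] L show "unitary_mat (mat_eval F z)"
    using U F by (auto simp: unitary_mat_def)
qed (use F pole in auto)

lemma four_block_mat_inject:
  assumes "four_block_mat A B C D = four_block_mat A' B' C' D'"
    and "A \<in> carrier_mat n m" "B \<in> carrier_mat n k" "C \<in> carrier_mat l m" "D \<in> carrier_mat l k"
    and "A' \<in> carrier_mat n m" "B' \<in> carrier_mat n k" "C' \<in> carrier_mat l m" "D' \<in> carrier_mat l k"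
  shows "A = A'" "B = B'" "C = C'" "D = D'"
proof -
  have ix: "four_block_mat A B C D $$ (i, j) = four_block_mat A' B' C' D' $$ (i, j)" for i j
    using assms(1) by simp
  show "A = A'"
  proof (rule eq_matI)
    fix i j assume "i < dim_row A'" "j < dim_col A'"
    then show "A $$ (i, j) = A' $$ (i, j)" using ix[of i j] assms(2-) by auto
  qed (use assms in auto)
  show "B = B'"
  proof (rule eq_matI)
    fix i j assume "i < dim_row B'" "j < dim_col B'"
    then show "B $$ (i, j) = B' $$ (i, j)" using ix[of i "m + j"] assms(2-) by auto
  qed (use assms in auto)
  show "C = C'"
  proof (rule eq_matI)
    fix i j assume "i < dim_row C'" "j < dim_col C'"
    then show "C $$ (i, j) = C' $$ (i, j)" using ix[of "n + i" j] assms(2-) by auto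
  qed (use assms in auto)
  show "D = D'"
  proof (rule eq_matI)
    fix i j assume "i < dim_row D'" "j < dim_col D'"
    then show "D $$ (i, j) = D' $$ (i, j)" using ix[of "n + i" "m + j"] assms(2-) by auto
  qed (use assms in auto)
qed

lemma lossless_block_product:
  assumes "A \<in> carrier_mat n n" "B \<in> carrier_mat n m" "C \<in> carrier_mat m n" "D \<in> carrier_mat m m" "P \<in> carrier_mat n n"
  shows "four_block_mat (A\<^sup>\<dagger>) (C\<^sup>\<dagger>) (B\<^sup>\<dagger>) (D\<^sup>\<dagger>) * four_block_mat P (0\<^sub>m n m) (0\<^sub>m m n) (1\<^sub>m m) * four_block_mat A B C D
    = four_block_mat (A\<^sup>\<dagger> * P * A + C\<^sup>\<dagger> * C) (A\<^sup>\<dagger> * P * B + C\<^sup>\<dagger> * D) (B\<^sup>\<dagger> * P * A + D\<^sup>\<dagger> * C) (B\<^sup>\<dagger> * P * B + D\<^sup>\<dagger> * (D :: complex mat))"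
proof -
  note d = assms[THEN carrier_mat_dims]
  have "four_block_mat (A\<^sup>\<dagger>) (C\<^sup>\<dagger>) (B\<^sup>\<dagger>) (D\<^sup>\<dagger>) * four_block_mat P (0\<^sub>m n m) (0\<^sub>m m n) (1\<^sub>m m) = 
     four_block_mat (A\<^sup>\<dagger> * P) (C\<^sup>\<dagger>) (B\<^sup>\<dagger> * P) (D\<^sup>\<dagger>)"
    using assms by (subst mult_four_block_mat[of _ n n _ m _ m _ _ n _ m]) (auto simp: mat_ring_dim intro!: cong_four_block_mat)
  then show ?thesis using assms by (simp add: mult_four_block_mat[of _ n n _ m _ m _ _ n _ m])
qed

lemma res_in_intertwine:
  assumes "L \<in> carrier_mat n n" "X \<in> carrier_mat n k" "M \<in> carrier_mat k k" "L * X = X * M"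
  shows "res_in L * const_mat X = const_mat X * res_in M"
proof -
  note d = assms(1-3)[THEN carrier_mat_dims] res_in_resolvent(1)[OF assms(1), THEN carrier_mat_dims] res_in_resolvent(1)[OF assms(3), THEN carrier_mat_dims]
  have "res_in L * const_mat X = res_in L * const_mat (L * X - X * M) * res_in M + const_mat X * res_in M"
    unfolding sylvester_in_in[OF assms(1-3)] by (rule eq_matI) (use d in \<open>simp_all add: mat_ring_dim const_mat_hom del: index_mult_mat(1)\<close>)
  also have "\<dots> = const_mat X * res_in M" unfolding assms(4) by (rule eq_matI) (use d in \<open>simp_all add: mat_ring_dim const_mat_hom del: index_mult_mat(1)\<close>)
  finally show ?thesis .
qed

lemma res_out_intertwine:
  assumes "L \<in> carrier_mat n n" "X \<in> carrier_mat n k" "M \<in> carrier_mat k k" "L * X = X * M"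
  shows "res_out L * const_mat X = const_mat X * res_out M"
proof -
  note d = assms(1-3)[THEN carrier_mat_dims] res_out_resolvent(1)[OF assms(1), THEN carrier_mat_dims] res_out_resolvent(1)[OF assms(3), THEN carrier_mat_dims]
  have "res_out L * const_mat X = res_out L * const_mat (L * X - X * M) * res_out M + const_mat X * res_out M"
    unfolding sylvester_out_out[OF assms(1-3)] by (rule eq_matI) (use d in \<open>simp_all add: mat_ring_dim const_mat_hom del: index_mult_mat(1)\<close>)
  also have "\<dots> = const_mat X * res_out M" unfolding assms(4) by (rule eq_matI) (use d in \<open>simp_all add: mat_ring_dim const_mat_hom del: index_mult_mat(1)\<close>)
  finally show ?thesis .
qed

text \<open>The first block row of the resolvent of a block upper triangular matrix. The rows are selected by
  \<open>X\<close> and \<open>X'\<close>, so that no block decomposition of the resolvent itself is needed.\<close>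

lemma res_in_triangular:
  assumes car: "L \<in> carrier_mat n n" "X \<in> carrier_mat n k" "M \<in> carrier_mat k k" "N \<in> carrier_mat p p" "X' \<in> carrier_mat p k" "S \<in> carrier_mat n p"
    and X: "X * M = L * X + S * X'" and X': "X' * M = N * X'"
  shows "const_mat X * res_in M = res_in L * const_mat X + res_in L * const_mat S * res_in N * const_mat X'"
proof -
  note d = car[THEN carrier_mat_dims] res_in_resolvent(1)[OF car(1), THEN carrier_mat_dims] 
    res_in_resolvent(1)[OF car(3), THEN carrier_mat_dims] res_in_resolvent(1)[OF car(4), THEN carrier_mat_dims]
  have "const_mat X * res_in M = res_in L * const_mat X - res_in L * const_mat (L * X - X * M) * res_in M"
    unfolding sylvester_in_in[OF car(1-3)] by (rule eq_matI) (use d in \<open>simp_all add: mat_ring_dim const_mat_hom del: index_mult_mat(1)\<close>)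
  also have "\<dots> = res_in L * const_mat X + res_in L * const_mat S * (const_mat X' * res_in M)"
    unfolding X by (rule eq_matI) (use d in \<open>simp_all add: mat_ring_dim const_mat_hom del: index_mult_mat(1)\<close>)
  also have "const_mat X' * res_in M = res_in N * const_mat X'" using res_in_intertwine[OF car(4,5,3)] X' by simp
  also have "res_in L * const_mat X + res_in L * const_mat S * \<dots> = res_in L * const_mat X + res_in L * const_mat S * res_in N * const_mat X'"
    by (rule eq_matI) (use d in \<open>simp_all add: mat_ring_dim const_mat_hom del: index_mult_mat(1)\<close>)
  finally show ?thesis .
qed

lemma unitary_lossless_factorization:
  assumes car: "\<alpha> \<in> carrier_mat p p" "A \<in> carrier_mat n n" "P \<in> carrier_mat n n"
      "\<Xi>0 \<in> carrier_mat m m" "\<beta> \<in> carrier_mat p m" "\<gamma> \<in> carrier_mat m p" "C \<in> carrier_mat m n" "K \<in> carrier_mat n m"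
      "B \<in> carrier_mat n m" "D \<in> carrier_mat m m"
    and st: "stable_mat \<alpha>" "stable_mat A"
    and P: "P - A\<^sup>\<dagger> * P * A = C\<^sup>\<dagger> * C"
    and 21: "B\<^sup>\<dagger> * P * A + D\<^sup>\<dagger> * C = 0\<^sub>m m n"
    and 12: "A\<^sup>\<dagger> * P * B + C\<^sup>\<dagger> * D = 0\<^sub>m n m"
    and 22: "B\<^sup>\<dagger> * P * B + D\<^sup>\<dagger> * D = 1\<^sub>m m"
  defines "\<Xi> \<equiv> const_mat \<Xi>0 + const_mat \<gamma> * res_in \<alpha> * const_mat \<beta> + const_mat C * res_out A * const_mat K"
    and "V \<equiv> const_mat D + const_mat C * res_out A * const_mat B"
  assumes unit: "mat_star \<Xi> * \<Xi> = 1\<^sub>m m"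
  shows "bi_inner m V" "bi_inner m (mat_star (mat_star V * \<Xi>))" "\<Xi> = V * (mat_star V * \<Xi>)"
    and "mat_star V * \<Xi> = (const_mat (D\<^sup>\<dagger>) + const_mat (B\<^sup>\<dagger>) * res_in (A\<^sup>\<dagger>) * const_mat (C\<^sup>\<dagger>)) * 
        (const_mat \<Xi>0 + const_mat \<gamma> * res_in \<alpha> * const_mat \<beta>)
     + (const_mat (B\<^sup>\<dagger> * P) + const_mat (B\<^sup>\<dagger>) * res_in (A\<^sup>\<dagger>) * const_mat (A\<^sup>\<dagger> * P)) * const_mat K" (is "_ = ?Ws")
proof -
  have A': "A\<^sup>\<dagger> \<in> carrier_mat n n" and \<alpha>': "\<alpha>\<^sup>\<dagger> \<in> carrier_mat p p" using car by simp_all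
  note d = car[THEN carrier_mat_dims] res_out_resolvent(1)[OF car(2), THEN carrier_mat_dims] 
    res_in_resolvent(1)[OF A', THEN carrier_mat_dims] res_in_resolvent(1)[OF car(1), THEN carrier_mat_dims]
    res_out_resolvent(1)[OF \<alpha>', THEN carrier_mat_dims]
  have star: "mat_star (res_out A) = res_in (A\<^sup>\<dagger>)" "mat_star (res_in (A\<^sup>\<dagger>)) = res_out A" "mat_star (res_in \<alpha>) = res_out (\<alpha>\<^sup>\<dagger>)"
    using mat_star_res_out[OF car(2)] mat_star_res_in[OF car(1)] mat_star_res_in[OF A'] by auto
  have dim: "dim_row V = m" "dim_col V = m" "dim_row \<Xi> = m" "dim_col \<Xi> = m" using d by (auto simp: V_def \<Xi>_def)
  then have V: "V \<in> carrier_mat m m" and V': "mat_star V \<in> carrier_mat m m" 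
    and \<Xi>: "\<Xi> \<in> carrier_mat m m" and \<Xi>': "mat_star \<Xi> \<in> carrier_mat m m" by auto
  have VV: "mat_star V * V = 1\<^sub>m m"
    unfolding V_def by (rule lossless_star_times[OF car(2,9,7,10,3) P 21 12 22])
  note VV' = mat_mult_left_right_inverse[OF V' V VV]
  note uu' = mat_mult_left_right_inverse[OF \<Xi>' \<Xi> unit]
  note o = stable_res_out_no_pole[OF car(2) st(2)] stable_res_out_no_pole[OF \<alpha>' stable_mat_adjoint[OF st(1)]]
  show "bi_inner m V"
  proof (rule bi_innerI[OF V _ VV])
    show "\<not> mat_pole V z" if "cmod z \<le> 1" for z
      unfolding V_def using o(1)[OF that] d by (intro no_mat_pole_add no_mat_pole_mult no_mat_pole_const) auto
  qed
  have "V * (mat_star V * \<Xi>) = (V * mat_star V) * \<Xi>" using dim by (simp add: assoc_mat_dim)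
  then show "\<Xi> = V * (mat_star V * \<Xi>)" unfolding VV' using dim by simp
  have "mat_star V * (const_mat C * res_out A) = const_mat (B\<^sup>\<dagger> * P) + const_mat (B\<^sup>\<dagger>) * res_in (A\<^sup>\<dagger>) * const_mat (A\<^sup>\<dagger> * P)"
    unfolding V_def by (rule lossless_star_times_out[OF car(2,9,7,10,3) P 21])
  moreover have "mat_star V = const_mat (D\<^sup>\<dagger>) + const_mat (B\<^sup>\<dagger>) * res_in (A\<^sup>\<dagger>) * const_mat (C\<^sup>\<dagger>)"
    using d by (simp add: V_def mat_star_add mat_star_mult star assoc_mat_dim)
  moreover have "mat_star V * \<Xi> = mat_star V * (const_mat \<Xi>0 + const_mat \<gamma> * res_in \<alpha> * const_mat \<beta>) + 
      mat_star V * (const_mat C * res_out A) * const_mat K"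
    unfolding \<Xi>_def using d dim by (simp add: mat_ring_dim)
  ultimately show Ws: "mat_star V * \<Xi> = ?Ws" by simp
  show "bi_inner m (mat_star (mat_star V * \<Xi>))"
  proof (rule bi_innerI)
    show "mat_star (mat_star V * \<Xi>) \<in> carrier_mat m m" using dim by (intro carrier_matI) auto
    have "mat_star (mat_star (mat_star V * \<Xi>)) * mat_star (mat_star V * \<Xi>) = mat_star V * (\<Xi> * mat_star \<Xi>) * V"
      using dim by (simp add: mat_star_mult mat_ring_dim)
    then show "mat_star (mat_star (mat_star V * \<Xi>)) * mat_star (mat_star V * \<Xi>) = 1\<^sub>m m"
      unfolding uu' using VV dim by simp
    fix z :: complex assume z: "cmod z \<le> 1"
    have "mat_star (mat_star V * \<Xi>) = 
      (const_mat (\<Xi>0\<^sup>\<dagger>) + const_mat (\<beta>\<^sup>\<dagger>) * (res_out (\<alpha>\<^sup>\<dagger>) * const_mat (\<gamma>\<^sup>\<dagger>))) * (const_mat D + const_mat C * (res_out A * const_mat B))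
      + const_mat (K\<^sup>\<dagger>) * (const_mat (P\<^sup>\<dagger> * B) + const_mat (P\<^sup>\<dagger> * A) * (res_out A * const_mat B))"
      unfolding Ws using d by (simp add: mat_star_add mat_star_mult star adjoint_mult)
    then show "\<not> mat_pole (mat_star (mat_star V * \<Xi>)) z"
      using o[OF z] d by (simp del: mult_carrier_mat) (intro no_mat_pole_add no_mat_pole_mult no_mat_pole_const; simp)
  qed
qed

text \<open>By \<open>res_in_star_product\<close> the function \<open>K\<^sup>\<dagger> e(A\<^sup>\<dagger>) G\<close> equals a combination of \<open>e(\<alpha>)\<close>, \<open>o(\<alpha>\<^sup>\<dagger>)\<close>, \<open>o(A)\<close> and
  constants. Its poles would have to be eigenvalues of \<open>A\<^sup>\<dagger>\<close>, but there the combination is regular: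
  such points lie in the open disc and are not eigenvalues of \<open>\<alpha>\<close>.\<close>

lemma quotient_residue_zero:
  assumes car: "\<alpha> \<in> carrier_mat p p" "A \<in> carrier_mat n n" "P \<in> carrier_mat n n" "P1 \<in> carrier_mat n p" "S \<in> carrier_mat p p"
      "\<Xi>0 \<in> carrier_mat k m" "\<beta> \<in> carrier_mat p m" "\<gamma> \<in> carrier_mat k p" "C \<in> carrier_mat k n" "K \<in> carrier_mat n m"
    and st: "stable_mat \<alpha>" "stable_mat A"
    and P: "P - A\<^sup>\<dagger> * P * A = C\<^sup>\<dagger> * C"
    and S: "S - \<alpha>\<^sup>\<dagger> * S * \<alpha> = \<gamma>\<^sup>\<dagger> * \<gamma>"
    and P1: "A\<^sup>\<dagger> * P1 - P1 * \<alpha> = - (C\<^sup>\<dagger> * \<gamma>)"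
    and unit: "mat_star (const_mat \<Xi>0 + const_mat \<gamma> * res_in \<alpha> * const_mat \<beta> + const_mat C * res_out A * const_mat K) *
      (const_mat \<Xi>0 + const_mat \<gamma> * res_in \<alpha> * const_mat \<beta> + const_mat C * res_out A * const_mat K) = 1\<^sub>m m"
    and disj: "spectrum (A\<^sup>\<dagger>) \<inter> spectrum \<alpha> = {}"
    and con: "\<And>G. G \<in> carrier_mat n m \<Longrightarrow> (\<And>j. K\<^sup>\<dagger> * (A\<^sup>\<dagger>) ^\<^sub>m j * G = 0\<^sub>m m m) \<Longrightarrow> G = 0\<^sub>m n m"
  shows "C\<^sup>\<dagger> * \<Xi>0 - P1 * \<beta> + A\<^sup>\<dagger> * P * K = 0\<^sub>m n m" (is "?G = _")
proof (rule con)
  have A': "A\<^sup>\<dagger> \<in> carrier_mat n n" and \<alpha>': "\<alpha>\<^sup>\<dagger> \<in> carrier_mat p p" and K': "K\<^sup>\<dagger> \<in> carrier_mat m n" using car by simp_all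
  note d = car[THEN carrier_mat_dims] res_out_resolvent(1)[OF car(2), THEN carrier_mat_dims] 
    res_in_resolvent(1)[OF A', THEN carrier_mat_dims] res_in_resolvent(1)[OF car(1), THEN carrier_mat_dims]
    res_out_resolvent(1)[OF \<alpha>', THEN carrier_mat_dims]
  show G: "?G \<in> carrier_mat n m" by (rule carrier_matI) (use d in auto)
  let ?M1 = "\<Xi>0\<^sup>\<dagger> * \<gamma> + \<beta>\<^sup>\<dagger> * S * \<alpha> + K\<^sup>\<dagger> * P1" and ?M2 = "\<gamma>\<^sup>\<dagger> * \<Xi>0 + \<alpha>\<^sup>\<dagger> * S * \<beta> + P1\<^sup>\<dagger> * K"
    and ?M3 = "\<Xi>0\<^sup>\<dagger> * C - \<beta>\<^sup>\<dagger> * P1\<^sup>\<dagger> + K\<^sup>\<dagger> * P * A" and ?M4 = "\<Xi>0\<^sup>\<dagger> * \<Xi>0 + \<beta>\<^sup>\<dagger> * S * \<beta> + K\<^sup>\<dagger> * P * K"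
  let ?T = "const_mat (- ?M1) * (res_in \<alpha> * const_mat \<beta>) + const_mat (- (\<beta>\<^sup>\<dagger>)) * (res_out (\<alpha>\<^sup>\<dagger>) * const_mat ?M2)
    + const_mat (- ?M3) * (res_out A * const_mat K) + const_mat (1\<^sub>m m - ?M4)"
  let ?F = "const_mat (K\<^sup>\<dagger>) * res_in (A\<^sup>\<dagger>) * const_mat ?G"
  have dG: "dim_row ?G = n" "dim_col ?G = m" "dim_row ?M1 = m" "dim_col ?M1 = p" "dim_row ?M2 = p" "dim_col ?M2 = m"
    "dim_row ?M3 = m" "dim_col ?M3 = n" "dim_row ?M4 = m" "dim_col ?M4 = m" using d by simp_all
  have "?F = (?F + const_mat ?M1 * res_in \<alpha> * const_mat \<beta> + const_mat (\<beta>\<^sup>\<dagger>) * res_out (\<alpha>\<^sup>\<dagger>) * const_mat ?M2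
    + const_mat ?M3 * res_out A * const_mat K + const_mat ?M4) - 1\<^sub>m m + ?T"
    by (rule eq_matI) (use d dG in \<open>simp_all add: mat_ring_dim const_mat_hom del: index_mult_mat(1)\<close>)
  also have "\<dots> = 1\<^sub>m m - 1\<^sub>m m + ?T"
    unfolding unit[unfolded res_in_star_product[OF car P S P1]] ..
  also have "\<dots> = ?T" by (rule eq_matI) (use d dG in \<open>simp_all del: index_mult_mat(1)\<close>)
  finally have FT: "?F = ?T" .
  have "\<not> mat_pole ?F z" for z
  proof (cases "z \<in> spectrum (A\<^sup>\<dagger>)")
    case False
    then show ?thesis using res_in_regular(2)[OF A' False] d
      by (intro no_mat_pole_mult no_mat_pole_const) auto
  next
    case True
    then have z: "z \<notin> spectrum \<alpha>" "cmod z \<le> 1"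
      using disj stable_mat_adjoint[OF st(2)] by (auto simp: stable_mat_def dest!: subsetD)
    note r = res_in_regular(2)[OF car(1) z(1)] stable_res_out_no_pole[OF car(2) st(2) z(2)] 
      stable_res_out_no_pole[OF \<alpha>' stable_mat_adjoint[OF st(1)] z(2)]
    show ?thesis unfolding FT using r d
      by (intro no_mat_pole_add no_mat_pole_mult no_mat_pole_const) simp_all
  qed
  from strictly_proper_pole_free_eq_0[OF A' K' G this]
  show "K\<^sup>\<dagger> * (A\<^sup>\<dagger>) ^\<^sub>m j * ?G = 0\<^sub>m m m" for j
    by (rule res_in_eq_0_moments[OF A' K' G])
qed

section \<open>The left unitary factor\<close>

text \<open>The block rows \<open>[I 0]\<close> and \<open>[0 I]\<close>. Multiplication by them expresses the block structure of the data
  by equations between matrices.\<close>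

definition first_coords :: "nat \<Rightarrow> nat \<Rightarrow> complex mat" where
  "first_coords n p = mat n (n + p) (\<lambda>(i, j). if i = j then 1 else 0)"

definition last_coords :: "nat \<Rightarrow> nat \<Rightarrow> complex mat" where
  "last_coords n p = mat p (n + p) (\<lambda>(i, j). if j = n + i then 1 else 0)"

lemma coords_carrier [simp]: "first_coords n p \<in> carrier_mat n (n + p)" "last_coords n p \<in> carrier_mat p (n + p)"
  by (auto simp: first_coords_def last_coords_def)

lemma coords_dim [simp]: "dim_row (first_coords n p) = n" "dim_col (first_coords n p) = n + p"
    "dim_row (last_coords n p) = p" "dim_col (last_coords n p) = n + p"
  by (auto simp: first_coords_def last_coords_def)

lemma coords_mult_index:
  "dim_row M = n + p \<Longrightarrow> i < n \<Longrightarrow> j < dim_col M \<Longrightarrow> (first_coords n p * M) $$ (i, j) = M $$ (i, j)"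
  "dim_row M = n + p \<Longrightarrow> i < p \<Longrightarrow> j < dim_col M \<Longrightarrow> (last_coords n p * M) $$ (i, j) = M $$ (n + i, j)"
  by (simp_all add: first_coords_def last_coords_def scalar_prod_def if_distrib[of "\<lambda>x. x * _"] cong: if_cong)

lemma mult_first_coords_index:
  "i < dim_row M \<Longrightarrow> dim_col M = n \<Longrightarrow> j < n + p \<Longrightarrow> (M * first_coords n p) $$ (i, j) = (if j < n then M $$ (i, j) else 0)"
  by (simp add: first_coords_def scalar_prod_def if_distrib[of "\<lambda>x. _ * x"] cong: if_cong)

lemma mult_last_coords_index:
  assumes "i < dim_row M" "dim_col M = p" "j < n + p"
  shows "(M * last_coords n p) $$ (i, j) = (if n \<le> j then M $$ (i, j - n) else 0)"
proof -
  have "(M * last_coords n p) $$ (i, j) = (\<Sum>l = 0..<p. M $$ (i, l) * (if j = n + l then 1 else 0))"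
    using assms by (simp add: last_coords_def scalar_prod_def)
  also have "\<dots> = (\<Sum>l = 0..<p. if l = j - n then (if n \<le> j then M $$ (i, l) else 0) else 0)"
    by (intro sum.cong) auto
  also have "\<dots> = (if n \<le> j then M $$ (i, j - n) else 0)" using assms(3) by (subst sum.delta) auto
  finally show ?thesis .
qed

lemma pos_def_mat_det:
  assumes D: "pos_def_mat D" "D \<in> carrier_mat m m"
  shows "det D \<noteq> 0"
proof
  assume "det D = 0"
  then obtain v where v: "v \<in> carrier_vec m" "v \<noteq> 0\<^sub>v m" "D *\<^sub>v v = 0\<^sub>v m"
    using det_0_iff_vec_prod_zero[OF D(2)] by blast
  then have "0 < (D *\<^sub>v v) \<bullet>c v" using D by (auto simp: pos_def_mat_def)
  then show False using v by simp
qed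

locale unitary_factor_data =
  fixes n p m :: nat
    and A B C R0 \<alpha> \<beta> \<gamma> Pp Pm At Bt Ct Dt Q D A0 B0 C0 Y \<Xi>0 C1 \<beta>1 :: "complex mat"
    and R \<Psi> \<Xi> :: "ratmat"
  assumes A: "A \<in> carrier_mat n n" and B: "B \<in> carrier_mat n m"
    and C: "C \<in> carrier_mat m n" and R0: "R0 \<in> carrier_mat m m"
    and \<alpha>: "\<alpha> \<in> carrier_mat p p" and \<beta>: "\<beta> \<in> carrier_mat p m"
    and \<gamma>: "\<gamma> \<in> carrier_mat m p"
    and stable: "stable_mat A" "stable_mat \<alpha>"
    and R: "R = const_mat R0 + realize_out C A B + realize_in \<gamma> \<alpha> \<beta>"
    and Pp: "Pp \<in> carrier_mat n n" "Pp - A\<^sup>\<dagger> * Pp * A = C\<^sup>\<dagger> * C"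
    and Pm: "Pm \<in> carrier_mat p p" "Pm - \<alpha>\<^sup>\<dagger> * Pm * \<alpha> = \<gamma>\<^sup>\<dagger> * \<gamma>"
    and At: "At = four_block_mat (A\<^sup>\<dagger>) (C\<^sup>\<dagger> * \<gamma>) (0\<^sub>m p n) \<alpha>"
    and Bt: "Bt = (C\<^sup>\<dagger> * R0 + A\<^sup>\<dagger> * Pp * B) @\<^sub>r \<beta>"
    and Ct: "Ct = B\<^sup>\<dagger> @\<^sub>c (R0\<^sup>\<dagger> * \<gamma> + \<beta>\<^sup>\<dagger> * Pm * \<alpha>)"
    and Dt: "Dt = R0\<^sup>\<dagger> * R0 + B\<^sup>\<dagger> * Pp * B + \<beta>\<^sup>\<dagger> * Pm * \<beta>"
    and Q: "Q \<in> carrier_mat (n + p) (n + p)" "Q\<^sup>\<dagger> = Q"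
    and Q_riccati: "Q - At * Q * At\<^sup>\<dagger> =
          (Bt - At * Q * Ct\<^sup>\<dagger>) * minv (Dt - Ct * Q * Ct\<^sup>\<dagger>) * (Bt\<^sup>\<dagger> - Ct * Q * At\<^sup>\<dagger>)"
    and D: "pos_def_mat D" "D * D = Dt - Ct * Q * Ct\<^sup>\<dagger>"
    and C0: "C0 = Bt\<^sup>\<dagger> - Ct * Q * At\<^sup>\<dagger>"
    and B0: "B0 = Ct\<^sup>\<dagger>"
    and A0: "A0 = At\<^sup>\<dagger> - Ct\<^sup>\<dagger> * (minv D ^\<^sub>m 2) * C0"
    and \<Psi>: "\<Psi> = const_mat D + realize_out (minv D * C0) (At\<^sup>\<dagger>) B0"
    and \<Xi>: "\<Xi> = R * minv \<Psi>"
    and Y: "Y \<in> carrier_mat p (n + p)" "Y - \<alpha> * Y * A0 = \<alpha> * \<beta> * (minv D ^\<^sub>m 2) * C0"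
    and \<Xi>0: "\<Xi>0 = R0 * minv D - \<gamma> * Y * A0 * B0 * minv D
                - \<gamma> * \<beta> * (minv D ^\<^sub>m 2) * C0 * B0 * minv D"
    and C1: "C1 = (C @\<^sub>c 0\<^sub>m m p) - R0 * (minv D ^\<^sub>m 2) * C0
                - \<gamma> * Y * (A0 ^\<^sub>m 2) - \<gamma> * \<beta> * (minv D ^\<^sub>m 2) * C0 * A0"
    and \<beta>1: "\<beta>1 = (\<beta> - Y * B0) * minv D"
begin

abbreviation (input) "X1 \<equiv> first_coords n p"
abbreviation (input) "X2 \<equiv> last_coords n p"
abbreviation (input) "Di \<equiv> minv D"

lemma data_carriers: "At \<in> carrier_mat (n + p) (n + p)" "Bt \<in> carrier_mat (n + p) m" "Ct \<in> carrier_mat m (n + p)"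
    "Dt \<in> carrier_mat m m" "B0 \<in> carrier_mat (n + p) m" "C0 \<in> carrier_mat m (n + p)" "D \<in> carrier_mat m m"
proof -
  note d = A[THEN carrier_mat_dims] B[THEN carrier_mat_dims] C[THEN carrier_mat_dims] R0[THEN carrier_mat_dims] \<alpha>[THEN carrier_mat_dims]
    \<beta>[THEN carrier_mat_dims] \<gamma>[THEN carrier_mat_dims] Pp(1)[THEN carrier_mat_dims] Pm(1)[THEN carrier_mat_dims] Q(1)[THEN carrier_mat_dims]
  show At': "At \<in> carrier_mat (n + p) (n + p)" and Bt': "Bt \<in> carrier_mat (n + p) m" and Ct': "Ct \<in> carrier_mat m (n + p)"
    and Dt': "Dt \<in> carrier_mat m m"
    unfolding At Bt Ct Dt append_rows_def append_cols_def by (rule carrier_matI; use d in simp)+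
  note d = d At'[THEN carrier_mat_dims] Bt'[THEN carrier_mat_dims] Ct'[THEN carrier_mat_dims] Dt'[THEN carrier_mat_dims]
  show "B0 \<in> carrier_mat (n + p) m" "C0 \<in> carrier_mat m (n + p)"
    unfolding B0 C0 by (rule carrier_matI; use d in simp)+
  have "dim_row (D * D) = m" "dim_col (D * D) = m" unfolding D(2) using d by simp_all
  then show "D \<in> carrier_mat m m" by (intro carrier_matI) simp_all
qed

lemma Di: "Di \<in> carrier_mat m m" "D * Di = 1\<^sub>m m" "Di * D = 1\<^sub>m m" "D\<^sup>\<dagger> = D" "Di\<^sup>\<dagger> = Di" "Di ^\<^sub>m 2 = Di * Di"
proof -
  note inv = minv_inverse[OF data_carriers(7) pos_def_mat_det[OF D(1) data_carriers(7)]]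
  then show "Di \<in> carrier_mat m m" "D * Di = 1\<^sub>m m" "Di * D = 1\<^sub>m m" by auto
  show D': "D\<^sup>\<dagger> = D" using D(1) by (simp add: pos_def_mat_def)
  have "D * Di\<^sup>\<dagger> = (Di * D)\<^sup>\<dagger>" using inv(1) data_carriers(7) D' by (subst adjoint_mult) auto
  then have "D * Di\<^sup>\<dagger> = 1\<^sub>m m" using inv by simp
  from minv_unique[OF data_carriers(7) _ this] show "Di\<^sup>\<dagger> = Di" using inv(1) by simp
  show "Di ^\<^sub>m 2 = Di * Di" using inv(1) by (simp add: numeral_2_eq_2)
qed

lemma factor_carriers: "A0 \<in> carrier_mat (n + p) (n + p)" "\<Xi>0 \<in> carrier_mat m m" "C1 \<in> carrier_mat m (n + p)" "\<beta>1 \<in> carrier_mat p m"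
proof -
  note d = A[THEN carrier_mat_dims] B[THEN carrier_mat_dims] C[THEN carrier_mat_dims] R0[THEN carrier_mat_dims] \<alpha>[THEN carrier_mat_dims]
    \<beta>[THEN carrier_mat_dims] \<gamma>[THEN carrier_mat_dims] Y(1)[THEN carrier_mat_dims] data_carriers[THEN carrier_mat_dims] Di(1)[THEN carrier_mat_dims]
  show A0': "A0 \<in> carrier_mat (n + p) (n + p)" unfolding A0 Di(6) by (rule carrier_matI) (use d in simp_all)
  note d = d A0'[THEN carrier_mat_dims] pow_carrier_mat[OF A0', of 2, THEN carrier_mat_dims]
  show "\<Xi>0 \<in> carrier_mat m m" "C1 \<in> carrier_mat m (n + p)" "\<beta>1 \<in> carrier_mat p m"
    unfolding \<Xi>0 C1 \<beta>1 Di(6) by (rule carrier_matI; use d in simp)+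
qed

lemmas dims = A[THEN carrier_mat_dims] B[THEN carrier_mat_dims] C[THEN carrier_mat_dims] R0[THEN carrier_mat_dims] \<alpha>[THEN carrier_mat_dims]
    \<beta>[THEN carrier_mat_dims] \<gamma>[THEN carrier_mat_dims] Pp(1)[THEN carrier_mat_dims] Pm(1)[THEN carrier_mat_dims] Q(1)[THEN carrier_mat_dims]
    Y(1)[THEN carrier_mat_dims] data_carriers[THEN carrier_mat_dims] Di(1)[THEN carrier_mat_dims] factor_carriers[THEN carrier_mat_dims]

lemma block_decomposition:
  "X1 * At = A\<^sup>\<dagger> * X1 + (C\<^sup>\<dagger> * \<gamma>) * X2" "X2 * At = \<alpha> * X2"
  "X1 * Bt = C\<^sup>\<dagger> * R0 + A\<^sup>\<dagger> * Pp * B" "X2 * Bt = \<beta>"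
  "Ct = B\<^sup>\<dagger> * X1 + (R0\<^sup>\<dagger> * \<gamma> + \<beta>\<^sup>\<dagger> * Pm * \<alpha>) * X2"
  "X1 * At\<^sup>\<dagger> = A * X1" "X1 * B0 = B" "C @\<^sub>c 0\<^sub>m m p = C * X1"
proof -
  have At_ix: "At $$ (i, j) = (if i < n then if j < n then A\<^sup>\<dagger> $$ (i, j) else (C\<^sup>\<dagger> * \<gamma>) $$ (i, j - n)
      else if j < n then 0 else \<alpha> $$ (i - n, j - n))" if "i < n + p" "j < n + p" for i j
    unfolding At using that A C \<gamma> \<alpha> by (simp del: index_mult_mat(1) adjoint_index)
  have Bt_ix: "Bt $$ (i, j) = (if i < n then (C\<^sup>\<dagger> * R0 + A\<^sup>\<dagger> * Pp * B) $$ (i, j) else \<beta> $$ (i - n, j))" if "i < n + p" "j < m" for i j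
    unfolding Bt append_rows_def using that A B C Pp(1) R0 \<beta> by (simp del: index_mult_mat(1) adjoint_index index_add_mat(1))
  have Ct_ix: "Ct $$ (i, j) = (if j < n then B\<^sup>\<dagger> $$ (i, j) else (R0\<^sup>\<dagger> * \<gamma> + \<beta>\<^sup>\<dagger> * Pm * \<alpha>) $$ (i, j - n))" if "i < m" "j < n + p" for i j
    unfolding Ct append_cols_def using that B R0 \<gamma> \<beta> Pm(1) \<alpha> by (simp del: index_mult_mat(1) adjoint_index index_add_mat(1))
  note ix = At_ix Bt_ix Ct_ix coords_mult_index mult_first_coords_index mult_last_coords_index
  note dl = index_mult_mat(1)
  show "X1 * At = A\<^sup>\<dagger> * X1 + (C\<^sup>\<dagger> * \<gamma>) * X2"
    by (rule eq_matI) (simp_all add: dims ix del: dl adjoint_index)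
  show "X2 * At = \<alpha> * X2"
    by (rule eq_matI) (simp_all add: dims ix del: dl adjoint_index)
  show "X1 * Bt = C\<^sup>\<dagger> * R0 + A\<^sup>\<dagger> * Pp * B"
    by (rule eq_matI) (simp_all add: dims ix del: dl adjoint_index index_add_mat(1))
  show "X2 * Bt = \<beta>"
    by (rule eq_matI) (simp_all add: dims ix del: dl adjoint_index)
  show "Ct = B\<^sup>\<dagger> * X1 + (R0\<^sup>\<dagger> * \<gamma> + \<beta>\<^sup>\<dagger> * Pm * \<alpha>) * X2"
    by (rule eq_matI) (simp_all add: dims ix del: dl adjoint_index)
  show "X1 * At\<^sup>\<dagger> = A * X1"
    by (rule eq_matI) (simp_all add: dims ix del: dl)
  show "X1 * B0 = B" unfolding B0
    by (rule eq_matI) (simp_all add: dims ix del: dl)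
  show "C @\<^sub>c 0\<^sub>m m p = C * X1" unfolding append_cols_def
    by (rule eq_matI) (simp_all add: dims ix del: dl)
qed

text \<open>Both sides equal \<open>Dt + Z + Z\<^sup>*\<close> with \<open>Z = Ct e(At) Bt\<close>. For \<open>R\<close> the triangular form of \<open>At\<close> has to be
  resolved into its diagonal blocks \<open>A\<^sup>\<dagger>\<close> and \<open>\<alpha>\<close>.\<close>

lemma spectral_equality: "mat_star R * R = mat_star \<Psi> * \<Psi>"
proof -
  have A': "A\<^sup>\<dagger> \<in> carrier_mat n n" using A by simp
  have At': "At\<^sup>\<dagger> \<in> carrier_mat (n + p) (n + p)" using data_carriers by simp
  have CG: "C\<^sup>\<dagger> * \<gamma> \<in> carrier_mat n p" by (rule carrier_matI) (simp_all add: dims)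
  note d = dims res_in_resolvent(1)[OF A', THEN carrier_mat_dims] res_in_resolvent(1)[OF \<alpha>, THEN carrier_mat_dims] 
    res_in_resolvent(1)[OF data_carriers(1), THEN carrier_mat_dims]
  let ?Z = "const_mat Ct * res_in At * const_mat Bt"
  have Rr: "R = const_mat R0 + const_mat C * res_out A * const_mat B + const_mat \<gamma> * res_in \<alpha> * const_mat \<beta>"
    unfolding R realize_in_eq realize_out_eq[OF C A B] ..
  have x2: "const_mat X2 * res_in At = res_in \<alpha> * const_mat X2"
    using res_in_intertwine[OF \<alpha> coords_carrier(2) data_carriers(1)] block_decomposition(2) by simp
  have x1: "const_mat X1 * res_in At = res_in (A\<^sup>\<dagger>) * const_mat X1 + res_in (A\<^sup>\<dagger>) * const_mat (C\<^sup>\<dagger> * \<gamma>) * res_in \<alpha> * const_mat X2"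
    by (rule res_in_triangular[OF A' coords_carrier(1) data_carriers(1) \<alpha> coords_carrier(2) CG block_decomposition(1,2)])
  have "?Z = const_mat (B\<^sup>\<dagger>) * (const_mat X1 * res_in At) * const_mat Bt
      + const_mat (R0\<^sup>\<dagger> * \<gamma> + \<beta>\<^sup>\<dagger> * Pm * \<alpha>) * (const_mat X2 * res_in At) * const_mat Bt"
    by (subst block_decomposition(5)) (rule eq_matI, simp_all add: d mat_ring_dim const_mat_hom del: index_mult_mat(1))
  also have "\<dots> = const_mat (B\<^sup>\<dagger>) * res_in (A\<^sup>\<dagger>) * const_mat (X1 * Bt) +
      const_mat (B\<^sup>\<dagger>) * res_in (A\<^sup>\<dagger>) * const_mat (C\<^sup>\<dagger> * \<gamma>) * res_in \<alpha> * const_mat (X2 * Bt) +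
      const_mat (R0\<^sup>\<dagger> * \<gamma> + \<beta>\<^sup>\<dagger> * Pm * \<alpha>) * res_in \<alpha> * const_mat (X2 * Bt)"
    unfolding x1 x2 by (rule eq_matI) (simp_all add: d mat_ring_dim const_mat_hom del: index_mult_mat(1))
  finally have Z: "?Z = \<dots>" .
  have RR: "mat_star R * R = const_mat Dt + ?Z + mat_star ?Z"
    unfolding Z block_decomposition(3,4) unfolding Rr Dt
    by (rule spectral_density[OF A B C R0 \<alpha> \<beta> \<gamma> Pp(1) Pm(1) Pp(2) stein_hermitian[OF A stable(1) Pp(1) C Pp(2)]
          Pm(2) stein_hermitian[OF \<alpha> stable(2) Pm(1) \<gamma> Pm(2)]])
  have C0s: "C0\<^sup>\<dagger> = Bt - At * Q * Ct\<^sup>\<dagger>" unfolding C0 by (simp add: d Q(2) adjoint_minus adjoint_mult assoc_mat_dim)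
  have "minv (D * D) = Di * Di"
  proof (rule minv_unique)
    have "D * D * (Di * Di) = D * (D * Di) * Di" by (simp add: d assoc_mat_dim)
    then show "D * D * (Di * Di) = 1\<^sub>m m" unfolding Di(2) by (simp add: d Di(2))
  qed (use data_carriers Di in auto)
  then have Qr: "Q - At * Q * At\<^sup>\<dagger> = C0\<^sup>\<dagger> * Di * Di * C0"
    unfolding Q_riccati D(2)[symmetric] C0s[symmetric] C0[symmetric] by (simp add: d assoc_mat_dim)
  have Bt': "Bt = C0\<^sup>\<dagger> + At * Q * Ct\<^sup>\<dagger>" unfolding C0s by (rule eq_matI) (simp_all add: d mat_ring_dim const_mat_hom del: index_mult_mat(1))
  have Dt': "Dt = D * D + Ct * Q * Ct\<^sup>\<dagger>" unfolding D(2) by (rule eq_matI) (simp_all add: d mat_ring_dim const_mat_hom del: index_mult_mat(1))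
  have DC: "Di * C0 \<in> carrier_mat m (n + p)" using Di data_carriers by auto
  show ?thesis unfolding RR Dt' unfolding \<Psi> B0 realize_out_eq[OF DC At' data_carriers(5)[unfolded B0]]
    by (rule spectral_factor[OF data_carriers(1,2,3,7) Di(1) data_carriers(6) Q(1) Di(4,5,2,3) Qr Q(2) Bt', symmetric])
qed

lemma A0_eq: "A0 = At\<^sup>\<dagger> - B0 * Di * Di * C0"
  unfolding A0 Di(6) B0 by (simp add: dims assoc_mat_dim)

definition "\<Psi>i = const_mat Di - const_mat (Di * Di * C0) * res_out A0 * const_mat (B0 * Di)"

lemma \<Psi>_inverse: "\<Psi> * \<Psi>i = 1\<^sub>m m" "res_out (At\<^sup>\<dagger>) * const_mat B0 * \<Psi>i = res_out A0 * const_mat (B0 * Di)"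
    "\<Psi>i \<in> carrier_mat m m" "\<Psi> \<in> carrier_mat m m" "minv \<Psi> = \<Psi>i"
proof -
  have At': "At\<^sup>\<dagger> \<in> carrier_mat (n + p) (n + p)" using data_carriers by simp
  note inv = factor_inverse[OF At' data_carriers(5,7) Di(1) data_carriers(6) Di(2), folded A0_eq, folded \<Psi>i_def]
  have DC: "Di * C0 \<in> carrier_mat m (n + p)" using Di data_carriers by auto
  have \<Psi>r: "\<Psi> = const_mat D + const_mat (Di * C0) * res_out (At\<^sup>\<dagger>) * const_mat B0"
    unfolding \<Psi> realize_out_eq[OF DC At' data_carriers(5)] ..
  show 1: "\<Psi> * \<Psi>i = 1\<^sub>m m" "res_out (At\<^sup>\<dagger>) * const_mat B0 * \<Psi>i = res_out A0 * const_mat (B0 * Di)"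
    "\<Psi>i \<in> carrier_mat m m" unfolding \<Psi>r using inv by auto
  show 2: "\<Psi> \<in> carrier_mat m m" unfolding \<Psi>r by (intro carrier_matI) (auto simp: dims)
  show "minv \<Psi> = \<Psi>i" by (rule minv_unique[OF 2 1(3,1)])
qed

lemma R_carrier: "R \<in> carrier_mat m m"
  unfolding R realize_in_eq realize_out_eq[OF C A B] by (intro carrier_matI) (auto simp: dims)

lemma \<Xi>_unitary: "mat_star \<Xi> * \<Xi> = 1\<^sub>m m"
proof -
  note d = R_carrier[THEN carrier_mat_dims] \<Psi>_inverse(3,4)[THEN carrier_mat_dims]
  have "mat_star \<Xi> * \<Xi> = mat_star \<Psi>i * (mat_star R * R) * \<Psi>i"
    unfolding \<Xi> \<Psi>_inverse(5) by (simp add: d mat_star_mult assoc_mat_dim del: mat_star_index)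
  also have "\<dots> = mat_star (\<Psi> * \<Psi>i) * (\<Psi> * \<Psi>i)"
    unfolding spectral_equality by (simp add: d mat_star_mult assoc_mat_dim)
  finally show ?thesis unfolding \<Psi>_inverse(1) by simp
qed

text \<open>The three terms of \<open>R\<close> are multiplied by \<open>\<Psi>\<^sup>-\<^sup>1\<close> one by one. The middle one needs only that \<open>\<Psi>\<^sup>-\<^sup>1\<close> turns
  the state matrix \<open>At\<^sup>\<dagger>\<close> into \<open>A0\<close>, because \<open>[I 0]\<close> intertwines \<open>At\<^sup>\<dagger>\<close> with \<open>A\<close>; the last one uses \<open>Y\<close>.\<close>

lemma \<Xi>_realization: "\<Xi> = const_mat \<Xi>0 + const_mat \<gamma> * res_in \<alpha> * const_mat \<beta>1 + const_mat C1 * res_out A0 * const_mat (B0 * Di)"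
proof -
  have At': "At\<^sup>\<dagger> \<in> carrier_mat (n + p) (n + p)" using data_carriers by simp
  note d = dims res_out_resolvent(1)[OF A, THEN carrier_mat_dims] res_in_resolvent(1)[OF \<alpha>, THEN carrier_mat_dims] 
    res_out_resolvent(1)[OF At', THEN carrier_mat_dims] res_out_resolvent(1)[OF factor_carriers(1), THEN carrier_mat_dims] 
    \<Psi>_inverse(3)[THEN carrier_mat_dims]
  let ?o = "res_out A0" and ?F = "\<beta> * Di * Di * C0" and ?K = "B0 * Di"
  have F: "?F \<in> carrier_mat p (n + p)" by (rule carrier_matI) (simp_all add: d)
  have K: "?K \<in> carrier_mat (n + p) m" by (rule carrier_matI) (simp_all add: d)
  have YF: "Y - \<alpha> * Y * A0 = \<alpha> * ?F" unfolding Y(2) Di(6) by (simp add: d assoc_mat_dim)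
  have \<beta>D: "\<beta> * Di \<in> carrier_mat p m" by (rule carrier_matI) (simp_all add: d)
  note anti = res_in_times_factor_inverse[OF \<alpha> factor_carriers(1) F Y(1) \<beta>D K YF]
  have x1: "res_out A * const_mat X1 = const_mat X1 * res_out (At\<^sup>\<dagger>)"
    using res_out_intertwine[OF A coords_carrier(1) At'] block_decomposition(6) by simp
  have Bc: "const_mat B = const_mat X1 * const_mat B0"
    by (subst block_decomposition(7)[symmetric]) (simp add: const_mat_mult d)
  have A0sq: "A0 ^\<^sub>m 2 = A0 * A0" by (simp add: numeral_2_eq_2 d)
  have "\<Xi> = (const_mat R0 + const_mat C * res_out A * const_mat B + const_mat \<gamma> * res_in \<alpha> * const_mat \<beta>) * \<Psi>i"
    unfolding \<Xi> \<Psi>_inverse(5) R realize_in_eq realize_out_eq[OF C A B] ..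
  also have "\<dots> = const_mat R0 * \<Psi>i + const_mat C * (res_out A * const_mat X1) * const_mat B0 * \<Psi>i 
     + const_mat \<gamma> * (res_in \<alpha> * (const_mat \<beta> * \<Psi>i))"
    unfolding Bc by (simp add: d mat_ring_dim)
  also have "const_mat C * (res_out A * const_mat X1) * const_mat B0 * \<Psi>i = 
      const_mat (C * X1) * (res_out (At\<^sup>\<dagger>) * const_mat B0 * \<Psi>i)"
    unfolding x1 by (simp add: d mat_ring_dim const_mat_mult)
  also have "\<dots> = const_mat (C * X1) * (?o * const_mat ?K)" unfolding \<Psi>_inverse(2) ..
  also have "const_mat \<beta> * \<Psi>i = const_mat (\<beta> * Di) - const_mat ?F * ?o * const_mat ?K"
    unfolding \<Psi>i_def by (rule eq_matI) (simp_all add: d mat_ring_dim const_mat_hom del: index_mult_mat(1))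
  also have "res_in \<alpha> * \<dots> = res_in \<alpha> * const_mat (\<beta> * Di - Y * ?K) - const_mat ((?F + Y * A0) * ?K) 
       - const_mat ((?F + Y * A0) * A0) * ?o * const_mat ?K" by (fact anti)
  also have "const_mat R0 * \<Psi>i = const_mat (R0 * Di) - const_mat (R0 * Di * Di * C0) * ?o * const_mat ?K"
    unfolding \<Psi>i_def by (rule eq_matI) (simp_all add: d mat_ring_dim const_mat_hom del: index_mult_mat(1))
  finally show ?thesis
    unfolding \<Xi>0 C1 \<beta>1 block_decomposition(8) Di(6) A0sq
    by (rule trans, intro eq_matI) (simp_all add: d mat_ring_dim const_mat_hom del: index_mult_mat(1))
qed

end

section \<open>The factorization\<close>

context unitary_factor_data
begin

text \<open>The input matrix of \<open>\<Xi>\<close> is \<open>B0 D\<^sup>-\<^sup>1\<close>; the invertible factor does not affect controllability.\<close>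

lemma controllable_gain_orthogonal:
  assumes con: "controllable_pair A0 B0" and G: "G \<in> carrier_mat (n + p) m"
    and 0: "\<And>j. (B0 * Di)\<^sup>\<dagger> * (A0\<^sup>\<dagger>) ^\<^sub>m j * G = 0\<^sub>m m m"
  shows "G = 0\<^sub>m (n + p) m"
proof (rule controllable_pair_orthogonal[OF factor_carriers(1) data_carriers(5) G con])
  fix j
  have A': "A0\<^sup>\<dagger> \<in> carrier_mat (n + p) (n + p)" using factor_carriers by simp
  note d = dims G[THEN carrier_mat_dims] pow_carrier_mat[OF A', THEN carrier_mat_dims]
  have "B0\<^sup>\<dagger> * (A0\<^sup>\<dagger>) ^\<^sub>m j * G = (D * Di) * B0\<^sup>\<dagger> * (A0\<^sup>\<dagger>) ^\<^sub>m j * G"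
    unfolding Di(2) by (simp add: d one_mult_mat_dim)
  also have "\<dots> = D * ((B0 * Di)\<^sup>\<dagger> * (A0\<^sup>\<dagger>) ^\<^sub>m j * G)"
    by (simp add: d adjoint_mult Di(5) assoc_mat_dim)
  also have "\<dots> = 0\<^sub>m m m" unfolding 0 by (simp add: d)
  finally show "B0\<^sup>\<dagger> * (A0\<^sup>\<dagger>) ^\<^sub>m j * G = 0\<^sub>m m m" .
qed

end

theorem proposition5p1:
  fixes n p m :: nat
    and A B C R0 \<alpha> \<beta> \<gamma> Pp Pm At Bt Ct Dt Q D A0 B0 C0 Y \<Xi>0 C1 \<beta>1 P0 :: "complex mat"
    and R \<Psi> \<Xi> :: "ratmat"
  assumes A: "A \<in> carrier_mat n n" and B: "B \<in> carrier_mat n m"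
    and C: "C \<in> carrier_mat m n" and R0: "R0 \<in> carrier_mat m m"
    and \<alpha>: "\<alpha> \<in> carrier_mat p p" and \<beta>: "\<beta> \<in> carrier_mat p m"
    and \<gamma>: "\<gamma> \<in> carrier_mat m p"
    and stable: "stable_mat A" "stable_mat \<alpha>"
    and R: "R = const_mat R0 + realize_out C A B + realize_in \<gamma> \<alpha> \<beta>"
    and R_regular: "invertible_mat R"
    and R_circle: "\<forall>z. cmod z = 1 \<longrightarrow> \<not> mat_pole R z \<and> \<not> mat_zero R z"
    \<comment> \<open>the Stein equations for $P_+$ and $P_-$\<close>
    and Pp: "Pp \<in> carrier_mat n n" "Pp - A\<^sup>\<dagger> * Pp * A = C\<^sup>\<dagger> * C"
    and Pm: "Pm \<in> carrier_mat p p" "Pm - \<alpha>\<^sup>\<dagger> * Pm * \<alpha> = \<gamma>\<^sup>\<dagger> * \<gamma>"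
    and At: "At = four_block_mat (A\<^sup>\<dagger>) (C\<^sup>\<dagger> * \<gamma>) (0\<^sub>m p n) \<alpha>"
    and Bt: "Bt = (C\<^sup>\<dagger> * R0 + A\<^sup>\<dagger> * Pp * B) @\<^sub>r \<beta>"
    and Ct: "Ct = B\<^sup>\<dagger> @\<^sub>c (R0\<^sup>\<dagger> * \<gamma> + \<beta>\<^sup>\<dagger> * Pm * \<alpha>)"
    and Dt: "Dt = R0\<^sup>\<dagger> * R0 + B\<^sup>\<dagger> * Pp * B + \<beta>\<^sup>\<dagger> * Pm * \<beta>"
    \<comment> \<open>the stabilizing solution $Q$ of the Riccati equation\<close>
    and Q: "Q \<in> carrier_mat (n + p) (n + p)" "Q\<^sup>\<dagger> = Q"
    and Q_riccati: "Q - At * Q * At\<^sup>\<dagger> =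
          (Bt - At * Q * Ct\<^sup>\<dagger>) * minv (Dt - Ct * Q * Ct\<^sup>\<dagger>) * (Bt\<^sup>\<dagger> - Ct * Q * At\<^sup>\<dagger>)"
    and Q_pos: "pos_def_mat (Dt - Ct * Q * Ct\<^sup>\<dagger>)"
    and D: "pos_def_mat D" "D * D = Dt - Ct * Q * Ct\<^sup>\<dagger>"
    and C0: "C0 = Bt\<^sup>\<dagger> - Ct * Q * At\<^sup>\<dagger>"
    and B0: "B0 = Ct\<^sup>\<dagger>"
    and A0: "A0 = At\<^sup>\<dagger> - Ct\<^sup>\<dagger> * (minv D ^\<^sub>m 2) * C0"
    and A0_stable: "stable_mat A0"
    \<comment> \<open>the left unitary factor\<close>
    and \<Psi>: "\<Psi> = const_mat D + realize_out (minv D * C0) (At\<^sup>\<dagger>) B0"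
    and \<Xi>: "\<Xi> = R * minv \<Psi>"
    and Y: "Y \<in> carrier_mat p (n + p)" "Y - \<alpha> * Y * A0 = \<alpha> * \<beta> * (minv D ^\<^sub>m 2) * C0"
    and \<Xi>0: "\<Xi>0 = R0 * minv D - \<gamma> * Y * A0 * B0 * minv D
                - \<gamma> * \<beta> * (minv D ^\<^sub>m 2) * C0 * B0 * minv D"
    and C1: "C1 = (C @\<^sub>c 0\<^sub>m m p) - R0 * (minv D ^\<^sub>m 2) * C0
                - \<gamma> * Y * (A0 ^\<^sub>m 2) - \<gamma> * \<beta> * (minv D ^\<^sub>m 2) * C0 * A0"
    and \<beta>1: "\<beta>1 = (\<beta> - Y * B0) * minv D"
    \<comment> \<open>the Stein equation for $P_0$\<close>
    and P0: "P0 \<in> carrier_mat (n + p) (n + p)" "P0 - A0\<^sup>\<dagger> * P0 * A0 = C1\<^sup>\<dagger> * C1"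
  shows
    "\<Xi> = const_mat \<Xi>0 + realize_in \<gamma> \<alpha> \<beta>1 + realize_out C1 A0 (B0 * minv D)
     \<and> (\<forall>i < n + p. \<forall>k < n + p.
          (\<lambda>j. ((A0\<^sup>\<dagger> ^\<^sub>m j) * C1\<^sup>\<dagger> * C1 * (A0 ^\<^sub>m j)) $$ (i, k)) sums (P0 $$ (i, k)))
     \<and> (let lossless = (\<lambda>BV DV. BV \<in> carrier_mat (n + p) m \<and> DV \<in> carrier_mat m m \<and>
              four_block_mat (A0\<^sup>\<dagger>) (C1\<^sup>\<dagger>) (BV\<^sup>\<dagger>) (DV\<^sup>\<dagger>)
                * four_block_mat P0 (0\<^sub>m (n + p) m) (0\<^sub>m m (n + p)) (1\<^sub>m m)
                * four_block_mat A0 BV C1 DV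
              = four_block_mat P0 (0\<^sub>m (n + p) m) (0\<^sub>m m (n + p)) (1\<^sub>m m))
        in (\<exists>BV DV. lossless BV DV) \<and>
           (\<forall>BV DV. lossless BV DV \<longrightarrow>
              (let V = const_mat DV + realize_out C1 A0 BV;
                   W = mat_star (mat_star V * \<Xi>)
               in bi_inner m V \<and> bi_inner m W \<and>
                  mat_star W = mat_star V * \<Xi> \<and> \<Xi> = V * mat_star W \<and>
                  (spectrum (A0\<^sup>\<dagger>) \<inter> spectrum \<alpha> = {} \<and>
                   observable_pair \<gamma> \<alpha> \<and> observable_pair C1 A0 \<and>
                   controllable_pair \<alpha> \<beta>1 \<and> controllable_pair A0 B0 \<longrightarrow>
                   (\<forall>P1 DWs BWs. P1 \<in> carrier_mat (n + p) p \<and>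
                      A0\<^sup>\<dagger> * P1 - P1 * \<alpha> = - (C1\<^sup>\<dagger> * \<gamma>) \<and>
                      DWs = DV\<^sup>\<dagger> * \<Xi>0 + BV\<^sup>\<dagger> * P0 * B0 * minv D \<and>
                      BWs = DV\<^sup>\<dagger> * \<gamma> + BV\<^sup>\<dagger> * P1 \<longrightarrow>
                      mat_star W = const_mat DWs + realize_in BWs \<alpha> \<beta>1)))))"
proof -
  interpret unitary_factor_data n p m A B C R0 \<alpha> \<beta> \<gamma> Pp Pm At Bt Ct Dt Q D A0 B0 C0 Y \<Xi>0 C1 \<beta>1 R \<Psi> \<Xi>
    by (rule unitary_factor_data.intro) (fact assms)+
  let ?K = "B0 * minv D"
  have K: "?K \<in> carrier_mat (n + p) m" by (rule carrier_matI) (simp_all add: dims)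
  note P0_herm = stein_hermitian[OF factor_carriers(1) A0_stable P0(1) factor_carriers(3) P0(2)]
    and P0_psd = stein_positive_semidefinite[OF factor_carriers(1) A0_stable P0(1) factor_carriers(3) P0(2)]
  note unit = \<Xi>_unitary[unfolded \<Xi>_realization]
  have A0': "A0\<^sup>\<dagger> \<in> carrier_mat (n + p) (n + p)" using factor_carriers by simp
  have stein': "A0\<^sup>\<dagger> * P0 * A0 + C1\<^sup>\<dagger> * C1 = P0"
    unfolding P0(2)[symmetric] by (rule eq_matI) (use P0(1) in \<open>simp_all add: dims del: index_mult_mat(1)\<close>)
  have lossless_blocks: "A0\<^sup>\<dagger> * P0 * BV + C1\<^sup>\<dagger> * DV = 0\<^sub>m (n + p) m \<and> BV\<^sup>\<dagger> * P0 * A0 + DV\<^sup>\<dagger> * C1 = 0\<^sub>m m (n + p)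
      \<and> BV\<^sup>\<dagger> * P0 * BV + DV\<^sup>\<dagger> * DV = 1\<^sub>m m"
    if "BV \<in> carrier_mat (n + p) m" "DV \<in> carrier_mat m m" 
      and "four_block_mat (A0\<^sup>\<dagger>) (C1\<^sup>\<dagger>) (BV\<^sup>\<dagger>) (DV\<^sup>\<dagger>)
                * four_block_mat P0 (0\<^sub>m (n + p) m) (0\<^sub>m m (n + p)) (1\<^sub>m m)
                * four_block_mat A0 BV C1 DV
              = four_block_mat P0 (0\<^sub>m (n + p) m) (0\<^sub>m m (n + p)) (1\<^sub>m m)" for BV DV
  proof -
    note d = that(1,2)[THEN carrier_mat_dims] P0(1)[THEN carrier_mat_dims] dims
    have "four_block_mat (A0\<^sup>\<dagger> * P0 * A0 + C1\<^sup>\<dagger> * C1) (A0\<^sup>\<dagger> * P0 * BV + C1\<^sup>\<dagger> * DV)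
        (BV\<^sup>\<dagger> * P0 * A0 + DV\<^sup>\<dagger> * C1) (BV\<^sup>\<dagger> * P0 * BV + DV\<^sup>\<dagger> * DV) =
      four_block_mat P0 (0\<^sub>m (n + p) m) (0\<^sub>m m (n + p)) (1\<^sub>m m)"
      using that(3) unfolding lossless_block_product[OF factor_carriers(1) that(1) factor_carriers(3) that(2) P0(1)] .
    note inj = four_block_mat_inject[OF this, of "n + p" "n + p" m m]
    show ?thesis
      by (intro conjI inj(2) inj(3) inj(4)) (rule carrier_matI; simp add: d)+
  qed
  show ?thesis unfolding Let_def
  proof (intro conjI allI impI)
    show "\<Xi> = const_mat \<Xi>0 + realize_in \<gamma> \<alpha> \<beta>1 + realize_out C1 A0 ?K"
      unfolding realize_in_eq realize_out_eq[OF factor_carriers(3,1) K] by (rule \<Xi>_realization)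
  next
    fix i k assume "i < n + p" "k < n + p"
    then show "(\<lambda>j. ((A0\<^sup>\<dagger> ^\<^sub>m j) * C1\<^sup>\<dagger> * C1 * (A0 ^\<^sub>m j)) $$ (i, k)) sums (P0 $$ (i, k))"
      by (rule stein_sums[OF factor_carriers(1) A0_stable P0(1) factor_carriers(3) P0(2)])
  next
    obtain BV DV where L: "BV \<in> carrier_mat (n + p) m" "DV \<in> carrier_mat m m"
        "A0\<^sup>\<dagger> * P0 * BV + C1\<^sup>\<dagger> * DV = 0\<^sub>m (n + p) m" "BV\<^sup>\<dagger> * P0 * BV + DV\<^sup>\<dagger> * DV = 1\<^sub>m m"
      by (rule lossless_extension[OF factor_carriers(1,3) P0(1) P0_herm P0_psd P0(2)])
    have "BV\<^sup>\<dagger> * P0 * A0 + DV\<^sup>\<dagger> * C1 = (A0\<^sup>\<dagger> * P0 * BV + C1\<^sup>\<dagger> * DV)\<^sup>\<dagger>"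
      using P0(1) L(1,2) by (simp add: dims adjoint_add adjoint_mult P0_herm assoc_mat_dim)
    then have "BV\<^sup>\<dagger> * P0 * A0 + DV\<^sup>\<dagger> * C1 = 0\<^sub>m m (n + p)" unfolding L(3) by simp
    then have "four_block_mat (A0\<^sup>\<dagger>) (C1\<^sup>\<dagger>) (BV\<^sup>\<dagger>) (DV\<^sup>\<dagger>)
                * four_block_mat P0 (0\<^sub>m (n + p) m) (0\<^sub>m m (n + p)) (1\<^sub>m m)
                * four_block_mat A0 BV C1 DV
              = four_block_mat P0 (0\<^sub>m (n + p) m) (0\<^sub>m m (n + p)) (1\<^sub>m m)"
      unfolding lossless_block_product[OF factor_carriers(1) L(1) factor_carriers(3) L(2) P0(1)] L(3,4) stein' by simp
    with L(1,2) show "\<exists>BV DV. BV \<in> carrier_mat (n + p) m \<and> DV \<in> carrier_mat m m \<and>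
              four_block_mat (A0\<^sup>\<dagger>) (C1\<^sup>\<dagger>) (BV\<^sup>\<dagger>) (DV\<^sup>\<dagger>)
                * four_block_mat P0 (0\<^sub>m (n + p) m) (0\<^sub>m m (n + p)) (1\<^sub>m m)
                * four_block_mat A0 BV C1 DV
              = four_block_mat P0 (0\<^sub>m (n + p) m) (0\<^sub>m m (n + p)) (1\<^sub>m m)" by blast
  next
    fix BV DV
    assume L: "BV \<in> carrier_mat (n + p) m \<and> DV \<in> carrier_mat m m \<and>
              four_block_mat (A0\<^sup>\<dagger>) (C1\<^sup>\<dagger>) (BV\<^sup>\<dagger>) (DV\<^sup>\<dagger>)
                * four_block_mat P0 (0\<^sub>m (n + p) m) (0\<^sub>m m (n + p)) (1\<^sub>m m)
                * four_block_mat A0 BV C1 DV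
              = four_block_mat P0 (0\<^sub>m (n + p) m) (0\<^sub>m m (n + p)) (1\<^sub>m m)"
    then have BV: "BV \<in> carrier_mat (n + p) m" and DV: "DV \<in> carrier_mat m m" by auto
    from lossless_blocks[OF BV DV] L have E: "A0\<^sup>\<dagger> * P0 * BV + C1\<^sup>\<dagger> * DV = 0\<^sub>m (n + p) m"
      "BV\<^sup>\<dagger> * P0 * A0 + DV\<^sup>\<dagger> * C1 = 0\<^sub>m m (n + p)" "BV\<^sup>\<dagger> * P0 * BV + DV\<^sup>\<dagger> * DV = 1\<^sub>m m" by auto
    note fac = unitary_lossless_factorization[OF \<alpha> factor_carriers(1) P0(1) factor_carriers(2,4) \<gamma> factor_carriers(3) K BV DV
        stable(2) A0_stable P0(2) E(2,1,3) unit, folded \<Xi>_realization]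
    note V_eq = realize_out_eq[OF factor_carriers(3,1) BV]
    show "bi_inner m (const_mat DV + realize_out C1 A0 BV)"
      "bi_inner m (mat_star (mat_star (const_mat DV + realize_out C1 A0 BV) * \<Xi>))"
      unfolding V_eq by (fact fac)+
    show "mat_star (mat_star (mat_star (const_mat DV + realize_out C1 A0 BV) * \<Xi>)) = mat_star (const_mat DV + realize_out C1 A0 BV) * \<Xi>"
      by simp
    show "\<Xi> = (const_mat DV + realize_out C1 A0 BV) * mat_star (mat_star (mat_star (const_mat DV + realize_out C1 A0 BV) * \<Xi>))"
      unfolding V_eq mat_star_star by (fact fac)
    fix P1 DWs BWs
    assume min: "spectrum (A0\<^sup>\<dagger>) \<inter> spectrum \<alpha> = {} \<and> observable_pair \<gamma> \<alpha> \<and> observable_pair C1 A0 \<and>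
        controllable_pair \<alpha> \<beta>1 \<and> controllable_pair A0 B0"
      and P1: "P1 \<in> carrier_mat (n + p) p \<and> A0\<^sup>\<dagger> * P1 - P1 * \<alpha> = - (C1\<^sup>\<dagger> * \<gamma>) \<and>
          DWs = DV\<^sup>\<dagger> * \<Xi>0 + BV\<^sup>\<dagger> * P0 * B0 * minv D \<and> BWs = DV\<^sup>\<dagger> * \<gamma> + BV\<^sup>\<dagger> * P1"
    then have P1c: "P1 \<in> carrier_mat (n + p) p" and P1e: "A0\<^sup>\<dagger> * P1 - P1 * \<alpha> = - (C1\<^sup>\<dagger> * \<gamma>)" by auto
    have G: "C1\<^sup>\<dagger> * \<Xi>0 - P1 * \<beta>1 + A0\<^sup>\<dagger> * P0 * ?K = 0\<^sub>m (n + p) m"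
      by (rule quotient_residue_zero[OF \<alpha> factor_carriers(1) P0(1) P1c Pm(1) factor_carriers(2,4) \<gamma> factor_carriers(3) K
            stable(2) A0_stable P0(2) Pm(2) P1e unit])
        (use min controllable_gain_orthogonal in auto)
    have DW: "DWs = DV\<^sup>\<dagger> * \<Xi>0 + BV\<^sup>\<dagger> * P0 * ?K"
      using P1 BV P0(1) by (simp add: dims assoc_mat_dim)
    have BW: "BWs = DV\<^sup>\<dagger> * \<gamma> + BV\<^sup>\<dagger> * P1" using P1 by simp
    show "mat_star (mat_star (mat_star (const_mat DV + realize_out C1 A0 BV) * \<Xi>)) = const_mat DWs + realize_in BWs \<alpha> \<beta>1"
      unfolding mat_star_star V_eq realize_in_eq fac(4) DW BW
      by (rule lossless_quotient_realization[OF \<alpha> factor_carriers(1) P0(1) P1c factor_carriers(2,4) \<gamma> factor_carriers(3) K BV DV P1e G])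
  qed
qed

end
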